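(* Let $\zeta\ge 60$ and $\theta>0$ be constants. For each $n$ let $\lambda=\lambda_n=\frac1{\zeta n}$, let $p=p_n\in(0,1)$ satisfy $p\sqrt n\to\theta$ as $n\to\infty$, and let $$q:=p+\frac{\mathbb{E}|M|}{\binom n2}(1-p),$$ where $\mathbb{E}|M|$ is the expected size of $M\sim\mu_\lambda$. Let $c=1-\frac12\left(\sqrt{\zeta^2+4\zeta}-\zeta\right)\in(0,1)$. Let $\mathcal{P}_\lambda$ be the planted matching model and $\mathcal{Q}=G(n,q)$. As $n\to\infty$, the log-likelihood ratio satisfies $$\log\frac{\mathrm{d}\mathcal{P}_\lambda}{\mathrm{d}\mathcal{Q}}(A)\ \overset{d}{\longrightarrow}\ \mathcal{N}\left(\pm\frac{c^4}{4\theta^2},\ \frac{c^4}{2\theta^2}\right),$$ where "$+$" holds for $A\sim\mathcal{P}_\lambda$ and "$-$" holds for $A\sim\mathcal{Q}$. Consequently, $$\inf_{\psi_n}\Big(\mathbb{P}_{A\sim\mathcal{P}_\lambda}[\psi_n(A)=0]+\mathbb{P}_{A\sim\mathcal{Q}}[\psi_n(A)=1]\Big)=1-\mathsf{TV}(\mathcal{P}_\lambda,\mathcal{Q})\ \longrightarrow\ 2\,\Phi\left(-\frac{c^2}{2\sqrt2\,\theta}\right),$$ where the infimum is over all tests $\psi_n:\{0,1\}^{\binom{[n]}{2}}\to\{0,1\}$.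
   Context: A matching in a graph is a set of pairwise non-adjacent (vertex-disjoint) edges; the empty set is a matching. For a simple graph $G$ and $\lambda>0$, the monomer-dimer Gibbs measure on matchings $M$ of $G$ is $\mu_{\lambda,G}(M)=\lambda^{|M|}/Z_G(\lambda)$ with $Z_G(\lambda)=\sum_{M\subset G}\lambda^{|M|}$ (sum over all matchings $M$ in $G$, where $|M|$ is the number of edges). Write $\mu_\lambda=\mu_{\lambda,K_n}$, where $K_n$ is the complete graph on $[n]=\{1,\dots,n\}$. The planted matching model $\mathcal{P}_\lambda$ (with parameters $n,p,\lambda$) is the law of the adjacency matrix $A$ of a random graph on $[n]$ generated as follows: sample $M\sim\mu_\lambda$; conditionally on $M$, set $A_{ij}=1$ if $\{i,j\}\in M$, and let $A_{ij}\sim\mathrm{Bernoulli}(p)$ independently for $\{i,j\}\notin M$. The null model $\mathcal{Q}=G(n,q)$ is the Erdős–Rényi random graph on $[n]$, with all edges independent $\mathrm{Bernoulli}(q)$. Graphs are identified with elements of $\{0,1\}^{\binom{[n]}{2}}$. $\Phi$ denotes the standard Gaussian cumulative distribution function, $\mathcal{N}(a,b)$ the Gaussian law with mean $a$ and variance $b$, and $\mathsf{TV}$ the total variation distance (supremum over events of the difference of probabilities). *)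

theory Defs
  imports "HOL-Probability.Probability" "HOL-Library.Disjoint_Sets"
begin

text \<open>An edge is a two-element vertex set, and a graph is given by its set of edges. Isolated
  vertices play no role for matchings.\<close>

definition complete_edges :: "nat \<Rightarrow> nat set set" where
  "complete_edges n = {e. e \<subseteq> {1..n} \<and> card e = 2}"

definition matchings :: "'v set set \<Rightarrow> 'v set set set" where
  "matchings E = {M. M \<subseteq> E \<and> disjoint M}"

definition partition_function :: "real \<Rightarrow> 'v set set \<Rightarrow> real" where
  "partition_function lam E = (\<Sum>M\<in>matchings E. lam ^ card M)"

definition monomer_dimer :: "real \<Rightarrow> 'v set set \<Rightarrow> 'v set set pmf" where
  "monomer_dimer lam E =
     embed_pmf (\<lambda>M. if M \<in> matchings E then lam ^ card M / partition_function lam E else 0)"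

lemma complete_edges_finite: "finite (complete_edges n)"
  by (rule finite_subset[of _ "Pow {1..n}"]) (auto simp: complete_edges_def)

lemma matchings_finite: "finite E \<Longrightarrow> finite (matchings E)"
  by (rule finite_subset[of _ "Pow E"]) (auto simp: matchings_def)

lemma partition_function_pos:
  assumes "finite E" "lam \<ge> 0"
  shows "partition_function lam E > 0"
proof -
  have "{} \<in> matchings E" by (simp add: matchings_def)
  with assms show ?thesis unfolding partition_function_def
    by (intro sum_pos2[of _ "{}"]) (auto simp: matchings_finite)
qed

text \<open>\<^const>\<open>embed_pmf\<close> is only meaningful for nonnegative weights of total mass one; this is the case
  here, so \<^const>\<open>monomer_dimer\<close> has the intended probabilities.\<close>

lemma pmf_monomer_dimer:
  assumes "finite E" "lam \<ge> 0"
  shows "pmf (monomer_dimer lam E) M =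
           (if M \<in> matchings E then lam ^ card M / partition_function lam E else 0)"
proof -
  let ?f = "\<lambda>M. if M \<in> matchings E then lam ^ card M / partition_function lam E else 0"
  have pos: "partition_function lam E > 0" using assms by (rule partition_function_pos)
  have nonneg: "?f M \<ge> 0" for M using pos assms by auto
  have "(\<integral>\<^sup>+ M. ennreal (?f M) \<partial>count_space UNIV) = (\<Sum>M\<in>matchings E. ennreal (?f M))"
    by (rule nn_integral_count_space'[OF matchings_finite[OF assms(1)]]) auto
  also have "\<dots> = ennreal (\<Sum>M\<in>matchings E. ?f M)"
    by (rule sum_ennreal) (use nonneg in blast)
  also have "(\<Sum>M\<in>matchings E. ?f M) = (\<Sum>M\<in>matchings E. lam ^ card M) / partition_function lam E"
    by (simp add: sum_divide_distrib)
  also have "\<dots> = 1" using pos by (simp add: partition_function_def)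
  finally have "(\<integral>\<^sup>+ M. ennreal (?f M) \<partial>count_space UNIV) = 1" by simp
  with nonneg show ?thesis unfolding monomer_dimer_def by (subst pmf_embed_pmf) auto
qed

text \<open>An adjacency matrix, i.e. an element of $\{0,1\}^{\binom{[n]}{2}}$, is a function
  from edges to Booleans; entries outside \<^term>\<open>complete_edges n\<close> carry no information and are
  fixed to \<^term>\<open>False\<close> by both laws.\<close>

type_synonym adjacency = "nat set \<Rightarrow> bool"

definition planted_matching :: "nat \<Rightarrow> real \<Rightarrow> real \<Rightarrow> adjacency pmf" where
  "planted_matching n p lam =
     bind_pmf (monomer_dimer lam (complete_edges n)) (\<lambda>M.
       Pi_pmf (complete_edges n) False
         (\<lambda>e. if e \<in> M then return_pmf True else bernoulli_pmf p))"

definition erdos_renyi :: "nat \<Rightarrow> real \<Rightarrow> adjacency pmf" where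
  "erdos_renyi n q = Pi_pmf (complete_edges n) False (\<lambda>_. bernoulli_pmf q)"

definition log_likelihood_ratio :: "'a measure \<Rightarrow> 'a measure \<Rightarrow> 'a \<Rightarrow> real" where
  "log_likelihood_ratio P Q x = ln (enn2real (RN_deriv Q P x))"

definition total_variation :: "'a measure \<Rightarrow> 'a measure \<Rightarrow> real" where
  "total_variation P Q = (SUP B\<in>sets P. \<bar>measure P B - measure Q B\<bar>)"

text \<open>Parametrised by the variance, whereas \<^const>\<open>normal_density\<close> takes the standard deviation.\<close>

definition gaussian :: "real \<Rightarrow> real \<Rightarrow> real measure" where
  "gaussian a v = density lborel (\<lambda>x. ennreal (normal_density a (sqrt v) x))"

definition std_normal_cdf :: "real \<Rightarrow> real" where
  "std_normal_cdf = cdf std_normal_distribution"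

end

theory Submission imports Defs "HOL-Real_Asymp.Real_Asymp" begin

text \<open>For matchings \<open>M\<close>, \<open>M'\<close> the likelihood ratios given the planted matching have \<open>Q\<close>-inner product
  depending only on the overlap \<open>|M \<inter> M'|\<close> and the two sizes, so the second moment of the likelihood
  ratio \<open>L\<close>, restricted to matchings of typical size, is a factorial-moment series in the overlap;
  its limit superior is at most \<open>e^v\<close> with \<open>v = c^4 / (2 \<theta>^2)\<close>. Since \<open>q\<close> matches the edge
  densities, the leading statistic is the signed count of wedges (pairs of adjacent edges). Its
  normalisation \<open>W\<close> is asymptotically \<open>N(0, v)\<close> under the null law, by a differential equation for its
  characteristic function, and \<open>N(v, v)\<close> under the planted law, because a matching has no wedges.
  The lognormal variable \<open>exp (W - v / 2)\<close> has second moment \<open>e^v\<close> and the same inner product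
  with \<open>L\<close>, so \<open>L\<close> and \<open>exp (W - v / 2)\<close> are asymptotically equal; the limit laws of \<open>log L\<close> follow,
  and the total variation distance is \<open>P(L > 1) - Q(L > 1)\<close>.\<close>

section \<open>Products of Bernoulli variables\<close>

text \<open>The obstacle is the scale of the second moment. Its exponent has three terms of order
  \<open>sqrt n\<close>: from the mismatch of \<open>p\<close> and \<open>q\<close> over all pairs,
  from the sizes of the two matchings, and from their overlap. They cancel when the sizes are near
  the mean, and \<open>v\<close> is what is left at order one. Hence every factor is expanded to
  second order, and the overlap has to be treated as drawing without replacement; a Poisson
  approximation of it would leave \<open>c^3 / (2 \<theta>^2)\<close> instead. The deviations of the
  two sizes enter through their product divided by \<open>n^(3/2)\<close>. Truncating the sizes
  makes this negligible, and a second-moment bound of order \<open>n\<close> for the deviation of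
  \<open>card M\<close> is then all the concentration that is used. The constant \<open>c\<close> is
  the limiting fraction of covered vertices: balancing insertion and deletion of an edge makes the
  uncovered fraction \<open>u = 1 - c\<close> a root of
  \<open>u^2 / \<zeta> + u = 1\<close>.\<close>

definition bernoulli_product :: "'e set \<Rightarrow> real \<Rightarrow> ('e \<Rightarrow> bool) pmf" where
  "bernoulli_product E p = Pi_pmf E False (\<lambda>_. bernoulli_pmf p)"

lemma finite_set_bernoulli_product:
  "finite E \<Longrightarrow> finite (set_pmf (bernoulli_product E p))"
  unfolding bernoulli_product_def by (subst set_Pi_pmf) auto

lemma integrable_bernoulli_product [simp, intro]:
  fixes f :: "_ \<Rightarrow> 'b::{banach, second_countable_topology}"
  shows "finite E \<Longrightarrow> integrable (measure_pmf (bernoulli_product E p)) f"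
  by (rule integrable_measure_pmf_finite[OF finite_set_bernoulli_product])

lemma expectation_bernoulli_product_insert:
  fixes G :: "('e \<Rightarrow> bool) \<Rightarrow> 'b::{banach, second_countable_topology}"
  assumes "finite A" "e \<notin> A" "0 \<le> p" "p \<le> 1"
  shows "measure_pmf.expectation (bernoulli_product (insert e A) p) G =
    p *\<^sub>R measure_pmf.expectation (bernoulli_product A p) (\<lambda>x. G (x(e := True))) +
    (1 - p) *\<^sub>R measure_pmf.expectation (bernoulli_product A p) (\<lambda>x. G (x(e := False)))"
proof -
  have "bernoulli_product (insert e A) p =
      bernoulli_pmf p \<bind> (\<lambda>y. map_pmf (\<lambda>f. f(e := y)) (bernoulli_product A p))"
    unfolding bernoulli_product_def Pi_pmf_insert'[OF assms(1,2)]
    by (simp add: map_pmf_def)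
  moreover have "measure_pmf.expectation (bernoulli_pmf p \<bind> (\<lambda>y. map_pmf (\<lambda>f. f(e := y)) (bernoulli_product A p))) G =
     (\<Sum>y\<in>UNIV. pmf (bernoulli_pmf p) y *\<^sub>R
        measure_pmf.expectation (map_pmf (\<lambda>f. f(e := y)) (bernoulli_product A p)) G)"
    using finite_set_bernoulli_product[OF assms(1), of p] by (intro pmf_expectation_bind) auto
  ultimately show ?thesis
    using assms by (simp add: UNIV_bool add.commute)
qed

text \<open>Independence of coordinate \<open>e\<close> in the form used throughout: that
  \<open>F\<close> does not depend on \<open>e\<close> is expressed by invariance under updates at
  \<open>e\<close>, which is easily checked for concrete sums.\<close>

lemma expectation_bernoulli_product_split:
  fixes F :: "('e \<Rightarrow> bool) \<Rightarrow> 'b::{real_normed_algebra_1, banach, second_countable_topology}"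
  assumes E: "finite E" "e \<in> E" and p: "0 \<le> p" "p \<le> 1"
    and F: "\<And>x b. F (x(e := b)) = F x"
  shows "measure_pmf.expectation (bernoulli_product E p) (\<lambda>x. h (x e) * F x) =
    (p *\<^sub>R h True + (1 - p) *\<^sub>R h False) * measure_pmf.expectation (bernoulli_product E p) F"
proof -
  define A where "A = E - {e}"
  have EA: "E = insert e A" "finite A" "e \<notin> A" using E by (auto simp: A_def)
  show ?thesis
    unfolding EA(1) expectation_bernoulli_product_insert[OF EA(2,3) p]
    by (simp add: F EA(2) algebra_simps)
qed

section \<open>Moments of linear and quadratic forms in centred entries\<close>

definition centred :: "real \<Rightarrow> ('e \<Rightarrow> bool) \<Rightarrow> 'e \<Rightarrow> real" where
  "centred p x e = of_bool (x e) - p"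

lemma centred_upd [simp]:
  "centred p (x(e := b)) f = (if f = e then of_bool b - p else centred p x f)"
  by (simp add: centred_def)

lemma abs_centred_le_1: "0 \<le> p \<Longrightarrow> p \<le> 1 \<Longrightarrow> \<bar>centred p x e\<bar> \<le> 1"
  by (auto simp: centred_def)

lemma expectation_centred_mult:
  fixes F :: "('e \<Rightarrow> bool) \<Rightarrow> real"
  assumes E: "finite E" "e \<in> E" and p: "0 \<le> p" "p \<le> 1"
    and F: "\<And>x b. F (x(e := b)) = F x"
  shows "measure_pmf.expectation (bernoulli_product E p) (\<lambda>x. centred p x e * F x) = 0"
    and "measure_pmf.expectation (bernoulli_product E p) (\<lambda>x. (centred p x e)\<^sup>2 * F x) =
      p * (1 - p) * measure_pmf.expectation (bernoulli_product E p) F"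
proof -
  show "measure_pmf.expectation (bernoulli_product E p) (\<lambda>x. centred p x e * F x) = 0"
    using expectation_bernoulli_product_split[OF E p F, of "\<lambda>b. of_bool b - p"]
    by (simp add: centred_def)
  show "measure_pmf.expectation (bernoulli_product E p) (\<lambda>x. (centred p x e)\<^sup>2 * F x) =
      p * (1 - p) * measure_pmf.expectation (bernoulli_product E p) F"
    using expectation_bernoulli_product_split[OF E p F, of "\<lambda>b. (of_bool b - p)\<^sup>2"]
    by (simp add: centred_def) (simp add: algebra_simps power2_eq_square)
qed

lemma expectation_centred:
  assumes "finite E" "e \<in> E" "0 \<le> p" "p \<le> 1"
  shows "measure_pmf.expectation (bernoulli_product E p) (\<lambda>x. centred p x e) = 0"
    and "measure_pmf.expectation (bernoulli_product E p) (\<lambda>x. (centred p x e)\<^sup>2) = p * (1 - p)"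
  using expectation_centred_mult[OF assms, of "\<lambda>_. 1"] by simp_all

text \<open>Orthogonality by induction: the new edge \<open>e\<close> does not occur in the sum over
  \<open>A\<close>, so the cross term has a factor of mean zero.\<close>

lemma expectation_centred_linear_sq:
  assumes E: "finite E" and p: "0 \<le> p" "p \<le> 1"
  shows "A \<subseteq> E \<Longrightarrow> measure_pmf.expectation (bernoulli_product E p)
      (\<lambda>x. (\<Sum>e\<in>A. H e * centred p x e)\<^sup>2) = p * (1 - p) * (\<Sum>e\<in>A. (H e)\<^sup>2)"
proof (induction A rule: infinite_finite_induct)
  case (infinite A)
  then show ?case using E finite_subset by blast
next
  case empty
  then show ?case by simp
next
  case (insert e A)
  let ?M = "bernoulli_product E p"
  let ?S = "\<lambda>x. \<Sum>e\<in>A. H e * centred p x e"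
  have S: "?S (x(e := b)) = ?S x" for x b
    using insert by (intro sum.cong) (auto simp: fun_upd_def centred_def)
  have "measure_pmf.expectation ?M (\<lambda>x. (\<Sum>e\<in>insert e A. H e * centred p x e)\<^sup>2) =
      measure_pmf.expectation ?M (\<lambda>x. (H e)\<^sup>2 * (centred p x e)\<^sup>2 + 2 * H e * (centred p x e * ?S x) + (?S x)\<^sup>2)"
    using insert by (simp add: power2_sum power_mult_distrib mult_ac add_ac)
  also have "\<dots> = (H e)\<^sup>2 * measure_pmf.expectation ?M (\<lambda>x. (centred p x e)\<^sup>2) +
      2 * H e * measure_pmf.expectation ?M (\<lambda>x. centred p x e * ?S x) +
      measure_pmf.expectation ?M (\<lambda>x. (?S x)\<^sup>2)"
    using E by simp
  also have "\<dots> = (H e)\<^sup>2 * (p * (1 - p)) + 0 + p * (1 - p) * (\<Sum>e\<in>A. (H e)\<^sup>2)"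
    using insert expectation_centred(2)[OF E _ p, of e] expectation_centred_mult(1)[OF E _ p S]
    by simp
  finally show ?case using insert by (simp add: algebra_simps)
qed

text \<open>In the expansion of the fourth power of the old sum plus the new entry, the terms with
  odd exponents vanish, because both the entry and the old sum have mean zero.\<close>

lemma expectation_centred_sum_pow4:
  assumes E: "finite E" and p: "0 \<le> p" "p \<le> 1"
  shows "A \<subseteq> E \<Longrightarrow> measure_pmf.expectation (bernoulli_product E p)
      (\<lambda>x. (\<Sum>e\<in>A. centred p x e) ^ 4) \<le> p * real (card A) + 3 * (p * real (card A))\<^sup>2"
proof (induction A rule: infinite_finite_induct)
  case (infinite A)
  then show ?case using E finite_subset by blast
next
  case empty
  then show ?case by simp
next
  case (insert e A)
  let ?M = "bernoulli_product E p"
  let ?S = "\<lambda>x. \<Sum>e\<in>A. centred p x e"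
  have S: "?S (x(e := b)) = ?S x" for x b
    using insert by (intro sum.cong) (auto simp: fun_upd_def centred_def)
  have S2: "(?S (x(e := b)))\<^sup>2 = (?S x)\<^sup>2" for x b
    by (simp only: S)
  have S3: "(?S (x(e := b)))^3 = (?S x)^3" for x b
    by (simp only: S)
  have sq: "measure_pmf.expectation ?M (\<lambda>x. (?S x)\<^sup>2) = p * (1 - p) * real (card A)"
    using expectation_centred_linear_sq[OF E p, of A "\<lambda>_. 1"] insert by simp
  have m4: "measure_pmf.expectation ?M (\<lambda>x. (centred p x e)^4) \<le> p"
  proof -
    have "measure_pmf.expectation ?M (\<lambda>x. (centred p x e)^4) \<le>
        measure_pmf.expectation ?M (\<lambda>x. (centred p x e)^2)"
    proof (intro integral_mono integrable_bernoulli_product E)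
      fix x show "(centred p x e)^4 \<le> (centred p x e)^2"
        using power_decreasing[of 2 4 "\<bar>centred p x e\<bar>"] abs_centred_le_1[OF p, of x e] by simp
    qed
    also have "\<dots> \<le> p" using expectation_centred(2)[OF E _ p, of e] insert p
      by (simp add: mult_left_le)
    finally show ?thesis .
  qed
  have m3: "measure_pmf.expectation ?M (\<lambda>x. (centred p x e)^3 * ?S x) = 0"
  proof -
    have S: "?S (x(e := b)) = ?S x" for x b
      using insert by (intro sum.cong) (auto simp: fun_upd_def centred_def)
    have "measure_pmf.expectation ?M ?S = 0"
      using insert expectation_centred(1)[OF E _ p] E by (simp add: subset_iff)
    thus ?thesis
      using expectation_bernoulli_product_split[OF E _ p S, where h = "\<lambda>b. (of_bool b - p)^3"] insert
      by (simp add: centred_def)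
  qed
  have "measure_pmf.expectation ?M (\<lambda>x. (\<Sum>e\<in>insert e A. centred p x e) ^ 4) =
     measure_pmf.expectation ?M (\<lambda>x. (centred p x e)^4 + 4 * ((centred p x e)^3 * ?S x)
       + 6 * ((centred p x e)\<^sup>2 * (?S x)\<^sup>2) + 4 * (centred p x e * (?S x)^3) + (?S x)^4)"
  proof (intro Bochner_Integration.integral_cong refl)
    have *: "(a + b)^4 = a^4 + 4*(a^3*b) + 6*(a\<^sup>2*b\<^sup>2) + 4*(a*b^3) + b^4" for a b :: real
      by (simp add: power4_eq_xxxx power3_eq_cube power2_eq_square algebra_simps)
    fix x show "(\<Sum>e\<in>insert e A. centred p x e) ^ 4 = (centred p x e)^4 + 4 * ((centred p x e)^3 * ?S x)
       + 6 * ((centred p x e)\<^sup>2 * (?S x)\<^sup>2) + 4 * (centred p x e * (?S x)^3) + (?S x)^4"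
      using insert by (simp add: *)
  qed
  also have "\<dots> = measure_pmf.expectation ?M (\<lambda>x. (centred p x e)^4) + 
      6 * (p * (1 - p) * (p * (1 - p) * real (card A))) + measure_pmf.expectation ?M (\<lambda>x. (?S x)^4)"
    using E m3 expectation_centred_mult(1)[OF E _ p S3] expectation_centred_mult(2)[OF E _ p S2] insert sq by simp
  also have "\<dots> \<le> p + 6 * (p * (p * real (card A))) + (p * real (card A) + 3 * (p * real (card A))\<^sup>2)"
  proof (intro add_mono m4 insert.IH mult_left_mono)
    show "p * (1 - p) * (p * (1 - p) * real (card A)) \<le> p * (p * real (card A))"
      using p by (intro mult_mono mult_nonneg_nonneg) (auto simp: mult_left_le)
  qed (use insert in auto)
  \<comment> \<open>The growth \<open>3 * p^2 * (2 * card A + 1)\<close> of the square absorbs the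
    mixed term \<open>6 * p^2 * card A\<close>.\<close>
  also have "\<dots> \<le> p * real (card (insert e A)) + 3 * (p * real (card (insert e A)))\<^sup>2"
    using insert p by (simp add: algebra_simps power2_eq_square)
  finally show ?case .
qed

text \<open>The factor 2 arises because the sum runs over ordered pairs, so that every monomial
  occurs twice. A new edge \<open>e\<close> adds twice \<open>centred p x e\<close> times a linear
  form, which is orthogonal to the old form.\<close>

lemma expectation_centred_quadratic_offdiag:
  assumes E: "finite E" and p: "0 \<le> p" "p \<le> 1"
    and sym: "\<And>e f. K e f = K f e"
  shows "A \<subseteq> E \<Longrightarrow> measure_pmf.expectation (bernoulli_product E p)
      (\<lambda>x. (\<Sum>e\<in>A. \<Sum>f\<in>A - {e}. K e f * centred p x e * centred p x f)\<^sup>2)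
      = 2 * (p * (1 - p))\<^sup>2 * (\<Sum>e\<in>A. \<Sum>f\<in>A - {e}. (K e f)\<^sup>2)"
proof (induction A rule: infinite_finite_induct)
  case (infinite A)
  then show ?case using E finite_subset by blast
next
  case empty
  then show ?case by simp
next
  case (insert e A)
  let ?M = "bernoulli_product E p"
  let ?T = "\<lambda>x. \<Sum>e\<in>A. \<Sum>f\<in>A - {e}. K e f * centred p x e * centred p x f"
  let ?S = "\<lambda>x. \<Sum>f\<in>A. K e f * centred p x f"
  have S: "?S (x(e := b)) = ?S x" for x b
    using insert by (intro sum.cong) (auto simp: fun_upd_def centred_def)
  have T: "?T (x(e := b)) = ?T x" for x b
    using insert by (intro sum.cong refl) auto
  have ST: "?S (x(e := b)) * ?T (x(e := b)) = ?S x * ?T x" for x b by (simp only: S T)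
  have S2: "(?S (x(e := b)))\<^sup>2 = (?S x)\<^sup>2" for x b by (simp only: S)
  have split: "(\<Sum>e'\<in>insert e A. \<Sum>f\<in>insert e A - {e'}. g e' f) =
     (\<Sum>f\<in>A. g e f) + (\<Sum>f\<in>A. g f e) + (\<Sum>e'\<in>A. \<Sum>f\<in>A - {e'}. g e' f)" for g :: "'a \<Rightarrow> 'a \<Rightarrow> real"
  proof -
    have "(\<Sum>e'\<in>insert e A. \<Sum>f\<in>insert e A - {e'}. g e' f) =
      (\<Sum>f\<in>A. g e f) + (\<Sum>e'\<in>A. \<Sum>f\<in>insert e A - {e'}. g e' f)"
      using insert by (subst sum.insert) (auto simp: insert_Diff_if)
    also have "(\<Sum>e'\<in>A. \<Sum>f\<in>insert e A - {e'}. g e' f) = (\<Sum>e'\<in>A. g e' e + (\<Sum>f\<in>A - {e'}. g e' f))"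
    proof (intro sum.cong refl)
      fix e' assume "e' \<in> A"
      then have "insert e A - {e'} = insert e (A - {e'})" using insert by auto
      then show "(\<Sum>f\<in>insert e A - {e'}. g e' f) = g e' e + (\<Sum>f\<in>A - {e'}. g e' f)"
        using insert by simp
    qed
    finally show ?thesis by (simp add: sum.distrib)
  qed
  have eqT: "(\<Sum>e'\<in>insert e A. \<Sum>f\<in>insert e A - {e'}. K e' f * centred p x e' * centred p x f)
     = 2 * (centred p x e * ?S x) + ?T x" for x
    unfolding split by (simp add: sum_distrib_left sym[of _ e] mult_ac sum.distrib)
  have "measure_pmf.expectation ?M
      (\<lambda>x. (\<Sum>e'\<in>insert e A. \<Sum>f\<in>insert e A - {e'}. K e' f * centred p x e' * centred p x f)\<^sup>2)
    = measure_pmf.expectation ?M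
      (\<lambda>x. 4 * ((centred p x e)\<^sup>2 * (?S x)\<^sup>2) + 4 * (centred p x e * (?S x * ?T x)) + (?T x)\<^sup>2)"
    unfolding eqT by (simp add: power2_sum power_mult_distrib mult_ac add_ac)
  also have "\<dots> = 4 * (p * (1 - p) * measure_pmf.expectation ?M (\<lambda>x. (?S x)\<^sup>2)) +
      measure_pmf.expectation ?M (\<lambda>x. (?T x)\<^sup>2)"
    using E expectation_centred_mult(1)[OF E _ p ST] expectation_centred_mult(2)[OF E _ p S2] insert
    by simp
  also have "\<dots> = 4 * (p * (1 - p) * (p * (1 - p) * (\<Sum>f\<in>A. (K e f)\<^sup>2))) +
      2 * (p * (1 - p))\<^sup>2 * (\<Sum>e\<in>A. \<Sum>f\<in>A - {e}. (K e f)\<^sup>2)"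
    using insert expectation_centred_linear_sq[OF E p, of A "K e"] by simp
  also have "\<dots> = 2 * (p * (1 - p))\<^sup>2 * (\<Sum>e'\<in>insert e A. \<Sum>f\<in>insert e A - {e'}. (K e' f)\<^sup>2)"
    unfolding split by (simp add: sym[of _ e] algebra_simps power2_eq_square)
  finally show ?case .
qed

section \<open>Quadratic forms of centred Bernoulli variables\<close>

text \<open>Jensen's inequality, proved as nonnegativity of the variance of the absolute
  value.\<close>

lemma integral_abs_le_sqrt_second_moment:
  fixes X :: "'a \<Rightarrow> real"
  assumes "finite (set_pmf M)"
  shows "measure_pmf.expectation M (\<lambda>x. \<bar>X x\<bar>) \<le> sqrt (measure_pmf.expectation M (\<lambda>x. (X x)\<^sup>2))"
proof -
  note [simp] = integrable_measure_pmf_finite[OF assms]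
  let ?m = "measure_pmf.expectation M (\<lambda>x. \<bar>X x\<bar>)"
  have "0 \<le> measure_pmf.expectation M (\<lambda>x. (\<bar>X x\<bar> - ?m)\<^sup>2)"
    by simp
  also have "\<dots> = measure_pmf.expectation M (\<lambda>x. (X x)\<^sup>2 - 2 * ?m * \<bar>X x\<bar> + ?m\<^sup>2)"
    by (simp add: power2_diff mult_ac)
  also have "\<dots> = measure_pmf.expectation M (\<lambda>x. (X x)\<^sup>2) - ?m\<^sup>2"
    by (simp add: power2_eq_square)
  finally show ?thesis by (intro real_le_rsqrt) simp
qed

lemma abs_cube: "\<bar>d\<bar> ^ 3 = \<bar>d\<bar> * d\<^sup>2" for d :: real
  by (simp add: power3_eq_cube power2_eq_square)

text \<open>A symmetric \<open>\<Delta>\<close>-regular relation on the coordinates. The application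
  is the line graph of the complete graph, where two neighbouring edges form a wedge.
  \<open>form\<close> runs over ordered pairs and counts each wedge twice, hence the division by 2
  wherever it is normalised.\<close>

locale regular_form =
  fixes E :: "'e set" and nb :: "'e \<Rightarrow> 'e set" and \<Delta> :: nat and p :: real
  assumes fin: "finite E" and p01: "0 \<le> p" "p \<le> 1"
    and nb_sub: "e \<in> E \<Longrightarrow> nb e \<subseteq> E" and nb_irrefl: "e \<notin> nb e"
    and nb_sym: "e \<in> E \<Longrightarrow> f \<in> E \<Longrightarrow> f \<in> nb e \<longleftrightarrow> e \<in> nb f"
    and nb_card: "e \<in> E \<Longrightarrow> card (nb e) = \<Delta>"
begin

abbreviation "\<mu> \<equiv> bernoulli_product E p"
abbreviation "\<beta> x e \<equiv> centred p x e"
abbreviation "v \<equiv> p * (1 - p)"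

definition "nbsum x e = (\<Sum>f\<in>nb e. \<beta> x f)"
definition "form x = (\<Sum>e\<in>E. \<beta> x e * nbsum x e)"

lemma v_nonneg: "0 \<le> v" and v_le: "v \<le> p" and v_le4: "v \<le> 1 / 4"
proof -
  show "0 \<le> v" "v \<le> p" using p01 by (auto simp: mult_left_le)
  have "0 \<le> (p - 1 / 2)\<^sup>2" by simp
  thus "v \<le> 1 / 4" by (simp add: power2_diff algebra_simps power2_eq_square)
qed

lemma finite_nb: "e \<in> E \<Longrightarrow> finite (nb e)"
  using nb_sub fin finite_subset by blast

lemma integrable_bernoulli [simp]: "integrable (measure_pmf \<mu>) (f :: _ \<Rightarrow> 'b::{banach, second_countable_topology})"
  using fin by simp

lemma nbsum_upd: "nbsum (x(e := b)) e = nbsum x e"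
  unfolding nbsum_def using nb_irrefl by (intro sum.cong) (auto simp: fun_upd_def centred_def)

text \<open>By symmetry of the relation, \<open>e\<close> occurs in \<open>form\<close> once as
  first and once as second index, so twice its own term is everything that involves it. The
  remainder is the leave-one-out form, independent of coordinate \<open>e\<close>.\<close>

lemma form_minus_upd:
  assumes "e \<in> E"
  shows "form (x(e := b)) - 2 * (\<beta> (x(e := b)) e * nbsum (x(e := b)) e) =
    form x - 2 * (\<beta> x e * nbsum x e)"
proof -
  have eq: "form y - 2 * (\<beta> y e * nbsum y e) = (\<Sum>g\<in>E - {e}. \<beta> y g * (\<Sum>f\<in>nb g - {e}. \<beta> y f))" for y
  proof -
    have "form y = \<beta> y e * nbsum y e + (\<Sum>g\<in>E - {e}. \<beta> y g * nbsum y g)"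
      unfolding form_def using assms fin by (simp add: sum.remove)
    also have "(\<Sum>g\<in>E - {e}. \<beta> y g * nbsum y g) = (\<Sum>g\<in>E - {e}. \<beta> y g * (\<Sum>f\<in>nb g - {e}. \<beta> y f) +
       (if g \<in> nb e then \<beta> y e * \<beta> y g else 0))"
    proof (intro sum.cong refl)
      fix g assume g: "g \<in> E - {e}"
      have "nbsum y g = (\<Sum>f\<in>nb g - {e}. \<beta> y f) + (if g \<in> nb e then \<beta> y e else 0)"
        unfolding nbsum_def using g assms nb_sym[of e g] finite_nb[of g]
        by (auto simp: sum.remove)
      then show "\<beta> y g * nbsum y g = \<beta> y g * (\<Sum>f\<in>nb g - {e}. \<beta> y f) +
         (if g \<in> nb e then \<beta> y e * \<beta> y g else 0)"
        by (simp add: algebra_simps)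
    qed
    also have "\<dots> = (\<Sum>g\<in>E - {e}. \<beta> y g * (\<Sum>f\<in>nb g - {e}. \<beta> y f)) + (\<Sum>g\<in>nb e. \<beta> y e * \<beta> y g)"
    proof -
      have "(\<Sum>g\<in>E - {e}. if g \<in> nb e then \<beta> y e * \<beta> y g else 0) = (\<Sum>g\<in>(E - {e}) \<inter> nb e. \<beta> y e * \<beta> y g)"
        using fin by (simp add: sum.inter_restrict)
      also have "(E - {e}) \<inter> nb e = nb e" using nb_irrefl nb_sub[OF assms] by auto
      finally show ?thesis by (simp add: sum.distrib)
    qed
    finally show ?thesis by (simp add: nbsum_def sum_distrib_left)
  qed
  show ?thesis unfolding eq
    by (intro sum.cong arg_cong2[where f = "(*)"]) auto
qed

lemma nbsum_sq: "e \<in> E \<Longrightarrow> measure_pmf.expectation \<mu> (\<lambda>x. (nbsum x e)\<^sup>2) = v * real \<Delta>"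
  unfolding nbsum_def using expectation_centred_linear_sq[OF fin p01 nb_sub, of e "\<lambda>_. 1"] nb_card by simp

definition "cubic_bound = 2 * (p * real \<Delta>) + 3 * (p * real \<Delta>)\<^sup>2"

text \<open>The cube is at most the sum of the second and the fourth power, whose moments are known.
  Third absolute moments measure all remainders when the exponential is expanded in one
  coordinate.\<close>

lemma nbsum_cube: 
  assumes "e \<in> E"
  shows "measure_pmf.expectation \<mu> (\<lambda>x. \<bar>nbsum x e\<bar> ^ 3) \<le> cubic_bound"
proof -
  have "measure_pmf.expectation \<mu> (\<lambda>x. \<bar>nbsum x e\<bar> ^ 3) \<le>
      measure_pmf.expectation \<mu> (\<lambda>x. (nbsum x e)\<^sup>2 + (nbsum x e) ^ 4)"
  proof (intro integral_mono integrable_bernoulli)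
    fix x
    have *: "a ^ 3 \<le> a\<^sup>2 + a ^ 4" if "a \<ge> 0" for a :: real
    proof (cases "a \<le> 1")
      case True
      then have "a ^ 3 \<le> a\<^sup>2" using that by (intro power_decreasing) auto
      thus ?thesis using that by (simp add: add_increasing2)
    next
      case False
      then have "a ^ 3 \<le> a ^ 4" by (intro power_increasing) auto
      thus ?thesis by (simp add: add_increasing)
    qed
    from *[of "\<bar>nbsum x e\<bar>"] show "\<bar>nbsum x e\<bar> ^ 3 \<le> (nbsum x e)\<^sup>2 + (nbsum x e) ^ 4" by simp
  qed
  also have "\<dots> = v * real \<Delta> + measure_pmf.expectation \<mu> (\<lambda>x. (nbsum x e) ^ 4)"
    using nbsum_sq[OF assms] by simp
  also have "\<dots> \<le> p * real \<Delta> + (p * real \<Delta> + 3 * (p * real \<Delta>)\<^sup>2)"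
  proof (intro add_mono)
    show "v * real \<Delta> \<le> p * real \<Delta>" by (intro mult_right_mono v_le) auto
    show "measure_pmf.expectation \<mu> (\<lambda>x. (nbsum x e) ^ 4) \<le> p * real \<Delta> + 3 * (p * real \<Delta>)\<^sup>2"
      unfolding nbsum_def using expectation_centred_sum_pow4[OF fin p01 nb_sub[OF assms]] nb_card[OF assms] by simp
  qed
  finally show ?thesis by (simp add: cubic_bound_def)
qed

lemma centred_sq: "(\<beta> x e)\<^sup>2 = v + (1 - 2 * p) * \<beta> x e"
  by (auto simp: centred_def power2_eq_square algebra_simps)

text \<open>Expanding the squares gives a quadratic form whose kernel is the number of common
  neighbours. \<open>centred_sq\<close> turns its diagonal into the mean plus a linear form
  \<open>X\<close>; the off-diagonal part \<open>Y\<close> has small variance because the kernel is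
  at most \<open>\<Delta>\<close> and sums to \<open>card E * \<Delta>^2\<close>.\<close>

lemma sum_nbsum_sq_deviation:
  "measure_pmf.expectation \<mu> (\<lambda>x. \<bar>(\<Sum>e\<in>E. (nbsum x e)\<^sup>2) - real (card E) * real \<Delta> * v\<bar>) \<le>
    real \<Delta> * sqrt (real (card E) * p) + p * sqrt (2 * real (card E) * real \<Delta> ^ 3)"
proof -
  define K where "K f g = real (card {e \<in> E. f \<in> nb e \<and> g \<in> nb e})" for f g
  have Kalt: "K f g = (\<Sum>e\<in>E. of_bool (f \<in> nb e \<and> g \<in> nb e))" for f g
    unfolding K_def using fin by (simp add: Int_def)
  have Ksym: "K f g = K g f" for f g unfolding K_def by (simp add: conj_commute)
  have Kdiag: "K f f = real \<Delta>" if "f \<in> E" for f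
  proof -
    have "{e \<in> E. f \<in> nb e \<and> f \<in> nb e} = nb f" using that nb_sym nb_sub by blast
    thus ?thesis unfolding K_def using nb_card that by simp
  qed
  have Kle: "K f g \<le> real \<Delta>" if "f \<in> E" for f g
    unfolding Kdiag[OF that, symmetric] unfolding K_def using fin
    by (intro of_nat_mono card_mono) auto
  define X where "X x = (\<Sum>f\<in>E. (real \<Delta> * (1 - 2 * p)) * \<beta> x f)" for x
  define Y where "Y x = (\<Sum>f\<in>E. \<Sum>g\<in>E - {f}. K f g * \<beta> x f * \<beta> x g)" for x
  have sumK: "(\<Sum>f\<in>E. \<Sum>g\<in>E. K f g * F f g) = (\<Sum>e\<in>E. \<Sum>f\<in>nb e. \<Sum>g\<in>nb e. F f g)" for F
  proof -
    have "(\<Sum>f\<in>E. \<Sum>g\<in>E. K f g * F f g) = (\<Sum>f\<in>E. \<Sum>g\<in>E. \<Sum>e\<in>E. if f \<in> nb e \<and> g \<in> nb e then F f g else 0)"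
      unfolding Kalt sum_distrib_right by (intro sum.cong refl) auto
    also have "\<dots> = (\<Sum>e\<in>E. \<Sum>f\<in>E. \<Sum>g\<in>E. if f \<in> nb e \<and> g \<in> nb e then F f g else 0)"
      by (rule trans[OF sum.cong[OF refl, OF sum.swap] sum.swap])
    also have "\<dots> = (\<Sum>e\<in>E. \<Sum>f\<in>nb e. \<Sum>g\<in>nb e. F f g)"
    proof (rule sum.cong[OF refl])
      fix e assume e: "e \<in> E"
      have s: "(\<Sum>f\<in>E. if f \<in> nb e then H f else 0) = (\<Sum>f\<in>nb e. H f)" for H :: "'e \<Rightarrow> real"
      proof -
        have "E \<inter> nb e = nb e" using nb_sub[OF e] by auto
        thus ?thesis using fin by (simp add: sum.inter_restrict[symmetric])
      qed
      have "(\<Sum>f\<in>E. \<Sum>g\<in>E. if f \<in> nb e \<and> g \<in> nb e then F f g else 0) =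
         (\<Sum>f\<in>E. if f \<in> nb e then (\<Sum>g\<in>E. if g \<in> nb e then F f g else 0) else 0)"
        by (intro sum.cong refl) auto
      then show "(\<Sum>f\<in>E. \<Sum>g\<in>E. if f \<in> nb e \<and> g \<in> nb e then F f g else 0) = (\<Sum>f\<in>nb e. \<Sum>g\<in>nb e. F f g)"
        by (simp only: s)
    qed
    finally show ?thesis .
  qed
  have eq: "(\<Sum>e\<in>E. (nbsum x e)\<^sup>2) - real (card E) * real \<Delta> * v = X x + Y x" for x
  proof -
    have "(\<Sum>e\<in>E. (nbsum x e)\<^sup>2) = (\<Sum>f\<in>E. \<Sum>g\<in>E. K f g * (\<beta> x f * \<beta> x g))"
      unfolding sumK nbsum_def power2_eq_square sum_product ..
    also have "\<dots> = (\<Sum>f\<in>E. K f f * (\<beta> x f * \<beta> x f) + (\<Sum>g\<in>E - {f}. K f g * (\<beta> x f * \<beta> x g)))"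
      using fin by (intro sum.cong refl) (simp add: sum.remove)
    also have "\<dots> = (\<Sum>f\<in>E. real \<Delta> * v + (real \<Delta> * (1 - 2 * p)) * \<beta> x f + (\<Sum>g\<in>E - {f}. K f g * \<beta> x f * \<beta> x g))"
    proof (intro sum.cong refl)
      fix f assume "f \<in> E"
      have "K f f * (\<beta> x f * \<beta> x f) = real \<Delta> * v + (real \<Delta> * (1 - 2 * p)) * \<beta> x f"
        unfolding Kdiag[OF \<open>f \<in> E\<close>] power2_eq_square[symmetric] centred_sq by (simp add: algebra_simps)
      thus "K f f * (\<beta> x f * \<beta> x f) + (\<Sum>g\<in>E - {f}. K f g * (\<beta> x f * \<beta> x g)) =
         real \<Delta> * v + (real \<Delta> * (1 - 2 * p)) * \<beta> x f + (\<Sum>g\<in>E - {f}. K f g * \<beta> x f * \<beta> x g)"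
        by (simp add: mult.assoc)
    qed
    finally show ?thesis by (simp add: sum.distrib X_def Y_def)
  qed
  have X2: "measure_pmf.expectation \<mu> (\<lambda>x. (X x)\<^sup>2) \<le> (real \<Delta>)\<^sup>2 * (real (card E) * p)"
  proof -
    have "measure_pmf.expectation \<mu> (\<lambda>x. (X x)\<^sup>2) = v * (real (card E) * (real \<Delta> * (1 - 2 * p))\<^sup>2)"
      unfolding X_def using expectation_centred_linear_sq[OF fin p01, of E "\<lambda>_. real \<Delta> * (1 - 2 * p)"] by simp
    also have "\<dots> = (real \<Delta>)\<^sup>2 * (real (card E) * (v * (1 - 2 * p)\<^sup>2))"
      by (simp add: power_mult_distrib)
    also have "\<dots> \<le> (real \<Delta>)\<^sup>2 * (real (card E) * (p * 1))"
      using p01 by (intro mult_left_mono mult_mono v_le) (auto simp: abs_square_le_1)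
    finally show ?thesis by simp
  qed
  have Y2: "measure_pmf.expectation \<mu> (\<lambda>x. (Y x)\<^sup>2) \<le> p\<^sup>2 * (2 * real (card E) * real \<Delta> ^ 3)"
  proof -
    have "measure_pmf.expectation \<mu> (\<lambda>x. (Y x)\<^sup>2) = 2 * v\<^sup>2 * (\<Sum>f\<in>E. \<Sum>g\<in>E - {f}. (K f g)\<^sup>2)"
      unfolding Y_def by (rule expectation_centred_quadratic_offdiag[OF fin p01 Ksym order.refl])
    also have "\<dots> \<le> 2 * p\<^sup>2 * (\<Sum>f\<in>E. \<Sum>g\<in>E. K f g * real \<Delta>)"
    proof (intro mult_mono power_mono v_le sum_mono)
      fix f assume f: "f \<in> E"
      have "(\<Sum>g\<in>E - {f}. (K f g)\<^sup>2) \<le> (\<Sum>g\<in>E. (K f g)\<^sup>2)"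
        using fin by (intro sum_mono2) auto
      also have "\<dots> \<le> (\<Sum>g\<in>E. K f g * real \<Delta>)"
        unfolding power2_eq_square using Kle f by (intro sum_mono mult_left_mono) (auto simp: K_def)
      finally show "(\<Sum>g\<in>E - {f}. (K f g)\<^sup>2) \<le> (\<Sum>g\<in>E. K f g * real \<Delta>)" .
    qed (use v_nonneg in \<open>auto intro!: sum_nonneg\<close>)
    also have "\<dots> = p\<^sup>2 * (2 * real (card E) * real \<Delta> ^ 3)"
    proof -
      have "(\<Sum>f\<in>E. \<Sum>g\<in>E. K f g * real \<Delta>) = (\<Sum>e\<in>E. \<Sum>f\<in>nb e. \<Sum>g\<in>nb e. real \<Delta>)"
        by (rule sumK)
      also have "\<dots> = real (card E) * real \<Delta> ^ 3"
        using nb_card by (simp add: power3_eq_cube)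
      finally show ?thesis by simp
    qed
    finally show ?thesis .
  qed
  have "measure_pmf.expectation \<mu> (\<lambda>x. \<bar>X x + Y x\<bar>) \<le> measure_pmf.expectation \<mu> (\<lambda>x. \<bar>X x\<bar> + \<bar>Y x\<bar>)"
    by (intro integral_mono integrable_bernoulli) simp
  also have "\<dots> = measure_pmf.expectation \<mu> (\<lambda>x. \<bar>X x\<bar>) + measure_pmf.expectation \<mu> (\<lambda>x. \<bar>Y x\<bar>)"
    by simp
  also have "\<dots> \<le> sqrt ((real \<Delta>)\<^sup>2 * (real (card E) * p)) + sqrt (p\<^sup>2 * (2 * real (card E) * real \<Delta> ^ 3))"
    using integral_abs_le_sqrt_second_moment[OF finite_set_bernoulli_product[OF fin, of p]]
    by (intro add_mono order.trans[OF _ real_sqrt_le_mono[OF X2]] order.trans[OF _ real_sqrt_le_mono[OF Y2]])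
  also have "\<dots> = real \<Delta> * sqrt (real (card E) * p) + p * sqrt (2 * real (card E) * real \<Delta> ^ 3)"
    using p01 by (simp add: real_sqrt_mult)
  finally have final: "measure_pmf.expectation \<mu> (\<lambda>x. \<bar>X x + Y x\<bar>) \<le>
    real \<Delta> * sqrt (real (card E) * p) + p * sqrt (2 * real (card E) * real \<Delta> ^ 3)" .
  show ?thesis by (simp only: eq final)
qed

definition "char_form \<kappa> t = measure_pmf.expectation \<mu> (\<lambda>x. iexp (t * (\<kappa> * form x / 2)))"

lemma char_form_deriv:
  "(char_form \<kappa> has_vector_derivative
     measure_pmf.expectation \<mu> (\<lambda>x. \<i> * of_real (\<kappa> * form x / 2) * iexp (t * (\<kappa> * form x / 2)))) (at t within S)"
proof -
  note fs = finite_set_bernoulli_product[OF fin, of p]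
  have eq: "measure_pmf.expectation \<mu> g = (\<Sum>x\<in>set_pmf \<mu>. pmf \<mu> x *\<^sub>R g x)" for g :: "_ \<Rightarrow> complex"
    by (rule integral_measure_pmf[OF fs]) auto
  have "((\<lambda>z. exp (\<i> * (z * of_real a))) has_field_derivative \<i> * of_real a * iexp (t * a)) (at (of_real t))" for a :: real
    by (auto intro!: derivative_eq_intros)
  from has_vector_derivative_real_field[OF this]
  have d: "((\<lambda>t. iexp (t * a)) has_vector_derivative \<i> * of_real a * iexp (t * a)) (at t within S)" for a :: real
    by simp
  show ?thesis unfolding char_form_def[abs_def] eq
    by (intro has_vector_derivative_sum bounded_linear.has_vector_derivative[OF bounded_linear_scaleR_right] d)
qed

text \<open>An approximate Stein identity. The exponent is \<open>R x + y x\<close> with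
  \<open>R\<close> free of coordinate \<open>e\<close>. Expanding in \<open>y\<close>, the constant
  term has mean zero and the linear one yields the factor \<open>v\<close> once coordinate
  \<open>e\<close> is integrated out. The quadratic remainder, and putting \<open>R + y\<close> back
  in place of \<open>R\<close>, each cost a third absolute moment of \<open>nbsum\<close>.\<close>

lemma char_form_term:
  assumes e: "e \<in> E"
  shows "cmod (measure_pmf.expectation \<mu> (\<lambda>x. of_real (\<beta> x e * nbsum x e) * iexp (t * (\<kappa> * form x / 2)))
     - \<i> * of_real (t * \<kappa> * v) * measure_pmf.expectation \<mu> (\<lambda>x. of_real ((nbsum x e)\<^sup>2) * iexp (t * (\<kappa> * form x / 2))))
     \<le> t\<^sup>2 * \<kappa>\<^sup>2 * p * cubic_bound"
proof -
  define R where "R x = t * (\<kappa> * (form x - 2 * (\<beta> x e * nbsum x e)) / 2)" for x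
  define y where "y x = t * \<kappa> * (\<beta> x e * nbsum x e)" for x
  define D where "D x = nbsum x e" for x
  have W: "iexp (t * (\<kappa> * form x / 2)) = iexp (R x) * iexp (y x)" for x
    unfolding R_def y_def by (simp add: exp_add[symmetric] algebra_simps add_divide_distrib diff_divide_distrib)
  have Rupd: "R (x(e := b)) = R x" for x b unfolding R_def form_minus_upd[OF e] ..
  have Dupd: "D (x(e := b)) = D x" for x b unfolding D_def by (rule nbsum_upd)
  note split = expectation_bernoulli_product_split[OF fin e p01]
  define \<rho> where "\<rho> x = iexp (y x) - 1 - \<i> * y x" for x
  have \<rho>: "cmod (\<rho> x) \<le> (y x)\<^sup>2 / 2" for x
    using iexp_approx1[of "y x" 1] by (simp add: \<rho>_def diff_diff_eq power2_eq_square)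
  have D3: "measure_pmf.expectation \<mu> (\<lambda>x. \<bar>D x\<bar> ^ 3) \<le> cubic_bound"
    unfolding D_def by (rule nbsum_cube[OF e])
  have D3upd: "\<bar>D (x(e := b))\<bar> ^ 3 = \<bar>D x\<bar> ^ 3" for x b by (simp only: Dupd)
  let ?m3 = "measure_pmf.expectation \<mu> (\<lambda>x. \<bar>D x\<bar> ^ 3)"
  have m3: "0 \<le> ?m3" by simp
  have A: "measure_pmf.expectation \<mu> (\<lambda>x. of_real (\<beta> x e) * (of_real (D x) * iexp (R x))) = 0"
    using split[where h = "\<lambda>b. of_real (of_bool b - p)" and F = "\<lambda>x. of_real (D x) * iexp (R x)"]
    by (simp add: Rupd Dupd centred_def) (simp add: scaleR_conv_of_real algebra_simps)
  have B: "measure_pmf.expectation \<mu> (\<lambda>x. of_real ((\<beta> x e)\<^sup>2) * (of_real ((D x)\<^sup>2) * iexp (R x))) =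
     of_real v * measure_pmf.expectation \<mu> (\<lambda>x. of_real ((D x)\<^sup>2) * iexp (R x))"
  proof -
    have hv: "p *\<^sub>R of_real ((1 - p)\<^sup>2) + (1 - p) *\<^sub>R of_real (p\<^sup>2) = (of_real v :: complex)"
      unfolding scaleR_conv_of_real of_real_mult[symmetric] of_real_add[symmetric]
      by (intro arg_cong[where f = of_real]) (simp add: algebra_simps power2_eq_square)
    show ?thesis
      using split[where h = "\<lambda>b. of_real ((of_bool b - p)\<^sup>2)" and F = "\<lambda>x. of_real ((D x)\<^sup>2) * iexp (R x)"]
      unfolding Rupd Dupd centred_def
      by (simp only: simp_thms of_bool_eq diff_0 power2_minus hv)
  qed
  have C: "cmod (measure_pmf.expectation \<mu> (\<lambda>x. of_real (\<beta> x e * D x) * iexp (R x) * \<rho> x))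
     \<le> t\<^sup>2 * \<kappa>\<^sup>2 / 2 * (v * ?m3)"
  proof -
    have "cmod (measure_pmf.expectation \<mu> (\<lambda>x. of_real (\<beta> x e * D x) * iexp (R x) * \<rho> x)) \<le>
       measure_pmf.expectation \<mu> (\<lambda>x. cmod (of_real (\<beta> x e * D x) * iexp (R x) * \<rho> x))"
      by (rule integral_norm_bound)
    also have "\<dots> \<le> measure_pmf.expectation \<mu> (\<lambda>x. t\<^sup>2 * \<kappa>\<^sup>2 / 2 * ((\<beta> x e)\<^sup>2 * \<bar>D x\<bar> ^ 3))"
    proof (intro integral_mono integrable_bernoulli)
      fix x
      have "cmod (of_real (\<beta> x e * D x) * iexp (R x) * \<rho> x) \<le> (\<bar>\<beta> x e\<bar> * \<bar>D x\<bar>) * ((y x)\<^sup>2 / 2)"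
        using mult_left_mono[OF \<rho>[of x], of "\<bar>\<beta> x e\<bar> * \<bar>D x\<bar>"] by (simp add: norm_mult abs_mult)
      also have "\<dots> = \<bar>\<beta> x e\<bar> * (t\<^sup>2 * \<kappa>\<^sup>2 / 2 * ((\<beta> x e)\<^sup>2 * \<bar>D x\<bar> ^ 3))"
        by (simp add: y_def D_def abs_cube power_mult_distrib)
      also have "\<dots> \<le> 1 * (t\<^sup>2 * \<kappa>\<^sup>2 / 2 * ((\<beta> x e)\<^sup>2 * \<bar>D x\<bar> ^ 3))"
        by (intro mult_right_mono abs_centred_le_1 p01) auto
      finally show "cmod (of_real (\<beta> x e * D x) * iexp (R x) * \<rho> x) \<le> t\<^sup>2 * \<kappa>\<^sup>2 / 2 * ((\<beta> x e)\<^sup>2 * \<bar>D x\<bar> ^ 3)" by simp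
    qed
    also have "\<dots> = t\<^sup>2 * \<kappa>\<^sup>2 / 2 * (v * ?m3)"
      using expectation_centred_mult(2)[OF fin e p01 D3upd] by simp
    finally show ?thesis .
  qed
  have Dd: "cmod (measure_pmf.expectation \<mu> (\<lambda>x. of_real ((D x)\<^sup>2) * iexp (R x)) -
      measure_pmf.expectation \<mu> (\<lambda>x. of_real ((D x)\<^sup>2) * (iexp (R x) * iexp (y x))))
      \<le> \<bar>t\<bar> * \<bar>\<kappa>\<bar> * (2 * v * ?m3)"
  proof -
    have "cmod (measure_pmf.expectation \<mu> (\<lambda>x. of_real ((D x)\<^sup>2) * iexp (R x)) -
      measure_pmf.expectation \<mu> (\<lambda>x. of_real ((D x)\<^sup>2) * (iexp (R x) * iexp (y x)))) =
      cmod (measure_pmf.expectation \<mu> (\<lambda>x. of_real ((D x)\<^sup>2) * iexp (R x) * (1 - iexp (y x))))"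
      by (subst Bochner_Integration.integral_diff[OF integrable_bernoulli integrable_bernoulli, symmetric])
         (auto intro!: arg_cong[where f = cmod] Bochner_Integration.integral_cong simp: algebra_simps)
    also have "\<dots> \<le> measure_pmf.expectation \<mu> (\<lambda>x. cmod (of_real ((D x)\<^sup>2) * iexp (R x) * (1 - iexp (y x))))"
      by (rule integral_norm_bound)
    also have "\<dots> \<le> measure_pmf.expectation \<mu> (\<lambda>x. \<bar>t\<bar> * \<bar>\<kappa>\<bar> * (\<bar>\<beta> x e\<bar> * \<bar>D x\<bar> ^ 3))"
    proof (intro integral_mono integrable_bernoulli)
      fix x
      have "cmod (1 - iexp (y x)) \<le> \<bar>y x\<bar>"
        using iexp_approx1[of "y x" 0] by (simp add: norm_minus_commute)
      then have "cmod (of_real ((D x)\<^sup>2) * iexp (R x) * (1 - iexp (y x))) \<le> (D x)\<^sup>2 * \<bar>y x\<bar>"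
        by (simp add: norm_mult mult_left_mono norm_power)
      also have "\<dots> = \<bar>t\<bar> * \<bar>\<kappa>\<bar> * (\<bar>\<beta> x e\<bar> * \<bar>D x\<bar> ^ 3)"
        by (simp add: y_def D_def abs_mult abs_cube)
      finally show "cmod (of_real ((D x)\<^sup>2) * iexp (R x) * (1 - iexp (y x))) \<le> \<bar>t\<bar> * \<bar>\<kappa>\<bar> * (\<bar>\<beta> x e\<bar> * \<bar>D x\<bar> ^ 3)" .
    qed
    also have "\<dots> = \<bar>t\<bar> * \<bar>\<kappa>\<bar> * (2 * v * ?m3)"
    proof -
      have hv: "p *\<^sub>R \<bar>1 - p\<bar> + (1 - p) *\<^sub>R \<bar>- p\<bar> = 2 * v" using p01 by (simp add: algebra_simps)
      have "measure_pmf.expectation \<mu> (\<lambda>x. \<bar>\<beta> x e\<bar> * \<bar>D x\<bar> ^ 3) = 2 * v * ?m3"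
        using split[where h = "\<lambda>b. \<bar>of_bool b - p\<bar>", OF D3upd]
        unfolding centred_def by (simp only: of_bool_eq diff_0 hv)
      thus ?thesis by (simp only: integral_mult_right_zero)
    qed
    finally show ?thesis .
  qed
  have eq: "measure_pmf.expectation \<mu> (\<lambda>x. of_real (\<beta> x e * nbsum x e) * iexp (t * (\<kappa> * form x / 2)))
      - \<i> * of_real (t * \<kappa> * v) * measure_pmf.expectation \<mu> (\<lambda>x. of_real ((nbsum x e)\<^sup>2) * iexp (t * (\<kappa> * form x / 2)))
     = \<i> * of_real (t * \<kappa> * v) * (measure_pmf.expectation \<mu> (\<lambda>x. of_real ((D x)\<^sup>2) * iexp (R x)) -
      measure_pmf.expectation \<mu> (\<lambda>x. of_real ((D x)\<^sup>2) * (iexp (R x) * iexp (y x))))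
      + measure_pmf.expectation \<mu> (\<lambda>x. of_real (\<beta> x e * D x) * iexp (R x) * \<rho> x)"
  proof -
    have "measure_pmf.expectation \<mu> (\<lambda>x. of_real (\<beta> x e * nbsum x e) * iexp (t * (\<kappa> * form x / 2))) =
      measure_pmf.expectation \<mu> (\<lambda>x. of_real (\<beta> x e) * (of_real (D x) * iexp (R x)) +
       \<i> * of_real (t * \<kappa>) * (of_real ((\<beta> x e)\<^sup>2) * (of_real ((D x)\<^sup>2) * iexp (R x))) +
       of_real (\<beta> x e * D x) * iexp (R x) * \<rho> x)"
    proof (intro Bochner_Integration.integral_cong refl)
      fix x
      have *: "iexp (y x) = 1 + \<i> * y x + \<rho> x" by (simp add: \<rho>_def)
      show "of_real (\<beta> x e * nbsum x e) * iexp (t * (\<kappa> * form x / 2)) =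
       of_real (\<beta> x e) * (of_real (D x) * iexp (R x)) +
       \<i> * of_real (t * \<kappa>) * (of_real ((\<beta> x e)\<^sup>2) * (of_real ((D x)\<^sup>2) * iexp (R x))) +
       of_real (\<beta> x e * D x) * iexp (R x) * \<rho> x"
      proof -
        have "b * d * (R * (1 + \<i> * (tk * (b * d)) + r)) =
          b * (d * R) + \<i> * tk * (b\<^sup>2 * (d\<^sup>2 * R)) + b * d * R * r" for b d R tk r :: complex
          by (simp add: algebra_simps power2_eq_square)
        thus ?thesis unfolding W * unfolding D_def y_def of_real_mult of_real_power .
      qed
    qed
    also have "\<dots> = \<i> * of_real (t * \<kappa> * v) * measure_pmf.expectation \<mu> (\<lambda>x. of_real ((D x)\<^sup>2) * iexp (R x)) +
       measure_pmf.expectation \<mu> (\<lambda>x. of_real (\<beta> x e * D x) * iexp (R x) * \<rho> x)"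
      by (simp only: Bochner_Integration.integral_add[OF integrable_bernoulli integrable_bernoulli] integral_mult_right_zero A B add_0 of_real_mult mult.assoc)
    finally show ?thesis unfolding W D_def by (simp only: right_diff_distrib diff_add_eq)
  qed
  have "cmod (measure_pmf.expectation \<mu> (\<lambda>x. of_real (\<beta> x e * nbsum x e) * iexp (t * (\<kappa> * form x / 2)))
     - \<i> * of_real (t * \<kappa> * v) * measure_pmf.expectation \<mu> (\<lambda>x. of_real ((nbsum x e)\<^sup>2) * iexp (t * (\<kappa> * form x / 2))))
     \<le> \<bar>t\<bar> * \<bar>\<kappa>\<bar> * v * (\<bar>t\<bar> * \<bar>\<kappa>\<bar> * (2 * v * ?m3)) + t\<^sup>2 * \<kappa>\<^sup>2 / 2 * (v * ?m3)"
  proof -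
    have nrm: "cmod (\<i> * of_real a * z) = \<bar>a\<bar> * cmod z" for a z by (simp add: norm_mult)
    have "\<bar>t * \<kappa> * v\<bar> = \<bar>t\<bar> * \<bar>\<kappa>\<bar> * v" using v_nonneg by (simp only: abs_mult[of "t * \<kappa>"] abs_mult[of t] abs_of_nonneg)
    thus ?thesis unfolding eq using v_nonneg
      by (intro order.trans[OF norm_triangle_ineq] add_mono C) (simp only: nrm, intro mult_left_mono Dd, simp)
  qed
  also have "\<dots> = (t\<^sup>2 * \<kappa>\<^sup>2) * (v * (2 * v + 1 / 2)) * ?m3"
  proof -
    have "\<bar>t\<bar> * \<bar>\<kappa>\<bar> * v * (\<bar>t\<bar> * \<bar>\<kappa>\<bar> * (2 * v * ?m3)) = (\<bar>t\<bar> * \<bar>\<kappa>\<bar>)\<^sup>2 * (v * (2 * v)) * ?m3"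
      by (simp only: power2_eq_square ac_simps)
    also have "(\<bar>t\<bar> * \<bar>\<kappa>\<bar>)\<^sup>2 = t\<^sup>2 * \<kappa>\<^sup>2" by (simp add: power_mult_distrib)
    finally have F: "\<bar>t\<bar> * \<bar>\<kappa>\<bar> * v * (\<bar>t\<bar> * \<bar>\<kappa>\<bar> * (2 * v * ?m3)) = t\<^sup>2 * \<kappa>\<^sup>2 * (v * (2 * v)) * ?m3" .
    show ?thesis unfolding F by (simp add: distrib_left distrib_right)
  qed
  \<comment> \<open>\<open>v <= 1 / 4\<close> gives \<open>2 * v + 1 / 2 <= 1\<close>.\<close>
  also have "\<dots> \<le> (t\<^sup>2 * \<kappa>\<^sup>2) * (p * 1) * cubic_bound"
    using v_nonneg v_le4 v_le p01 m3 by (intro mult_mono D3) auto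
  finally show ?thesis by simp
qed

text \<open>Since \<open>nbsum x e\<close> does not involve the coordinate \<open>e\<close>, expanding the exponential in that
  coordinate turns the derivative of the characteristic function into a multiple of the function.\<close>

lemma char_form_ode:
  "cmod (vector_derivative (char_form \<kappa>) (at t) + of_real (t * (\<kappa>\<^sup>2 * v\<^sup>2 * real (card E) * real \<Delta> / 2)) * char_form \<kappa> t)
    \<le> t\<^sup>2 * (\<bar>\<kappa>\<bar> ^ 3 * real (card E) * p * cubic_bound) +
      \<bar>t\<bar> * (\<kappa>\<^sup>2 * p * (real \<Delta> * sqrt (real (card E) * p) + p * sqrt (2 * real (card E) * real \<Delta> ^ 3)))"
proof -
  let ?I = "\<lambda>x. iexp (t * (\<kappa> * form x / 2))"
  let ?A = "\<lambda>e. measure_pmf.expectation \<mu> (\<lambda>x. of_real (\<beta> x e * nbsum x e) * ?I x)"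
  let ?B = "\<lambda>e. measure_pmf.expectation \<mu> (\<lambda>x. of_real ((nbsum x e)\<^sup>2) * ?I x)"
  let ?V = "\<lambda>x. (\<Sum>e\<in>E. (nbsum x e)\<^sup>2) - real (card E) * real \<Delta> * v"
  let ?dev = "real \<Delta> * sqrt (real (card E) * p) + p * sqrt (2 * real (card E) * real \<Delta> ^ 3)"
  have "vector_derivative (char_form \<kappa>) (at t) = measure_pmf.expectation \<mu> (\<lambda>x. \<i> * of_real (\<kappa> * form x / 2) * ?I x)"
    by (rule vector_derivative_at[OF char_form_deriv])
  also have "\<dots> = measure_pmf.expectation \<mu> (\<lambda>x. \<Sum>e\<in>E. \<i> * of_real (\<kappa> / 2) * (of_real (\<beta> x e * nbsum x e) * ?I x))"
    unfolding form_def by (intro Bochner_Integration.integral_cong refl)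
      (simp add: sum_distrib_left sum_distrib_right sum_divide_distrib mult_ac)
  also have "\<dots> = (\<Sum>e\<in>E. \<i> * of_real (\<kappa> / 2) * ?A e)"
    by (simp only: Bochner_Integration.integral_sum[OF integrable_bernoulli] integral_mult_right_zero)
  finally have d: "vector_derivative (char_form \<kappa>) (at t) = (\<Sum>e\<in>E. \<i> * of_real (\<kappa> / 2) * ?A e)" .
  have V: "(\<Sum>e\<in>E. ?B e) = measure_pmf.expectation \<mu> (\<lambda>x. of_real (?V x) * ?I x) +
     of_real (real (card E) * real \<Delta> * v) * char_form \<kappa> t"
  proof -
    have "(\<Sum>e\<in>E. ?B e) = measure_pmf.expectation \<mu> (\<lambda>x. \<Sum>e\<in>E. of_real ((nbsum x e)\<^sup>2) * ?I x)"
      by (simp only: Bochner_Integration.integral_sum[OF integrable_bernoulli])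
    also have "\<dots> = measure_pmf.expectation \<mu> (\<lambda>x. of_real (?V x) * ?I x + of_real (real (card E) * real \<Delta> * v) * ?I x)"
      by (intro Bochner_Integration.integral_cong refl) (simp add: sum_distrib_right algebra_simps)
    finally show ?thesis by (simp only: Bochner_Integration.integral_add[OF integrable_bernoulli integrable_bernoulli] integral_mult_right_zero char_form_def)
  qed
  have Vb: "cmod (measure_pmf.expectation \<mu> (\<lambda>x. of_real (?V x) * ?I x)) \<le> ?dev"
  proof -
    have "cmod (measure_pmf.expectation \<mu> (\<lambda>x. of_real (?V x) * ?I x)) \<le>
        measure_pmf.expectation \<mu> (\<lambda>x. cmod (of_real (?V x) * ?I x))"
      by (rule integral_norm_bound)
    also have "\<dots> = measure_pmf.expectation \<mu> (\<lambda>x. \<bar>?V x\<bar>)"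
      by (intro Bochner_Integration.integral_cong refl) (simp only: norm_mult norm_of_real norm_exp_i_times mult_1_right)
    also note sum_nbsum_sq_deviation
    finally show ?thesis .
  qed
  \<comment> \<open>The defect of the equation consists of the errors of
    \<open>char_form_term\<close> over all edges and of the fluctuation \<open>?V\<close> of the sum
    of squared neighbour sums about its mean.\<close>
  have main: "vector_derivative (char_form \<kappa>) (at t) + of_real (t * (\<kappa>\<^sup>2 * v\<^sup>2 * real (card E) * real \<Delta> / 2)) * char_form \<kappa> t
    = (\<Sum>e\<in>E. \<i> * of_real (\<kappa> / 2) * (?A e - \<i> * of_real (t * \<kappa> * v) * ?B e))
      - of_real (t * \<kappa>\<^sup>2 * v / 2) * measure_pmf.expectation \<mu> (\<lambda>x. of_real (?V x) * ?I x)"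
  proof -
    have *: "(\<Sum>e\<in>E. \<i> * of_real (\<kappa> / 2) * (?A e - \<i> * of_real (t * \<kappa> * v) * ?B e)) =
      (\<Sum>e\<in>E. \<i> * of_real (\<kappa> / 2) * ?A e) + of_real (t * \<kappa>\<^sup>2 * v / 2) * (\<Sum>e\<in>E. ?B e)"
    proof -
      have "\<i> * of_real (\<kappa> / 2) * (a - \<i> * of_real (t * \<kappa> * v) * b) =
         \<i> * of_real (\<kappa> / 2) * a + of_real (t * \<kappa>\<^sup>2 * v / 2) * b" for a b :: complex
        by (simp add: field_simps power2_eq_square)
      thus ?thesis unfolding sum_distrib_left sum.distrib[symmetric] by (intro sum.cong refl)
    qed
    have gen: "S + c = (S + (m + c)) - m" for S c m :: complex by simp
    have **: "of_real (t * \<kappa>\<^sup>2 * v / 2) * (of_real (real (card E) * real \<Delta> * v) * \<phi>) =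
        of_real (t * (\<kappa>\<^sup>2 * v\<^sup>2 * real (card E) * real \<Delta> / 2)) * \<phi>" for \<phi> :: complex
      by (simp add: power2_eq_square)
    show ?thesis unfolding * d V distrib_left[of "of_real (t * \<kappa>\<^sup>2 * v / 2)"] ** by (rule gen)
  qed
  have S1: "cmod (\<Sum>e\<in>E. \<i> * of_real (\<kappa> / 2) * (?A e - \<i> * of_real (t * \<kappa> * v) * ?B e)) \<le>
      t\<^sup>2 * (\<bar>\<kappa>\<bar> ^ 3 * real (card E) * p * cubic_bound)"
  proof -
    have *: "cmod (\<i> * of_real (\<kappa> / 2) * z) = \<bar>\<kappa>\<bar> / 2 * cmod z" for z by (simp add: norm_mult)
    have "cmod (\<Sum>e\<in>E. \<i> * of_real (\<kappa> / 2) * (?A e - \<i> * of_real (t * \<kappa> * v) * ?B e)) \<le>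
        (\<Sum>e\<in>E. \<bar>\<kappa>\<bar> / 2 * (t\<^sup>2 * \<kappa>\<^sup>2 * p * cubic_bound))"
    proof (rule sum_norm_le)
      fix e assume "e \<in> E"
      show "cmod (\<i> * of_real (\<kappa> / 2) * (?A e - \<i> * of_real (t * \<kappa> * v) * ?B e)) \<le> \<bar>\<kappa>\<bar> / 2 * (t\<^sup>2 * \<kappa>\<^sup>2 * p * cubic_bound)"
        unfolding * by (rule mult_left_mono[OF char_form_term[OF \<open>e \<in> E\<close>]]) simp
    qed
    moreover have "(\<Sum>e\<in>E. \<bar>\<kappa>\<bar> / 2 * (t\<^sup>2 * \<kappa>\<^sup>2 * p * cubic_bound)) = t\<^sup>2 * (\<bar>\<kappa>\<bar> ^ 3 * real (card E) * p * cubic_bound) / 2"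
      by (simp add: abs_cube)
    moreover have "0 \<le> cubic_bound" using p01 by (simp add: cubic_bound_def)
    then have "0 \<le> t\<^sup>2 * (\<bar>\<kappa>\<bar> ^ 3 * real (card E) * p * cubic_bound)" using p01 by simp
    ultimately show ?thesis by linarith
  qed
  have S2: "cmod (of_real (t * \<kappa>\<^sup>2 * v / 2) * measure_pmf.expectation \<mu> (\<lambda>x. of_real (?V x) * ?I x)) \<le> \<bar>t\<bar> * (\<kappa>\<^sup>2 * p * ?dev)"
  proof -
    have **: "cmod (of_real (t * (\<kappa>\<^sup>2 * v / 2)) * z) = \<bar>t\<bar> * (\<kappa>\<^sup>2 * v / 2) * cmod z" for z
    proof -
      have "0 \<le> \<kappa>\<^sup>2 * v / 2" using v_nonneg by simp
      then have "\<bar>t * (\<kappa>\<^sup>2 * v / 2)\<bar> = \<bar>t\<bar> * (\<kappa>\<^sup>2 * v / 2)" by (simp only: abs_mult[of t] abs_of_nonneg)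
      thus ?thesis by (simp only: norm_mult norm_of_real)
    qed
    have "t * \<kappa>\<^sup>2 * v / 2 = t * (\<kappa>\<^sup>2 * v / 2)" by simp
    then have "cmod (of_real (t * \<kappa>\<^sup>2 * v / 2) * measure_pmf.expectation \<mu> (\<lambda>x. of_real (?V x) * ?I x)) \<le>
        \<bar>t\<bar> * (\<kappa>\<^sup>2 * v / 2) * ?dev"
      using mult_left_mono[OF Vb, of "\<bar>t\<bar> * (\<kappa>\<^sup>2 * v / 2)"] v_nonneg by (simp only: **) simp
    moreover have "\<bar>t\<bar> * (\<kappa>\<^sup>2 * v / 2) * ?dev \<le> \<bar>t\<bar> * (\<kappa>\<^sup>2 * p) * ?dev"
    proof (intro mult_right_mono mult_left_mono)
      show "\<kappa>\<^sup>2 * v / 2 \<le> \<kappa>\<^sup>2 * p"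
        using mult_left_mono[OF v_le, of "\<kappa>\<^sup>2"] v_nonneg p01 by (simp add: field_simps)
      show "0 \<le> ?dev" using p01 by simp
    qed simp
    ultimately show ?thesis by (simp only: mult.assoc)
  qed
  show ?thesis unfolding main
    by (rule order.trans[OF norm_triangle_ineq4 add_mono[OF S1 S2]])
qed

end

section \<open>From the approximate differential equation to a Gaussian limit\<close>

lemma char_limit_of_ode:
  fixes \<phi> :: "nat \<Rightarrow> real \<Rightarrow> complex"
  assumes diff: "\<And>n t. n \<ge> m \<Longrightarrow> (\<phi> n) differentiable (at t)"
    and ode: "\<And>n t. n \<ge> m \<Longrightarrow> cmod (vector_derivative (\<phi> n) (at t) + of_real (t * s n) * \<phi> n t) \<le> t\<^sup>2 * a n + \<bar>t\<bar> * b n"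
    and init: "\<And>n. n \<ge> m \<Longrightarrow> \<phi> n 0 = 1"
    and lim: "s \<longlonglongrightarrow> s0" "a \<longlonglongrightarrow> 0" "b \<longlonglongrightarrow> 0"
  shows "(\<lambda>n. \<phi> n t) \<longlonglongrightarrow> of_real (exp (- s0 * t\<^sup>2 / 2))"
proof -
  \<comment> \<open>Integrating factor: the derivative of \<open>g n\<close> is the defect in
    \<open>ode\<close> times \<open>exp (s n * u^2 / 2)\<close>, so \<open>g n t\<close> stays
    within \<open>B n * |t|\<close> of the value 1 at the origin.\<close>
  define g where "g n u = \<phi> n u * of_real (exp (s n * u\<^sup>2 / 2))" for n u
  define B where "B n = (t\<^sup>2 * \<bar>a n\<bar> + \<bar>t\<bar> * \<bar>b n\<bar>) * exp (\<bar>s n\<bar> * t\<^sup>2 / 2)" for n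
  have "cmod (g n t - g n 0) \<le> B n * \<bar>t\<bar>" if n: "n \<ge> m" for n
  proof -
    define g' where "g' u = (vector_derivative (\<phi> n) (at u) + of_real (u * s n) * \<phi> n u) * of_real (exp (s n * u\<^sup>2 / 2))" for u
    have der: "(g n has_vector_derivative g' u) (at u within X)" for u X
    proof -
      have 1: "(\<phi> n has_vector_derivative vector_derivative (\<phi> n) (at u)) (at u within X)"
        using diff[OF n, of u] by (simp add: vector_derivative_works has_vector_derivative_at_within)
      have "((\<lambda>u. exp (s n * u\<^sup>2 / 2)) has_real_derivative exp (s n * u\<^sup>2 / 2) * (s n * u)) (at u within X)"
        by (auto intro!: derivative_eq_intros simp: power2_eq_square)
      then have 2: "((\<lambda>u. complex_of_real (exp (s n * u\<^sup>2 / 2))) has_vector_derivative of_real (exp (s n * u\<^sup>2 / 2) * (s n * u))) (at u within X)"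
        by (intro has_vector_derivative_of_real) (simp add: has_real_derivative_iff_has_vector_derivative)
      from has_vector_derivative_mult[OF 1 2] show ?thesis
        unfolding g_def[abs_def] g'_def by (simp add: algebra_simps)
    qed
    have bnd: "cmod (g' u) \<le> B n" if u: "u \<in> {-\<bar>t\<bar>..\<bar>t\<bar>}" for u
    proof -
      have ut: "\<bar>u\<bar> \<le> \<bar>t\<bar>" using u by auto
      then have u2: "u\<^sup>2 \<le> t\<^sup>2" by (simp add: abs_le_square_iff)
      have "u\<^sup>2 * a n + \<bar>u\<bar> * b n \<le> t\<^sup>2 * \<bar>a n\<bar> + \<bar>t\<bar> * \<bar>b n\<bar>"
        by (intro add_mono order.trans[OF mult_left_mono[OF abs_ge_self] mult_right_mono] u2 ut) auto
      have "cmod (g' u) \<le> (t\<^sup>2 * \<bar>a n\<bar> + \<bar>t\<bar> * \<bar>b n\<bar>) * exp (\<bar>s n\<bar> * t\<^sup>2 / 2)"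
        unfolding g'_def norm_mult norm_of_real abs_exp_cancel
      proof (intro mult_mono)
        show "cmod (vector_derivative (\<phi> n) (at u) + of_real (u * s n) * \<phi> n u) \<le> t\<^sup>2 * \<bar>a n\<bar> + \<bar>t\<bar> * \<bar>b n\<bar>"
          using ode[OF n, of u] \<open>u\<^sup>2 * a n + \<bar>u\<bar> * b n \<le> _\<close> by linarith
        have "s n * u\<^sup>2 \<le> \<bar>s n\<bar> * t\<^sup>2" using u2 by (intro mult_mono) auto
        then show "exp (s n * u\<^sup>2 / 2) \<le> exp (\<bar>s n\<bar> * t\<^sup>2 / 2)" by simp
      qed auto
      thus ?thesis by (simp add: B_def)
    qed
    have "norm (g n t - g n 0) \<le> B n * norm (t - 0)"
    proof (rule differentiable_bound[where S = "{-\<bar>t\<bar>..\<bar>t\<bar>}" and f = "g n" and f' = "\<lambda>u h. h *\<^sub>R g' u"])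
      fix u assume "u \<in> {-\<bar>t\<bar>..\<bar>t\<bar>}"
      show "(g n has_derivative (\<lambda>h. h *\<^sub>R g' u)) (at u within {-\<bar>t\<bar>..\<bar>t\<bar>})"
        using der by (simp add: has_vector_derivative_def)
      show "onorm (\<lambda>h. h *\<^sub>R g' u) \<le> B n"
        using mult_left_mono[OF bnd[OF \<open>u \<in> _\<close>] abs_ge_zero] by (intro onorm_le) (simp add: mult.commute)
    qed auto
    thus ?thesis by simp
  qed
  then have "eventually (\<lambda>n. cmod (g n t - 1) \<le> B n * \<bar>t\<bar>) sequentially"
    using init by (auto simp: eventually_sequentially g_def)
  moreover have "(\<lambda>n. B n * \<bar>t\<bar>) \<longlonglongrightarrow> 0"
  proof -
    have 1: "(\<lambda>n. t\<^sup>2 * \<bar>a n\<bar> + \<bar>t\<bar> * \<bar>b n\<bar>) \<longlonglongrightarrow> t\<^sup>2 * \<bar>0\<bar> + \<bar>t\<bar> * \<bar>0\<bar>"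
      by (intro tendsto_add tendsto_mult_left tendsto_rabs lim)
    have 2: "(\<lambda>n. exp (\<bar>s n\<bar> * t\<^sup>2 / 2)) \<longlonglongrightarrow> exp (\<bar>s0\<bar> * t\<^sup>2 / 2)"
      by (intro tendsto_exp tendsto_divide tendsto_mult_right tendsto_rabs lim tendsto_const) simp
    show ?thesis
      using tendsto_mult_right[OF tendsto_mult[OF 1 2], of "\<bar>t\<bar>"] by (simp add: B_def)
  qed
  ultimately have "(\<lambda>n. g n t - 1) \<longlonglongrightarrow> 0"
    by (rule Lim_null_comparison)
  then have g: "(\<lambda>n. g n t) \<longlonglongrightarrow> 1" by (simp add: LIM_zero_iff)
  have "(\<lambda>n. complex_of_real (exp (- s n * t\<^sup>2 / 2))) \<longlonglongrightarrow> of_real (exp (- s0 * t\<^sup>2 / 2))"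
    by (intro tendsto_of_real tendsto_exp tendsto_divide tendsto_mult_right tendsto_minus lim tendsto_const) simp
  from tendsto_mult[OF g this]
  have "(\<lambda>n. g n t * of_real (exp (- s n * t\<^sup>2 / 2))) \<longlonglongrightarrow> of_real (exp (- s0 * t\<^sup>2 / 2))" by simp
  moreover have "g n t * of_real (exp (- s n * t\<^sup>2 / 2)) = \<phi> n t" for n
  proof -
    have "exp (s n * t\<^sup>2 / 2) * exp (- s n * t\<^sup>2 / 2) = 1" by (simp add: exp_add[symmetric])
    then have "complex_of_real (exp (s n * t\<^sup>2 / 2)) * complex_of_real (exp (- s n * t\<^sup>2 / 2)) = 1"
      by (simp only: of_real_mult[symmetric] of_real_1)
    thus ?thesis by (simp only: g_def mult.assoc mult_1_right)
  qed
  ultimately show ?thesis by (simp only:)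
qed

section \<open>The line graph of the complete graph\<close>

definition line_nb :: "nat \<Rightarrow> nat set \<Rightarrow> nat set set" where
  "line_nb n e = {f \<in> complete_edges n. card (e \<inter> f) = 1}"

lemma card_complete_edges: "card (complete_edges n) = n choose 2"
  unfolding complete_edges_def using n_subsets[of "{1..n}" 2] by simp

text \<open>Meeting in exactly one vertex excludes \<open>e\<close> itself as well as disjoint
  edges; the neighbours of \<open>{u, v}\<close> join \<open>u\<close> or \<open>v\<close> to one of
  the other \<open>n - 2\<close> vertices, and the two families are disjoint.\<close>

lemma card_line_nb:
  assumes "e \<in> complete_edges n"
  shows "card (line_nb n e) = 2 * (n - 2)"
proof -
  from assms obtain u v where uv: "e = {u, v}" "u \<noteq> v" "u \<in> {1..n}" "v \<in> {1..n}"
    by (auto simp: complete_edges_def card_2_iff)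
  let ?R = "{1..n} - {u, v}"
  have c2: "card ({1..n} - {u, v}) = n - 2" using uv by (subst card_Diff_subset) auto
  have eq: "line_nb n e = (\<lambda>w. {u, w}) ` ?R \<union> (\<lambda>w. {v, w}) ` ?R"
  proof (intro equalityI subsetI)
    fix f assume "f \<in> line_nb n e"
    then obtain a b where f: "f = {a, b}" "a \<noteq> b" "a \<in> {1..n}" "b \<in> {1..n}" and c: "card ({u,v} \<inter> {a,b}) = 1"
      by (auto simp: line_nb_def complete_edges_def card_2_iff uv)
    have c': "\<not> {a, b} \<subseteq> {u, v}" "{a, b} \<inter> {u, v} \<noteq> {}"
    proof -
      show "{a, b} \<inter> {u, v} \<noteq> {}" using c by (metis Int_commute card.empty zero_neq_one)
      show "\<not> {a, b} \<subseteq> {u, v}"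
      proof
        assume "{a, b} \<subseteq> {u, v}"
        then have "{u, v} \<inter> {a, b} = {a, b}" by blast
        thus False using c \<open>a \<noteq> b\<close> by simp
      qed
    qed
    then consider "a \<in> {u, v}" "b \<notin> {u, v}" | "b \<in> {u, v}" "a \<notin> {u, v}" by blast
    then show "f \<in> (\<lambda>w. {u, w}) ` ?R \<union> (\<lambda>w. {v, w}) ` ?R"
    proof cases
      case 1
      then have "b \<in> ?R" "f = {u, b} \<or> f = {v, b}" using f by auto
      thus ?thesis by blast
    next
      case 2
      then have "a \<in> ?R" "f = {u, a} \<or> f = {v, a}" using f by auto
      thus ?thesis by blast
    qed
  next
    fix f assume "f \<in> (\<lambda>w. {u, w}) ` ?R \<union> (\<lambda>w. {v, w}) ` ?R"
    then obtain w where w: "w \<in> ?R" "f = {u, w} \<or> f = {v, w}" by blast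
    have "e \<inter> f = {u} \<or> e \<inter> f = {v}" using w uv(1,2) by blast
    then have "card (e \<inter> f) = 1" by (elim disjE) simp_all
    moreover have "f \<subseteq> {1..n}" "card f = 2" using w uv by auto
    ultimately show "f \<in> line_nb n e" by (simp add: line_nb_def complete_edges_def)
  qed
  have "inj_on (\<lambda>w. {x, w}) ?R" if "x \<notin> ?R" for x
    using that by (auto simp: inj_on_def doubleton_eq_iff)
  then have "card ((\<lambda>w. {u, w}) ` ?R) = n - 2" "card ((\<lambda>w. {v, w}) ` ?R) = n - 2"
    using c2 by (auto simp: card_image)
  moreover have "(\<lambda>w. {u, w}) ` ?R \<inter> (\<lambda>w. {v, w}) ` ?R = {}"
    using uv by (auto simp: doubleton_eq_iff)
  ultimately show ?thesis unfolding eq by (subst card_Un_disjoint) auto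
qed

lemma regular_form_complete:
  assumes "0 \<le> p" "p \<le> 1"
  shows "regular_form (complete_edges n) (line_nb n) (2 * (n - 2)) p"
proof
  fix e f assume e: "e \<in> complete_edges n" and f: "f \<in> complete_edges n"
  show "f \<in> line_nb n e \<longleftrightarrow> e \<in> line_nb n f"
    using e f by (auto simp: line_nb_def Int_commute)
next
  fix e show "e \<notin> line_nb n e" by (auto simp: line_nb_def complete_edges_def)
next
  fix e assume "e \<in> complete_edges n"
  then show "card (line_nb n e) = 2 * (n - 2)" by (rule card_line_nb)
qed (use assms in \<open>auto simp: complete_edges_finite line_nb_def\<close>)

text \<open>With about \<open>n^2 / 2\<close> edges, degree about \<open>2 * n\<close> and
  \<open>p\<close> about \<open>\<theta> / sqrt n\<close>, the variance of \<open>form / 2\<close>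
  is about \<open>\<theta>^2 * n^2 / 2\<close>. This fixes the scale \<open>K / n\<close>; the error
  terms \<open>a\<close> and \<open>b\<close> are then of order \<open>1 / sqrt n\<close>.\<close>

lemma wedge_form_char_limit:
  fixes p :: "nat \<Rightarrow> real" and K \<theta> t :: real
  assumes p: "\<And>n. n \<ge> 1 \<Longrightarrow> 0 \<le> p n \<and> p n \<le> 1" and lim: "(\<lambda>n. p n * sqrt (real n)) \<longlonglongrightarrow> \<theta>"
  shows "(\<lambda>n. measure_pmf.expectation (bernoulli_product (complete_edges n) (p n))
      (\<lambda>x. iexp (t * (K / real n * regular_form.form (complete_edges n) (line_nb n) (p n) x / 2))))
    \<longlonglongrightarrow> of_real (exp (- (K\<^sup>2 * \<theta>\<^sup>2 / 2) * t\<^sup>2 / 2))"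
proof -
  define T where "T n = p n * sqrt (real n)" for n
  have T: "T \<longlonglongrightarrow> \<theta>" using lim by (simp add: T_def[abs_def])
  have pT: "p n = T n * (1 / sqrt (real n))" if "n \<ge> 1" for n using that by (simp add: T_def)
  have s0: "(\<lambda>n. 1 / sqrt (real n)) \<longlonglongrightarrow> 0" by real_asymp
  have p0: "p \<longlonglongrightarrow> 0"
  proof -
    have "(\<lambda>n. T n * (1 / sqrt (real n))) \<longlonglongrightarrow> \<theta> * 0" by (intro tendsto_intros T s0)
    moreover have "eventually (\<lambda>n. T n * (1 / sqrt (real n)) = p n) sequentially"
      using pT by (intro eventually_sequentiallyI[of 1]) simp
    ultimately show ?thesis by (auto elim: Lim_transform_eventually)
  qed
  define \<kappa> where "\<kappa> n = K / real n" for n :: nat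
  define N where "N n = real (card (complete_edges n))" for n
  define \<Delta> where "\<Delta> n = 2 * (n - 2)" for n :: nat
  let ?\<phi> = "\<lambda>n. regular_form.char_form (complete_edges n) (line_nb n) (p n) (\<kappa> n)"
  define s where "s n = (\<kappa> n)\<^sup>2 * (p n * (1 - p n))\<^sup>2 * N n * real (\<Delta> n) / 2" for n
  define cb where "cb n = 2 * (p n * real (\<Delta> n)) + 3 * (p n * real (\<Delta> n))\<^sup>2" for n
  define a where "a n = \<bar>\<kappa> n\<bar> ^ 3 * N n * p n * cb n" for n
  define b where "b n = (\<kappa> n)\<^sup>2 * p n * (real (\<Delta> n) * sqrt (N n * p n) + p n * sqrt (2 * N n * real (\<Delta> n) ^ 3))" for n
  note rf = regular_form_complete[OF p[THEN conjunct1] p[THEN conjunct2]]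
  have N: "N n = real n * (real n - 1) / 2" for n
    unfolding N_def card_complete_edges by (cases n; simp add: choose_two real_of_nat_div algebra_simps)
  have Nle: "N n \<le> (real n)\<^sup>2" "0 \<le> N n" for n
    unfolding N by (cases n; simp add: power2_eq_square algebra_simps)+
  have Dle: "real (\<Delta> n) \<le> 2 * real n" for n by (simp add: \<Delta>_def)
  have "(\<lambda>n. ?\<phi> n t) \<longlonglongrightarrow> of_real (exp (- (K\<^sup>2 * \<theta>\<^sup>2 / 2) * t\<^sup>2 / 2))"
  proof (rule char_limit_of_ode[where m = 1 and s = s and a = a and b = b])
    fix n :: nat and t :: real assume n: "n \<ge> 1"
    interpret regular_form "complete_edges n" "line_nb n" "\<Delta> n" "p n"
      unfolding \<Delta>_def by (rule rf[OF n n])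
    show "?\<phi> n differentiable at t"
      using char_form_deriv[of "\<kappa> n" t UNIV] by (rule differentiableI_vector)
    show "cmod (vector_derivative (?\<phi> n) (at t) + of_real (t * s n) * ?\<phi> n t) \<le> t\<^sup>2 * a n + \<bar>t\<bar> * b n"
      using char_form_ode[of "\<kappa> n" t] unfolding s_def a_def b_def N_def cb_def cubic_bound_def .
    show "?\<phi> n 0 = 1" by (simp add: char_form_def)
  next
    have "(\<lambda>n. K\<^sup>2 * ((T n)\<^sup>2 * (1 - p n)\<^sup>2) * ((real n - 1) * (real n - 2) / (2 * (real n)\<^sup>2))) \<longlonglongrightarrow> K\<^sup>2 * (\<theta>\<^sup>2 * (1 - 0)\<^sup>2) * (1 / 2)"
    proof (rule tendsto_mult)
      show "(\<lambda>n. (real n - 1) * (real n - 2) / (2 * (real n)\<^sup>2)) \<longlonglongrightarrow> 1 / 2" by real_asymp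
    qed (intro tendsto_intros T p0)
    moreover have "eventually (\<lambda>n. K\<^sup>2 * ((T n)\<^sup>2 * (1 - p n)\<^sup>2) * ((real n - 1) * (real n - 2) / (2 * (real n)\<^sup>2)) = s n) sequentially"
      using eventually_ge_at_top[of 2]
    proof eventually_elim
      case (elim n)
      then have "real (\<Delta> n) = 2 * (real n - 2)" by (simp add: \<Delta>_def of_nat_diff)
      with elim show ?case
        unfolding s_def N \<kappa>_def T_def by (simp add: power_mult_distrib power_divide divide_simps)
    qed
    ultimately have "s \<longlonglongrightarrow> K\<^sup>2 * (\<theta>\<^sup>2 * (1 - 0)\<^sup>2) * (1 / 2)" by (rule Lim_transform_eventually)
    then show "s \<longlonglongrightarrow> K\<^sup>2 * \<theta>\<^sup>2 / 2" by simp
  next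
    have "(\<lambda>n. \<bar>K\<bar> ^ 3 * T n * (4 * T n * (1 / real n) + 12 * (T n)\<^sup>2 * (1 / sqrt (real n)))) \<longlonglongrightarrow> \<bar>K\<bar> ^ 3 * \<theta> * (4 * \<theta> * 0 + 12 * \<theta>\<^sup>2 * 0)"
      by (intro tendsto_mult tendsto_add tendsto_const tendsto_power T s0 lim_1_over_n)
    then have L: "(\<lambda>n. \<bar>K\<bar> ^ 3 * T n * (4 * T n * (1 / real n) + 12 * (T n)\<^sup>2 * (1 / sqrt (real n)))) \<longlonglongrightarrow> 0" by simp
    show "a \<longlonglongrightarrow> 0"
    proof (rule Lim_null_comparison[OF _ L], use eventually_ge_at_top[of 1] in eventually_elim)
      case (elim n)
      have pn: "0 \<le> p n" "p n \<le> 1" using p[OF elim] by auto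
      have "cb n \<le> 2 * (p n * (2 * real n)) + 3 * (p n * (2 * real n))\<^sup>2"
        unfolding cb_def using pn by (intro add_mono mult_left_mono power_mono Dle) auto
      moreover have "0 \<le> cb n" unfolding cb_def using pn by simp
      ultimately have cb: "0 \<le> cb n" "cb n \<le> 2 * (p n * (2 * real n)) + 3 * (p n * (2 * real n))\<^sup>2"
        by blast+
      have "norm (a n) = \<bar>\<kappa> n\<bar> ^ 3 * N n * p n * cb n"
        unfolding a_def using pn Nle cb by simp
      also have "\<dots> \<le> \<bar>\<kappa> n\<bar> ^ 3 * (real n)\<^sup>2 * p n * (2 * (p n * (2 * real n)) + 3 * (p n * (2 * real n))\<^sup>2)"
        using pn Nle cb by (intro mult_mono mult_nonneg_nonneg) auto
      also have "\<dots> = \<bar>K\<bar> ^ 3 * T n * (4 * T n * (1 / real n) + 12 * (T n)\<^sup>2 * (1 / sqrt (real n)))"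
      proof -
        define r x where "r = sqrt (real n)" and "x = p n"
        have r: "real n = r\<^sup>2" "r > 0" using elim by (auto simp: r_def)
        have 1: "\<bar>\<kappa> n\<bar> ^ 3 * (real n)\<^sup>2 * real n = \<bar>K\<bar> ^ 3"
          using elim by (simp add: \<kappa>_def power_divide field_simps eval_nat_numeral)
        have 2: "2 * (x * (2 * real n)) + 3 * (x * (2 * real n))\<^sup>2 = real n * (4 * x + 12 * x\<^sup>2 * real n)"
          by (simp add: power_mult_distrib algebra_simps power2_eq_square)
        have 3: "r * (4 * (x * r) * (1 / real n) + 12 * (x * r)\<^sup>2 * (1 / r)) = 4 * x + 12 * x\<^sup>2 * real n"
          unfolding r(1) using r(2) by (simp add: field_simps power2_eq_square)
        have "\<bar>\<kappa> n\<bar> ^ 3 * (real n)\<^sup>2 * x * (2 * (x * (2 * real n)) + 3 * (x * (2 * real n))\<^sup>2) =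
            (\<bar>\<kappa> n\<bar> ^ 3 * (real n)\<^sup>2 * real n) * x * (4 * x + 12 * x\<^sup>2 * real n)"
          unfolding 2 by (simp only: ac_simps)
        also have "\<dots> = \<bar>K\<bar> ^ 3 * (x * r) * (4 * (x * r) * (1 / real n) + 12 * (x * r)\<^sup>2 * (1 / r))"
          unfolding 1 3[symmetric] by (simp only: ac_simps)
        finally show ?thesis unfolding T_def r_def[symmetric] x_def .
      qed
      finally show ?case .
    qed
  next
    have "(\<lambda>n. K\<^sup>2 * p n * (2 * sqrt (p n) + 4 * T n)) \<longlonglongrightarrow> K\<^sup>2 * 0 * (2 * sqrt 0 + 4 * \<theta>)"
      by (intro tendsto_intros T p0)
    then have L: "(\<lambda>n. K\<^sup>2 * p n * (2 * sqrt (p n) + 4 * T n)) \<longlonglongrightarrow> 0" by simp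
    show "b \<longlonglongrightarrow> 0"
    proof (rule Lim_null_comparison[OF _ L], use eventually_ge_at_top[of 1] in eventually_elim)
      case (elim n)
      have pn: "0 \<le> p n" "p n \<le> 1" using p[OF elim] by auto
      have 1: "sqrt (N n * p n) \<le> real n * sqrt (p n)"
        using Nle[of n] pn by (simp add: real_sqrt_mult real_le_lsqrt mult_right_mono)
      have 2: "sqrt (2 * N n * real (\<Delta> n) ^ 3) \<le> 4 * (real n)\<^sup>2 * sqrt (real n)"
      proof (rule real_le_lsqrt)
        have "2 * N n * real (\<Delta> n) ^ 3 \<le> 2 * (real n)\<^sup>2 * (2 * real n) ^ 3"
          using Nle[of n] Dle[of n] by (intro mult_mono power_mono) auto
        also have "\<dots> = (4 * (real n)\<^sup>2 * sqrt (real n))\<^sup>2"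
          by (simp add: power_mult_distrib) (simp add: eval_nat_numeral)
        finally show "2 * N n * real (\<Delta> n) ^ 3 \<le> (4 * (real n)\<^sup>2 * sqrt (real n))\<^sup>2" .
      qed auto
      have "norm (b n) = b n" unfolding b_def using pn Nle by simp
      also have "\<dots> \<le> (\<kappa> n)\<^sup>2 * p n * (2 * real n * (real n * sqrt (p n)) + p n * (4 * (real n)\<^sup>2 * sqrt (real n)))"
        unfolding b_def using pn Nle 1 2 Dle by (intro mult_left_mono add_mono mult_mono mult_nonneg_nonneg) auto
      also have "\<dots> = K\<^sup>2 * p n * (2 * sqrt (p n) + 4 * T n)"
        unfolding \<kappa>_def T_def using elim by (simp add: power_divide divide_simps) (simp add: algebra_simps power2_eq_square)
      finally show ?case .
    qed
  qed
  moreover have "?\<phi> n t = measure_pmf.expectation (bernoulli_product (complete_edges n) (p n))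
      (\<lambda>x. iexp (t * (K / real n * regular_form.form (complete_edges n) (line_nb n) (p n) x / 2)))" if "n \<ge> 1" for n
    unfolding regular_form.char_form_def[OF rf[OF that that]] \<kappa>_def ..
  ultimately show ?thesis
    by (elim Lim_transform_eventually) (auto simp: eventually_sequentially intro!: exI[of _ 1])
qed

section \<open>Matchings of the complete graph\<close>

abbreviation kmatchings :: "nat \<Rightarrow> nat set set set" where
  "kmatchings n \<equiv> matchings (complete_edges n)"

lemma matching_subset: "M \<in> matchings E \<Longrightarrow> S \<subseteq> M \<Longrightarrow> S \<in> matchings E"
  unfolding matchings_def by (auto intro: pairwise_subset)

lemma finite_matching: "M \<in> kmatchings n \<Longrightarrow> finite M"
  using complete_edges_finite finite_subset unfolding matchings_def by auto

lemma card_vertices_matching: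
  assumes "M \<in> kmatchings n"
  shows "card (\<Union>M) = 2 * card M" "\<Union>M \<subseteq> {1..n}"
proof -
  have M: "M \<subseteq> complete_edges n" "disjoint M" using assms by (auto simp: matchings_def)
  have "card (\<Union>M) = (\<Sum>e\<in>M. card e)"
    using M by (intro card_Union_disjoint) (auto simp: complete_edges_def intro: finite_subset)
  also have "\<dots> = (\<Sum>e\<in>M. 2)" using M by (intro sum.cong) (auto simp: complete_edges_def)
  finally show "card (\<Union>M) = 2 * card M" by simp
  show "\<Union>M \<subseteq> {1..n}" using M by (auto simp: complete_edges_def)
qed

lemma two_card_matching_le: "M \<in> kmatchings n \<Longrightarrow> 2 * card M \<le> n"
  using card_vertices_matching[of M n] card_mono[of "{1..n}" "\<Union>M"] by simp

definition extensions :: "nat \<Rightarrow> nat set set \<Rightarrow> nat set set" where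
  "extensions n M = {e. e \<notin> M \<and> insert e M \<in> kmatchings n}"

text \<open>A new edge must avoid the covered vertices, of which there are
  \<open>2 * card M\<close>.\<close>

lemma card_extensions:
  assumes "M \<in> kmatchings n"
  shows "card (extensions n M) = (n - 2 * card M) choose 2"
proof -
  have M: "M \<subseteq> complete_edges n" "disjoint M" using assms by (auto simp: matchings_def)
  have "extensions n M = {e. e \<subseteq> {1..n} - \<Union>M \<and> card e = 2}"
  proof (intro equalityI subsetI)
    fix e assume e: "e \<in> extensions n M"
    then have "e \<in> complete_edges n" "disjoint (insert e M)" "e \<notin> M"
      by (auto simp: extensions_def matchings_def)
    then have "\<forall>f\<in>M. e \<inter> f = {}" by (auto simp: pairwise_insert disjnt_def)
    with \<open>e \<in> complete_edges n\<close> show "e \<in> {e. e \<subseteq> {1..n} - \<Union>M \<and> card e = 2}"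
      by (auto simp: complete_edges_def)
  next
    fix e assume e: "e \<in> {e. e \<subseteq> {1..n} - \<Union>M \<and> card e = 2}"
    then have "e \<noteq> {}" by auto
    then have "e \<notin> M" using e by blast
    moreover have "disjoint (insert e M)" using M e by (auto simp: pairwise_insert disjnt_def)
    ultimately show "e \<in> extensions n M" using M e by (auto simp: extensions_def matchings_def complete_edges_def)
  qed
  then have "card (extensions n M) = card ({1..n} - \<Union>M) choose 2"
    using n_subsets[of "{1..n} - \<Union>M" 2] by simp
  also have "card ({1..n} - \<Union>M) = n - 2 * card M"
    using card_vertices_matching[OF assms] by (subst card_Diff_subset) (auto intro: finite_subset)
  finally show ?thesis .
qed

text \<open>Double counting of pairs \<open>(M, e)\<close> with \<open>e\<close> in
  \<open>M - S\<close>: deleting \<open>e\<close> leaves a matching that contains \<open>S\<close>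
  and has \<open>e\<close> as an extension. A general weight \<open>g\<close> of the size serves two
  purposes: indicators count matchings, and powers of \<open>lam\<close> give the balance equation
  of the Gibbs measure.\<close>

lemma sum_matchings_extend:
  fixes g :: "nat \<Rightarrow> real"
  assumes "finite S"
  shows "(\<Sum>M | M \<in> kmatchings n \<and> S \<subseteq> M. real (card M - card S) * g (card M)) =
    (\<Sum>M | M \<in> kmatchings n \<and> S \<subseteq> M. real ((n - 2 * card M) choose 2) * g (Suc (card M)))"
proof -
  let ?A = "{M. M \<in> kmatchings n \<and> S \<subseteq> M}"
  have fin: "finite ?A" using matchings_finite[OF complete_edges_finite] by simp
  have fin_ext: "finite (extensions n M)" for M
    by (rule finite_subset[OF _ complete_edges_finite[of n]]) (auto simp: extensions_def matchings_def)
  have "(\<Sum>M\<in>?A. real (card M - card S) * g (card M)) = (\<Sum>M\<in>?A. \<Sum>e\<in>M - S. g (card M))"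
    using assms by (intro sum.cong refl) (auto simp: card_Diff_subset)
  also have "\<dots> = (\<Sum>(M, e)\<in>Sigma ?A (\<lambda>M. M - S). g (card M))"
    using fin finite_matching by (subst sum.Sigma) auto
  also have "\<dots> = (\<Sum>(M, e)\<in>Sigma ?A (extensions n). g (Suc (card M)))"
  proof (rule sum.reindex_bij_witness[where j = "\<lambda>(M, e). (M - {e}, e)" and i = "\<lambda>(M, e). (insert e M, e)"])
    fix a assume a: "a \<in> Sigma ?A (\<lambda>M. M - S)"
    then obtain M e where ae: "a = (M, e)" "M \<in> kmatchings n" "S \<subseteq> M" "e \<in> M" "e \<notin> S" by auto
    show "(\<lambda>(M, e). (insert e M, e)) ((\<lambda>(M, e). (M - {e}, e)) a) = a" using ae by auto
    show "(\<lambda>(M, e). (M - {e}, e)) a \<in> Sigma ?A (extensions n)"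
      using ae matching_subset[of M _ "M - {e}"] by (auto simp: extensions_def insert_absorb)
    show "(case (\<lambda>(M, e). (M - {e}, e)) a of (M, e) \<Rightarrow> g (Suc (card M))) = (case a of (M, e) \<Rightarrow> g (card M))"
      by (simp only: ae(1) prod.case card_Suc_Diff1[OF finite_matching[OF ae(2)] ae(4)])
  next
    fix b assume b: "b \<in> Sigma ?A (extensions n)"
    then obtain M e where be: "b = (M, e)" "M \<in> kmatchings n" "S \<subseteq> M" "e \<in> extensions n M" by auto
    show "(\<lambda>(M, e). (M - {e}, e)) ((\<lambda>(M, e). (insert e M, e)) b) = b"
      using be by (auto simp: extensions_def)
    show "(\<lambda>(M, e). (insert e M, e)) b \<in> Sigma ?A (\<lambda>M. M - S)"
      using be by (auto simp: extensions_def)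
  qed
  also have "\<dots> = (\<Sum>M\<in>?A. \<Sum>e\<in>extensions n M. g (Suc (card M)))"
    using fin fin_ext by (subst sum.Sigma) auto
  also have "\<dots> = (\<Sum>M\<in>?A. real ((n - 2 * card M) choose 2) * g (Suc (card M)))"
    by (intro sum.cong refl) (auto simp: card_extensions)
  finally show ?thesis .
qed

section \<open>Counting matchings and their overlaps\<close>

definition matchings_above :: "nat \<Rightarrow> nat set set \<Rightarrow> nat \<Rightarrow> nat set set set" where
  "matchings_above n S m = {M \<in> kmatchings n. S \<subseteq> M \<and> card M = m}"

lemma finite_matchings_above [simp]: "finite (matchings_above n S m)"
  unfolding matchings_above_def using matchings_finite[OF complete_edges_finite] by simp

lemma card_matchings_above_Suc:
  assumes "finite S"
  shows "real (Suc m - card S) * real (card (matchings_above n S (Suc m))) =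
    real ((n - 2 * m) choose 2) * real (card (matchings_above n S m))"
proof -
  let ?A = "{M. M \<in> kmatchings n \<and> S \<subseteq> M}"
  have fin: "finite ?A" using matchings_finite[OF complete_edges_finite] by simp
  have c: "(\<Sum>M\<in>?A. F (card M) * of_bool (card M = j)) = F j * real (card (matchings_above n S j))" for F :: "nat \<Rightarrow> real" and j
  proof -
    have "(\<Sum>M\<in>?A. F (card M) * of_bool (card M = j)) = (\<Sum>M\<in>?A. if card M = j then F j else 0)"
      by (intro sum.cong) auto
    also have "\<dots> = (\<Sum>M\<in>matchings_above n S j. F j)"
      using fin by (subst sum.inter_filter[symmetric]) (auto simp: matchings_above_def intro!: sum.cong)
    finally show ?thesis by simp
  qed
  show ?thesis
    using sum_matchings_extend[OF assms, where n = n and g = "\<lambda>k. of_bool (k = Suc m)"]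
      c[of "\<lambda>k. real (k - card S)" "Suc m"] c[of "\<lambda>k. real ((n - 2 * k) choose 2)" m] by simp
qed

text \<open>Adding \<open>j\<close> edges one at a time produces each matching above
  \<open>S\<close> in \<open>fact j\<close> orders, and with \<open>i\<close> edges present there
  are \<open>(n - 2 * i) choose 2\<close> choices for the next one.\<close>

lemma card_matchings_above:
  assumes "S \<in> kmatchings n"
  shows "real (card (matchings_above n S (card S + j))) * fact j = (\<Prod>i\<in>{card S..<card S + j}. real ((n - 2 * i) choose 2))"
proof (induction j)
  case 0
  have "matchings_above n S (card S) = {S}"
  proof -
    have "M = S" if "M \<in> kmatchings n" "S \<subseteq> M" "card M = card S" for M
      using card_subset_eq[OF finite_matching[OF that(1)] that(2)] that(3) by simp
    thus ?thesis using assms by (auto simp: matchings_above_def)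
  qed
  then show ?case by simp
next
  case (Suc j)
  have "real (Suc j) * real (card (matchings_above n S (Suc (card S + j)))) =
    real ((n - 2 * (card S + j)) choose 2) * real (card (matchings_above n S (card S + j)))"
    using card_matchings_above_Suc[OF finite_matching[OF assms], of "card S + j" n] by simp
  then have "real (card (matchings_above n S (Suc (card S + j)))) * fact (Suc j) =
     real ((n - 2 * (card S + j)) choose 2) * (real (card (matchings_above n S (card S + j))) * fact j)"
    by (simp only: fact_Suc of_nat_mult[symmetric] mult.commute mult.left_commute mult.assoc)
  then show ?case using Suc by simp
qed

lemma empty_matching: "{} \<in> kmatchings n" by (simp add: matchings_def)

abbreviation "pairs_left n i \<equiv> real ((n - 2 * i) choose 2)"

text \<open>For independent uniform matchings of sizes \<open>m\<close> and \<open>m'\<close> this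
  is the mean of \<open>(1 + t) ^ card (M \<inter> M')\<close>, expanded in factorial moments of the
  overlap; \<open>sum_overlap\<close> is this identity.\<close>

definition overlap_series :: "nat \<Rightarrow> nat \<Rightarrow> nat \<Rightarrow> real \<Rightarrow> real" where
  "overlap_series n m m' t = (\<Sum>k\<le>min m m'. t ^ k / fact k *
     (\<Prod>i<k. (real m - real i) * (real m' - real i) / pairs_left n i))"

lemma fact_ratio: "k \<le> m \<Longrightarrow> fact m = fact (m - k) * (\<Prod>i<k. real m - real i)"
proof (induction k)
  case (Suc k)
  then have "fact (m - k) = real (m - k) * fact (m - Suc k)"
    by (metis Suc_diff_Suc Suc_le_lessD fact_Suc)
  with Suc show ?case by (simp add: of_nat_diff)
qed simp

lemma sum_powers_subsets: "finite A \<Longrightarrow> (\<Sum>X\<in>Pow A. t ^ card X) = (1 + t :: real) ^ card A"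
  using prod_add[of A "\<lambda>_. t" "\<lambda>_. 1"] by (simp add: add.commute)

text \<open>\<open>(1 + t) ^ card (M \<inter> M')\<close> is the sum of \<open>t ^ card S\<close>
  over the common subsets \<open>S\<close>, which are again matchings. After exchanging the sums
  only the number of matchings above \<open>S\<close> enters, and it depends on
  \<open>card S\<close> alone. Nonemptiness of both classes keeps the divisors
  \<open>pairs_left n i\<close> nonzero in the range that occurs.\<close>

lemma sum_overlap:
  assumes N: "matchings_above n {} m \<noteq> {}" "matchings_above n {} m' \<noteq> {}"
  shows "(\<Sum>M\<in>matchings_above n {} m. \<Sum>M'\<in>matchings_above n {} m'. (1 + t) ^ card (M \<inter> M')) =
    real (card (matchings_above n {} m)) * real (card (matchings_above n {} m')) * overlap_series n m m' t"
proof -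
  let ?A = "matchings_above n {} m" and ?A' = "matchings_above n {} m'"
  let ?N = "\<lambda>k. real (card (matchings_above n {} k))"
  let ?C = "pairs_left n"
  have N0: "?N k * fact k = (\<Prod>i<k. ?C i)" for k
    using card_matchings_above[OF empty_matching, of n k] by (simp add: lessThan_atLeast0)
  have Npos: "?N m \<noteq> 0" "?N m' \<noteq> 0" using N by auto
  have Cpos: "(\<Prod>i<k. ?C i) \<noteq> 0" if "k \<le> m" "?N m \<noteq> 0" for k m
  proof -
    have "(\<Prod>i<m. ?C i) \<noteq> 0" unfolding N0[symmetric] using that by simp
    with that(1) show ?thesis by auto
  qed
  \<comment> \<open>The proportion of \<open>l\<close>-matchings that contain \<open>S\<close>, as
    the quotient of two instances of \<open>card_matchings_above\<close>.\<close>
  have NS: "real (card (matchings_above n S l)) = ?N l * (\<Prod>i<card S. (real l - real i) / ?C i)"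
    if S: "S \<in> kmatchings n" and l: "?N l \<noteq> 0" and k: "card S \<le> l" for S l
  proof -
    let ?k = "card S"
    have "real (card (matchings_above n S l)) * fact (l - ?k) = (\<Prod>i\<in>{?k..<l}. ?C i)"
      using card_matchings_above[OF S, of "l - ?k"] k by simp
    moreover have "(\<Prod>i<?k. ?C i) * (\<Prod>i\<in>{?k..<l}. ?C i) = (\<Prod>i<l. ?C i)"
      using k by (simp add: lessThan_atLeast0 prod.atLeastLessThan_concat)
    ultimately have "(\<Prod>i<?k. ?C i) * (real (card (matchings_above n S l)) * fact (l - ?k)) = ?N l * fact l"
      by (simp add: N0)
    also have "\<dots> = fact (l - ?k) * (?N l * (\<Prod>i<?k. real l - real i))"
      by (simp add: fact_ratio[OF k])
    finally have "(\<Prod>i<?k. ?C i) * real (card (matchings_above n S l)) = ?N l * (\<Prod>i<?k. real l - real i)"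
      by simp
    with Cpos[OF k l] show ?thesis by (simp add: prod_dividef field_simps)
  qed
  have NS0: "card (matchings_above n S l) = 0" if "card S > l" "S \<in> kmatchings n" for S l
  proof -
    have "card S \<le> card M" if "M \<in> kmatchings n" "S \<subseteq> M" for M
      using card_mono[OF finite_matching[OF that(1)] that(2)] .
    then have "matchings_above n S l = {}"
      using that by (fastforce simp: matchings_above_def)
    thus ?thesis by simp
  qed
  let ?K = "kmatchings n"
  have finK: "finite ?K" using matchings_finite[OF complete_edges_finite] .
  have "(\<Sum>M\<in>?A. \<Sum>M'\<in>?A'. (1 + t) ^ card (M \<inter> M')) =
     (\<Sum>M\<in>?A. \<Sum>M'\<in>?A'. \<Sum>S\<in>?K. if S \<subseteq> M \<and> S \<subseteq> M' then t ^ card S else 0)"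
  proof (intro sum.cong refl)
    fix M M' assume M: "M \<in> ?A" "M' \<in> ?A'"
    then have MK: "M \<in> ?K" by (simp add: matchings_above_def)
    have "(1 + t) ^ card (M \<inter> M') = (\<Sum>S\<in>Pow (M \<inter> M'). t ^ card S)"
      by (rule sum_powers_subsets[OF finite_Int[OF disjI1[OF finite_matching[OF MK]]], symmetric])
    also have "Pow (M \<inter> M') = {S \<in> ?K. S \<subseteq> M \<and> S \<subseteq> M'}"
      using matching_subset[OF MK] by auto
    also have "(\<Sum>S\<in>{S \<in> ?K. S \<subseteq> M \<and> S \<subseteq> M'}. t ^ card S) = (\<Sum>S\<in>?K. if S \<subseteq> M \<and> S \<subseteq> M' then t ^ card S else 0)"
      using finK by (rule sum.inter_filter)
    finally show "(1 + t) ^ card (M \<inter> M') = (\<Sum>S\<in>?K. if S \<subseteq> M \<and> S \<subseteq> M' then t ^ card S else 0)" .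
  qed
  also have "\<dots> = (\<Sum>M\<in>?A. \<Sum>S\<in>?K. \<Sum>M'\<in>?A'. if S \<subseteq> M \<and> S \<subseteq> M' then t ^ card S else 0)"
    by (rule sum.cong[OF refl sum.swap])
  also have "\<dots> = (\<Sum>S\<in>?K. \<Sum>M\<in>?A. \<Sum>M'\<in>?A'. if S \<subseteq> M \<and> S \<subseteq> M' then t ^ card S else 0)"
    by (rule sum.swap)
  also have "\<dots> = (\<Sum>S\<in>?K. t ^ card S * real (card (matchings_above n S m)) * real (card (matchings_above n S m')))"
  proof (rule sum.cong[OF refl])
    fix S
    have f: "(\<Sum>M\<in>matchings_above n {} l. if S \<subseteq> M then c else 0) = real (card (matchings_above n S l)) * c" for l and c :: real
    proof -
      have "(\<Sum>M\<in>matchings_above n {} l. if S \<subseteq> M then c else 0) = (\<Sum>M\<in>{M \<in> matchings_above n {} l. S \<subseteq> M}. c)"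
        by (rule sum.inter_filter[symmetric]) simp
      also have "{M \<in> matchings_above n {} l. S \<subseteq> M} = matchings_above n S l" by (auto simp: matchings_above_def)
      finally show ?thesis by simp
    qed
    have "(\<Sum>M\<in>?A. \<Sum>M'\<in>?A'. if S \<subseteq> M \<and> S \<subseteq> M' then t ^ card S else 0) =
       (\<Sum>M\<in>?A. if S \<subseteq> M then (\<Sum>M'\<in>?A'. if S \<subseteq> M' then t ^ card S else 0) else 0)"
      by (intro sum.cong refl) auto
    thus "(\<Sum>M\<in>?A. \<Sum>M'\<in>?A'. if S \<subseteq> M \<and> S \<subseteq> M' then t ^ card S else 0) =
      t ^ card S * real (card (matchings_above n S m)) * real (card (matchings_above n S m'))"
      unfolding f by simp
  qed
  also have "\<dots> = (\<Sum>S\<in>{S \<in> ?K. card S \<in> {..min m m'}}. t ^ card S * real (card (matchings_above n S m)) * real (card (matchings_above n S m')))"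
    using finK NS0 by (intro sum.mono_neutral_right) (auto simp: not_le min_def split: if_splits)
  also have "\<dots> = (\<Sum>k\<le>min m m'. \<Sum>S\<in>{S \<in> {S \<in> ?K. card S \<in> {..min m m'}}. card S = k}. t ^ card S * real (card (matchings_above n S m)) * real (card (matchings_above n S m')))"
    using finK by (intro sum.group[symmetric]) auto
  also have "\<dots> = (\<Sum>k\<le>min m m'. ?N m * ?N m' * (t ^ k / fact k * (\<Prod>i<k. (real m - real i) * (real m' - real i) / ?C i)))"
  proof (intro sum.cong refl)
    fix k assume k: "k \<in> {..min m m'}"
    then have km: "k \<le> m" "k \<le> m'" by auto
    let ?P = "\<lambda>l. \<Prod>i<k. (real l - real i) / ?C i"
    have eq: "{S \<in> {S \<in> ?K. card S \<in> {..min m m'}}. card S = k} = matchings_above n {} k"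
      using km by (auto simp: matchings_above_def)
    have "(\<Sum>S\<in>matchings_above n {} k. t ^ card S * real (card (matchings_above n S m)) * real (card (matchings_above n S m'))) =
        (\<Sum>S\<in>matchings_above n {} k. t ^ k * (?N m * ?P m) * (?N m' * ?P m'))"
      using NS[OF _ Npos(1)] NS[OF _ Npos(2)] km by (intro sum.cong refl) (auto simp: matchings_above_def)
    also have "\<dots> = ?N k * (t ^ k * (?N m * ?P m) * (?N m' * ?P m'))" by simp
    also have "?N k = (\<Prod>i<k. ?C i) / fact k" using N0[of k] by (simp add: field_simps)
    also have "(\<Prod>i<k. ?C i) / fact k * (t ^ k * (?N m * ?P m) * (?N m' * ?P m')) =
       ?N m * ?N m' * (t ^ k / fact k * ((\<Prod>i<k. ?C i) * ?P m * ?P m'))" by simp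
    also have "(\<Prod>i<k. ?C i) * ?P m * ?P m' = (\<Prod>i<k. (real m - real i) * (real m' - real i) / ?C i)"
      unfolding prod.distrib[symmetric]
    proof (rule prod.cong[OF refl])
      fix i assume "i \<in> {..<k}"
      then have "?C i \<noteq> 0" using Cpos[OF km(1) Npos(1)] by auto
      then show "?C i * ((real m - real i) / ?C i) * ((real m' - real i) / ?C i) = (real m - real i) * (real m' - real i) / ?C i"
        by simp
    qed
    finally show "(\<Sum>S\<in>{S \<in> {S \<in> ?K. card S \<in> {..min m m'}}. card S = k}. t ^ card S * real (card (matchings_above n S m)) * real (card (matchings_above n S m'))) =
      ?N m * ?N m' * (t ^ k / fact k * (\<Prod>i<k. (real m - real i) * (real m' - real i) / ?C i))" unfolding eq .
  qed
  finally show ?thesis by (simp add: overlap_series_def sum_distrib_left)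
qed


section \<open>The size of a monomer-dimer matching\<close>

lemma expectation_monomer_dimer:
  assumes "lam \<ge> 0"
  shows "measure_pmf.expectation (monomer_dimer lam (complete_edges n)) h =
    (\<Sum>M\<in>kmatchings n. lam ^ card M / partition_function lam (complete_edges n) * (h M :: real))"
proof -
  note pmf = pmf_monomer_dimer[OF complete_edges_finite assms]
  have "measure_pmf.expectation (monomer_dimer lam (complete_edges n)) h =
     (\<Sum>M\<in>kmatchings n. pmf (monomer_dimer lam (complete_edges n)) M *\<^sub>R h M)"
    using matchings_finite[OF complete_edges_finite]
    by (intro integral_measure_pmf) (auto simp: set_pmf_eq pmf split: if_splits)
  thus ?thesis by (simp add: pmf)
qed

lemma integrable_monomer_dimer:
  assumes "lam \<ge> 0"
  shows "integrable (measure_pmf (monomer_dimer lam (complete_edges n))) (h :: _ \<Rightarrow> real)"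
proof (rule integrable_measure_pmf_finite)
  have "set_pmf (monomer_dimer lam (complete_edges n)) \<subseteq> kmatchings n"
    by (auto simp: set_pmf_eq pmf_monomer_dimer[OF complete_edges_finite assms] split: if_splits)
  thus "finite (set_pmf (monomer_dimer lam (complete_edges n)))"
    using matchings_finite[OF complete_edges_finite] finite_subset by blast
qed

text \<open>Balance of insertion and deletion of one edge: \<open>sum_matchings_extend\<close> with
  \<open>S = {}\<close> and \<open>g k = lam^k * h (k - 1)\<close>. The truncated subtraction at
  \<open>card M = 0\<close> is harmless because of the factor \<open>card M\<close>.\<close>

lemma expectation_matching_size_shift:
  assumes lam: "lam \<ge> 0"
  shows "measure_pmf.expectation (monomer_dimer lam (complete_edges n)) (\<lambda>M. real (card M) * h (card M - 1)) =
    lam / 2 * measure_pmf.expectation (monomer_dimer lam (complete_edges n))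
      (\<lambda>M. (real n - 2 * real (card M)) * (real n - 2 * real (card M) - 1) * h (card M))"
proof -
  let ?Z = "partition_function lam (complete_edges n)"
  have ch: "real ((n - 2 * card M) choose 2) = (real n - 2 * real (card M)) * (real n - 2 * real (card M) - 1) / 2"
    if "M \<in> kmatchings n" for M
  proof -
    have "real (k choose 2) = real k * (real k - 1) / 2" for k
      by (cases k; simp add: choose_two real_of_nat_div algebra_simps)
    moreover have "real (n - 2 * card M) = real n - 2 * real (card M)"
      using two_card_matching_le[OF that] by (simp add: of_nat_diff)
    ultimately show ?thesis by simp
  qed
  have "(\<Sum>M\<in>kmatchings n. real (card M) * (lam ^ card M * h (card M - 1))) =
      (\<Sum>M\<in>kmatchings n. real ((n - 2 * card M) choose 2) * (lam ^ Suc (card M) * h (card M)))"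
    using sum_matchings_extend[of "{}", where n = n and g = "\<lambda>k. lam ^ k * h (k - 1)"] by simp
  also have "\<dots> = (\<Sum>M\<in>kmatchings n. lam / 2 * (lam ^ card M *
      ((real n - 2 * real (card M)) * (real n - 2 * real (card M) - 1) * h (card M))))"
    by (intro sum.cong refl) (simp add: ch)
  finally have eq: "(\<Sum>M\<in>kmatchings n. real (card M) * (lam ^ card M * h (card M - 1))) =
     (\<Sum>M\<in>kmatchings n. lam / 2 * (lam ^ card M *
      ((real n - 2 * real (card M)) * (real n - 2 * real (card M) - 1) * h (card M))))" .
  have "(\<Sum>M\<in>kmatchings n. lam ^ card M / ?Z * (real (card M) * h (card M - 1))) =
     (\<Sum>M\<in>kmatchings n. real (card M) * (lam ^ card M * h (card M - 1))) / ?Z"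
    by (simp add: sum_divide_distrib mult_ac)
  also have "\<dots> = lam / 2 * (\<Sum>M\<in>kmatchings n. lam ^ card M / ?Z *
      ((real n - 2 * real (card M)) * (real n - 2 * real (card M) - 1) * h (card M)))"
    unfolding eq by (simp add: sum_divide_distrib sum_distrib_left mult_ac)
  finally show ?thesis unfolding expectation_monomer_dimer[OF lam] .
qed

text \<open>The unmatched fraction \<open>Y\<close> satisfies both \<open>E (g Y) \<approx> 0\<close> and \<open>E (Y * g Y) \<approx> 0\<close> for
  \<open>g Y = Y^2 / \<zeta> + Y - 1\<close>, and \<open>(Y - u) * g Y \<ge> (Y - u)^2\<close> at the positive root \<open>u\<close> of \<open>g\<close>.\<close>

lemma matching_size_concentration:
  assumes n: "n \<ge> 1" and z: "\<zeta> \<ge> 1" and u: "u\<^sup>2 / \<zeta> + u = 1" "u \<ge> 0"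
  defines "lam \<equiv> 1 / (\<zeta> * real n)"
  shows "measure_pmf.expectation (monomer_dimer lam (complete_edges n))
     (\<lambda>M. (real (card M) - (1 - u) * real n / 2)\<^sup>2) \<le> real n"
proof -
  have lam: "lam \<ge> 0" using n z by (simp add: lam_def)
  let ?E = "measure_pmf.expectation (monomer_dimer lam (complete_edges n))"
  note [simp] = integrable_monomer_dimer[OF lam]
  define Y where "Y M = 1 - 2 * real (card M) / real n" for M :: "nat set set"
  have cardY: "real (card M) = real n * (1 - Y M) / 2" for M using n by (simp add: Y_def)
  have E_mono: "?E f \<le> ?E g" if "\<And>M. M \<in> kmatchings n \<Longrightarrow> f M \<le> g M" for f g :: "nat set set \<Rightarrow> real"
    unfolding expectation_monomer_dimer[OF lam]
    using that partition_function_pos[OF complete_edges_finite lam, of n] lam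
    by (intro sum_mono mult_left_mono) auto
  have E_cong: "?E f = ?E g" if "\<And>M. M \<in> kmatchings n \<Longrightarrow> f M = g M" for f g :: "nat set set \<Rightarrow> real"
    using E_mono[of f g] E_mono[of g f] that by fastforce
  have Y01: "0 \<le> Y M" "Y M \<le> 1" if "M \<in> kmatchings n" for M
    using two_card_matching_le[OF that] n by (auto simp: Y_def field_simps)
  have n0: "real n \<noteq> 0" "\<zeta> \<noteq> 0" using n z by auto
  have 1: "?E (\<lambda>M. 1 - Y M) = ?E (\<lambda>M. (Y M)\<^sup>2 / \<zeta> - Y M / (\<zeta> * real n))"
  proof -
    have "?E (\<lambda>M. 1 - Y M) = 2 / real n * ?E (\<lambda>M. real (card M) * 1)"
      unfolding cardY using n0 by simp
    also have "\<dots> = 2 / real n * (lam / 2 * ?E (\<lambda>M. (real n - 2 * real (card M)) * (real n - 2 * real (card M) - 1) * 1))"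
      using expectation_matching_size_shift[OF lam, of n "\<lambda>_. 1"] by simp
    also have "\<dots> = ?E (\<lambda>M. 2 / real n * (lam / 2 * ((real n - 2 * real (card M)) * (real n - 2 * real (card M) - 1) * 1)))"
      by (simp only: integral_mult_right_zero)
    also have "\<dots> = ?E (\<lambda>M. (Y M)\<^sup>2 / \<zeta> - Y M / (\<zeta> * real n))"
      unfolding cardY lam_def using n0 by (intro Bochner_Integration.integral_cong refl) (simp add: field_simps power2_eq_square)
    finally show ?thesis .
  qed
  \<comment> \<open>The balance equation with \<open>h k = n - 2 * k\<close>; at
    \<open>card M - 1\<close> this is \<open>n * (Y M + 2 / n)\<close>, whence the shift by
    \<open>2 / n\<close>. The previous equation is the case of constant \<open>h\<close>.\<close>
  have 2: "?E (\<lambda>M. (1 - Y M) * (Y M + 2 / real n)) = ?E (\<lambda>M. (Y M) ^ 3 / \<zeta> - (Y M)\<^sup>2 / (\<zeta> * real n))"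
  proof -
    have "?E (\<lambda>M. (1 - Y M) * (Y M + 2 / real n)) = ?E (\<lambda>M. 2 / (real n)\<^sup>2 * (real (card M) * (real n - 2 * real (card M - 1))))"
    proof (rule E_cong)
      fix M
      have "(1 - Y M) * (Y M + 2 / real n) = 2 / (real n)\<^sup>2 * (real (card M) * (real n - 2 * (real (card M) - 1)))"
        unfolding cardY using n0 by (simp add: field_simps power2_eq_square)
      also have "real (card M) * (real n - 2 * (real (card M) - 1)) = real (card M) * (real n - 2 * real (card M - 1))"
        by (cases "card M") auto
      finally show "(1 - Y M) * (Y M + 2 / real n) = 2 / (real n)\<^sup>2 * (real (card M) * (real n - 2 * real (card M - 1)))" .
    qed
    also have "\<dots> = 2 / (real n)\<^sup>2 * ?E (\<lambda>M. real (card M) * (real n - 2 * real (card M - 1)))"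
      by (simp only: integral_mult_right_zero)
    also have "\<dots> = 2 / (real n)\<^sup>2 * (lam / 2 * ?E (\<lambda>M. (real n - 2 * real (card M)) * (real n - 2 * real (card M) - 1) * (real n - 2 * real (card M))))"
      using expectation_matching_size_shift[OF lam, of n "\<lambda>k. real n - 2 * real k"] by simp
    also have "\<dots> = ?E (\<lambda>M. 2 / (real n)\<^sup>2 * (lam / 2 * ((real n - 2 * real (card M)) * (real n - 2 * real (card M) - 1) * (real n - 2 * real (card M)))))"
      by (simp only: integral_mult_right_zero)
    also have "\<dots> = ?E (\<lambda>M. (Y M) ^ 3 / \<zeta> - (Y M)\<^sup>2 / (\<zeta> * real n))"
      unfolding cardY lam_def using n0
      by (intro Bochner_Integration.integral_cong refl) (simp add: field_simps power2_eq_square power3_eq_cube)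
    finally show ?thesis .
  qed
  define g where "g y = y\<^sup>2 / \<zeta> + y - 1" for y
  have A: "?E (\<lambda>M. g (Y M)) = ?E (\<lambda>M. Y M / (\<zeta> * real n))"
    using 1 by (simp add: g_def)
  have B: "?E (\<lambda>M. Y M * g (Y M)) = ?E (\<lambda>M. (1 - Y M) * (2 / real n) + (Y M)\<^sup>2 / (\<zeta> * real n))"
  proof -
    have "Y M * g (Y M) = Y M ^ 3 / \<zeta> - (1 - Y M) * Y M" for M
      by (simp add: g_def algebra_simps power2_eq_square power3_eq_cube)
    moreover have "(1 - Y M) * (Y M + 2 / real n) = (1 - Y M) * Y M + (1 - Y M) * (2 / real n)" for M
      by (simp add: algebra_simps)
    ultimately show ?thesis using 2 by (simp del: integral_divide_zero integral_mult_left_zero)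
  qed
  \<comment> \<open>Since \<open>u\<close> is a root of \<open>g\<close>, the factor
    \<open>y - u\<close> splits off, and the cofactor \<open>(y + u) / \<zeta> + 1\<close> is at
    least 1.\<close>
  have fac: "(y - u)\<^sup>2 \<le> (y - u) * g y" if "y \<ge> 0" for y
  proof -
    have "g y = g y - (u\<^sup>2 / \<zeta> + u - 1)" using u by simp
    also have "\<dots> = (y - u) * ((y + u) / \<zeta> + 1)"
      using n0 by (simp add: g_def field_simps power2_eq_square)
    finally have "(y - u) * g y = (y - u)\<^sup>2 * ((y + u) / \<zeta> + 1)" by (simp add: power2_eq_square)
    moreover have "(y - u)\<^sup>2 * 1 \<le> (y - u)\<^sup>2 * ((y + u) / \<zeta> + 1)"
      using that u z by (intro mult_left_mono) auto
    ultimately show ?thesis by simp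
  qed
  have "?E (\<lambda>M. (Y M - u)\<^sup>2) \<le> ?E (\<lambda>M. Y M * g (Y M) - u * g (Y M))"
    using fac Y01 by (intro E_mono) (auto simp: left_diff_distrib)
  also have "\<dots> = ?E (\<lambda>M. Y M * g (Y M)) - u * ?E (\<lambda>M. g (Y M))" by simp
  \<comment> \<open>The subtracted term is nonnegative, because \<open>A\<close> equates the mean of
    \<open>g (Y M)\<close> with that of a nonnegative quantity.\<close>
  also have "\<dots> \<le> ?E (\<lambda>M. Y M * g (Y M))"
  proof -
    have "0 \<le> ?E (\<lambda>M. Y M / (\<zeta> * real n))"
      using E_mono[of "\<lambda>_. 0" "\<lambda>M. Y M / (\<zeta> * real n)"] Y01 z by simp
    from mult_nonneg_nonneg[OF u(2) this] show ?thesis unfolding A by linarith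
  qed
  also have "\<dots> \<le> ?E (\<lambda>M. 1 * (2 / real n) + 1 / (1 * real n))"
    unfolding B using Y01 z n
    by (intro E_mono add_mono mult_right_mono frac_le mult_right_mono) (auto simp: abs_square_le_1)
  finally have Yu: "?E (\<lambda>M. (Y M - u)\<^sup>2) \<le> 3 / real n" by simp
  have "?E (\<lambda>M. (real (card M) - (1 - u) * real n / 2)\<^sup>2) = ?E (\<lambda>M. (real n)\<^sup>2 / 4 * (Y M - u)\<^sup>2)"
  proof (rule E_cong)
    fix M
    have "real (card M) - (1 - u) * real n / 2 = real n / 2 * (u - Y M)" unfolding cardY by (simp add: field_simps)
    show "(real (card M) - (1 - u) * real n / 2)\<^sup>2 = (real n)\<^sup>2 / 4 * (Y M - u)\<^sup>2"
      unfolding \<open>real (card M) - (1 - u) * real n / 2 = real n / 2 * (u - Y M)\<close>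
      by (simp add: power_mult_distrib power_divide power2_commute[of u])
  qed
  also have "\<dots> \<le> (real n)\<^sup>2 / 4 * (3 / real n)"
    unfolding integral_mult_right_zero by (intro mult_left_mono Yu) simp
  also have "\<dots> \<le> real n" using n by (simp add: power2_eq_square)
  finally show ?thesis .
qed

section \<open>The second moment\<close>

text \<open>The quadratic term is kept because this is applied with \<open>x\<close> of order
  \<open>1 / sqrt n\<close> and raised to a power of order \<open>n\<close>, so that the squares
  contribute to the limit.\<close>

lemma one_minus_le_exp2:
  fixes x :: real
  assumes "0 \<le> x" "x < 1"
  shows "1 - x \<le> exp (- x - x\<^sup>2 / 2)"
proof -
  define h where "h x = - x - x\<^sup>2 / 2 - ln (1 - x)" for x :: real
  have "h 0 \<le> h x"
  proof (rule DERIV_nonneg_imp_nondecreasing[OF assms(1)])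
    fix y assume y: "0 \<le> y" "y \<le> x"
    have "(h has_real_derivative - 1 - y + 1 / (1 - y)) (at y)"
      unfolding h_def using y assms by (auto intro!: derivative_eq_intros simp: field_simps)
    moreover have "- 1 - y + 1 / (1 - y) = y\<^sup>2 / (1 - y)"
      using y assms by (simp add: field_simps power2_eq_square)
    ultimately show "\<exists>d. (h has_real_derivative d) (at y) \<and> 0 \<le> d"
      using y assms by (intro exI[of _ "y\<^sup>2 / (1 - y)"]) auto
  qed
  then have "ln (1 - x) \<le> - x - x\<^sup>2 / 2" by (simp add: h_def)
  then have "exp (ln (1 - x)) \<le> exp (- x - x\<^sup>2 / 2)" by simp
  thus ?thesis using assms by simp
qed

text \<open>Applied to \<open>y * exp (- w)\<close> with \<open>y\<close> of order
  \<open>sqrt n\<close> and \<open>w\<close> of order \<open>1 / sqrt n\<close>: the linear term has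
  order one, and the quadratic one vanishes in the limit.\<close>

lemma exp_neg_le_quadratic:
  fixes x :: real
  assumes "0 \<le> x"
  shows "exp (- x) \<le> 1 - x + x\<^sup>2 / 2"
proof -
  define h where "h x = 1 - x + x\<^sup>2 / 2 - exp (- x)" for x :: real
  have "h 0 \<le> h x"
  proof (rule DERIV_nonneg_imp_nondecreasing[OF assms])
    fix y :: real assume y: "0 \<le> y" "y \<le> x"
    have "(h has_real_derivative - 1 + y + exp (- y)) (at y)"
      unfolding h_def by (auto intro!: derivative_eq_intros)
    moreover have "0 \<le> - 1 + y + exp (- y)" using exp_ge_add_one_self[of "- y"] by simp
    ultimately show "\<exists>d. (h has_real_derivative d) (at y) \<and> 0 \<le> d" by blast
  qed
  thus ?thesis by (simp add: h_def)
qed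

lemma sum_power_div_fact_le_exp:
  fixes z :: real
  assumes "0 \<le> z"
  shows "(\<Sum>k\<le>K. z ^ k / fact k) \<le> exp z"
proof -
  have "(\<Sum>k\<le>K. z ^ k / fact k) \<le> (\<Sum>k. z ^ k / fact k)"
    using assms summable_exp_generic[of z]
    by (intro sum_le_suminf) (auto simp: scaleR_conv_of_real field_simps)
  also have "\<dots> = exp z" by (simp add: exp_def scaleR_conv_of_real field_simps)
  finally show ?thesis .
qed

text \<open>The Gaussian factor comes from drawing without replacement; it is linearised in \<open>k\<close> at
  \<open>k = y\<close> through \<open>k^2 \<ge> 2 k y - y^2\<close>, so that the series sums to an exponential.\<close>

lemma overlap_series_le:
  fixes n m m' :: nat and t :: real
  assumes m: "1 \<le> m" "4 * m \<le> n" "1 \<le> m'" "4 * m' \<le> n" and t: "0 \<le> t"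
  defines "y \<equiv> 2 * t * real m * real m' * (1 + 4 / real n) / (real n)\<^sup>2"
  defines "\<alpha> \<equiv> 1 / real m + 1 / real m' - 4 / real n"
  assumes y: "1 / 2 \<le> y"
  shows "overlap_series n m m' t \<le> exp (y - \<alpha> * y\<^sup>2 / 2 + \<alpha> * y / 2 + \<alpha>\<^sup>2 * y ^ 3 / 2)"
proof -
  have n: "n \<ge> 4" using m by linarith
  have frac: "2 / real n \<le> 1 / real l" if "1 \<le> l" "4 * l \<le> n" for l
    using that by (simp add: field_simps)
  have a0: "0 \<le> \<alpha>" unfolding \<alpha>_def using frac[OF m(1,2)] frac[OF m(3,4)] by linarith
  have one: "(real l - real i) / (real n - 2 * real i) \<le> real l / real n * exp (- real i * (1 / real l - 2 / real n))"
    and nn: "0 \<le> (real l - real i) / (real n - 2 * real i)"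
    if l: "1 \<le> l" "4 * l \<le> n" "i < l" for l i
  proof -
    \<comment> \<open>Here \<open>b <= a\<close> because \<open>l <= n / 2\<close>, and then
      \<open>(1 - a) / (1 - b) <= 1 - (a - b)\<close>: the depletion of the matching and that of the
      vertices combine into one exponential in \<open>i\<close>.\<close>
    define a b where "a = real i / real l" and "b = 2 * real i / real n"
    have "real i * (2 / real n) \<le> real i * (1 / real l)" by (intro mult_left_mono frac l) simp
    then have ab: "b \<le> a" by (simp add: a_def b_def mult.commute)
    have b: "0 \<le> b" "b < 1" using l by (auto simp: b_def field_simps)
    have "1 - a \<le> (1 - b) * (1 - (a - b))"
    proof -
      have "(1 - b) * (1 - (a - b)) = 1 - a + b * (a - b)" by (simp add: algebra_simps)
      thus ?thesis using ab b by simp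
    qed
    also have "\<dots> \<le> (1 - b) * exp (- (a - b))"
      using exp_ge_add_one_self[of "- (a - b)"] b by (intro mult_left_mono) linarith+
    finally have "(1 - a) / (1 - b) \<le> exp (- (a - b))" using b by (simp add: field_simps)
    moreover have "(real l - real i) / (real n - 2 * real i) = real l / real n * ((1 - a) / (1 - b))"
    proof -
      have "real l - real i = real l * (1 - a)" "real n - 2 * real i = real n * (1 - b)"
        using l n by (auto simp: a_def b_def field_simps)
      thus ?thesis by simp
    qed
    moreover have "- (a - b) = - real i * (1 / real l - 2 / real n)" by (simp add: a_def b_def field_simps)
    moreover have "real l / real n * ((1 - a) / (1 - b)) \<le> real l / real n * exp (- (a - b))"
      by (rule mult_left_mono[OF \<open>(1 - a) / (1 - b) \<le> exp (- (a - b))\<close>]) simp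
    ultimately show "(real l - real i) / (real n - 2 * real i) \<le> real l / real n * exp (- real i * (1 / real l - 2 / real n))"
      by (simp only:)
    show "0 \<le> (real l - real i) / (real n - 2 * real i)" using l by simp
  qed
  let ?Y = "2 * real m * real m' * (1 + 4 / real n) / (real n)\<^sup>2"
  have fac: "(real m - real i) * (real m' - real i) / pairs_left n i \<le> ?Y * exp (- \<alpha> * real i)"
    and fac0: "0 \<le> (real m - real i) * (real m' - real i) / pairs_left n i" if i: "i < m" "i < m'" for i
  proof -
    have i4: "4 * i + 4 \<le> n" using i m by linarith
    then have i4': "4 * real i + 4 \<le> real n" by linarith
    have pl: "pairs_left n i = (real n - 2 * real i) * (real n - 2 * real i - 1) / 2"
    proof -
      have "real (k choose 2) = real k * (real k - 1) / 2" for k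
        by (cases k; simp add: choose_two real_of_nat_div algebra_simps)
      thus ?thesis using i4 by (simp add: of_nat_diff)
    qed
    let ?F = "\<lambda>l. (real l - real i) / (real n - 2 * real i)"
    have eq: "(real m - real i) * (real m' - real i) / pairs_left n i =
        2 * (?F m * ?F m') * ((real n - 2 * real i) / (real n - 2 * real i - 1))"
    proof -
      have "a * b / (c * d / 2) = 2 * (a / c * (b / c)) * (c / d)" if "c \<noteq> 0" for a b c d :: real
        using that by (simp add: field_simps)
      moreover have "real n - 2 * real i \<noteq> 0" using i4' by linarith
      ultimately show ?thesis unfolding pl by blast
    qed
    \<comment> \<open>\<open>pairs_left\<close> has the factors \<open>n - 2 * i\<close> and
      \<open>n - 2 * i - 1\<close>; replacing the second by the first costs at most the factor
      \<open>1 + 4 / n\<close> that appears in \<open>y\<close>.\<close>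
    have ratio: "(real n - 2 * real i) / (real n - 2 * real i - 1) \<le> 1 + 4 / real n"
    proof -
      have "real n \<le> 4 * (real n - 2 * real i - 1)"
        using i4' of_nat_0_le_iff[where 'a = real, of i] by (simp add: algebra_simps)
      then have "1 / (real n - 2 * real i - 1) \<le> 4 / real n" using i4' by (simp add: field_simps)
      moreover have "(real n - 2 * real i) / (real n - 2 * real i - 1) = 1 + 1 / (real n - 2 * real i - 1)"
        using i4' by (simp add: field_simps)
      ultimately show ?thesis by simp
    qed
    have ratio0: "0 \<le> (real n - 2 * real i) / (real n - 2 * real i - 1)" using i4' by simp
    have "2 * (?F m * ?F m') * ((real n - 2 * real i) / (real n - 2 * real i - 1)) \<le>
       2 * ((real m / real n * exp (- real i * (1 / real m - 2 / real n))) * (real m' / real n * exp (- real i * (1 / real m' - 2 / real n))))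
        * (1 + 4 / real n)"
      using nn[OF m(1,2) i(1)] nn[OF m(3,4) i(2)] ratio0
      by (intro mult_mono one m i ratio mult_nonneg_nonneg) auto
    also have "\<dots> = ?Y * (exp (- real i * (1 / real m - 2 / real n)) * exp (- real i * (1 / real m' - 2 / real n)))"
      by (simp add: power2_eq_square)
    also have "exp (- real i * (1 / real m - 2 / real n)) * exp (- real i * (1 / real m' - 2 / real n)) = exp (- \<alpha> * real i)"
      unfolding exp_add[symmetric] by (intro arg_cong[where f = exp]) (simp add: \<alpha>_def algebra_simps)
    finally show "(real m - real i) * (real m' - real i) / pairs_left n i \<le> ?Y * exp (- \<alpha> * real i)" unfolding eq .
    show "0 \<le> (real m - real i) * (real m' - real i) / pairs_left n i"
      unfolding eq by (intro mult_nonneg_nonneg nn[OF m(1,2) i(1)] nn[OF m(3,4) i(2)] ratio0) simp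
  qed
  have Y0: "0 \<le> ?Y" by simp
  \<comment> \<open>The slope of \<open>\<alpha> * k * (k - 1) / 2\<close> at \<open>k = y\<close>;
    the assumption \<open>1 / 2 <= y\<close> makes it nonnegative.\<close>
  define w where "w = \<alpha> * (y - 1 / 2)"
  have w0: "0 \<le> w" using a0 y by (simp add: w_def)
  have termwise: "t ^ k / fact k * (\<Prod>i<k. (real m - real i) * (real m' - real i) / pairs_left n i) \<le>
     exp (\<alpha> * y\<^sup>2 / 2) * ((y * exp (- w)) ^ k / fact k)" if k: "k \<le> min m m'" for k
  proof -
    have "(\<Prod>i<k. (real m - real i) * (real m' - real i) / pairs_left n i) \<le> (\<Prod>i<k. ?Y * exp (- \<alpha> * real i))"
      using fac fac0 k by (intro prod_mono) auto
    also have "\<dots> = ?Y ^ k * exp (- \<alpha> * (real k * (real k - 1) / 2))"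
    proof -
      have "(\<Sum>i<k. real i) = real k * (real k - 1) / 2" by (induction k) (auto simp: field_simps)
      then have "(\<Sum>i<k. - \<alpha> * real i) = - \<alpha> * (real k * (real k - 1) / 2)" by (simp only: sum_distrib_left[symmetric])
      moreover have "(\<Prod>i<k. exp (- \<alpha> * real i)) = exp (\<Sum>i<k. - \<alpha> * real i)" by (simp only: exp_sum finite_lessThan)
      ultimately show ?thesis by (simp only: prod.distrib prod_constant card_lessThan)
    qed
    finally have P: "(\<Prod>i<k. (real m - real i) * (real m' - real i) / pairs_left n i) \<le> ?Y ^ k * exp (- \<alpha> * (real k * (real k - 1) / 2))" .
    have "t ^ k / fact k * (\<Prod>i<k. (real m - real i) * (real m' - real i) / pairs_left n i) \<le>
        t ^ k / fact k * (?Y ^ k * exp (- \<alpha> * (real k * (real k - 1) / 2)))"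
      using t by (intro mult_left_mono P) simp
    also have "\<dots> = y ^ k / fact k * exp (- \<alpha> * (real k * (real k - 1) / 2))"
    proof -
      have "y = t * ?Y" by (simp add: y_def)
      thus ?thesis by (simp only: power_mult_distrib times_divide_eq_left mult.assoc)
    qed
    also have "\<dots> \<le> y ^ k / fact k * (exp (\<alpha> * y\<^sup>2 / 2) * exp (- w) ^ k)"
    proof (intro mult_left_mono)
      have "0 \<le> (real k - y)\<^sup>2" by simp
      then have "real k * y - y\<^sup>2 / 2 - real k / 2 \<le> real k * (real k - 1) / 2"
        by (simp add: power2_eq_square algebra_simps)
      then have "\<alpha> * (real k * y - y\<^sup>2 / 2 - real k / 2) \<le> \<alpha> * (real k * (real k - 1) / 2)"
        by (rule mult_left_mono[OF _ a0])
      have "- \<alpha> * (real k * (real k - 1) / 2) \<le> \<alpha> * y\<^sup>2 / 2 + real k * (- w)"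
      proof -
        have "\<alpha> * (real k * y - y\<^sup>2 / 2 - real k / 2) = real k * w - \<alpha> * y\<^sup>2 / 2"
          by (simp add: w_def algebra_simps diff_divide_distrib)
        with \<open>\<alpha> * (real k * y - y\<^sup>2 / 2 - real k / 2) \<le> _\<close> show ?thesis by (simp only: mult_minus_left mult_minus_right)
      qed
      then have "exp (- \<alpha> * (real k * (real k - 1) / 2)) \<le> exp (\<alpha> * y\<^sup>2 / 2 + real k * (- w))" by simp
      thus "exp (- \<alpha> * (real k * (real k - 1) / 2)) \<le> exp (\<alpha> * y\<^sup>2 / 2) * exp (- w) ^ k"
        by (simp only: exp_add exp_of_nat_mult)
    qed (use y in simp)
    finally show ?thesis by (simp add: power_mult_distrib mult_ac)
  qed
  have "overlap_series n m m' t \<le> (\<Sum>k\<le>min m m'. exp (\<alpha> * y\<^sup>2 / 2) * ((y * exp (- w)) ^ k / fact k))"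
    unfolding overlap_series_def by (intro sum_mono termwise) simp
  also have "\<dots> \<le> exp (\<alpha> * y\<^sup>2 / 2) * exp (y * exp (- w))"
    unfolding sum_distrib_left[symmetric] using y by (intro mult_left_mono sum_power_div_fact_le_exp) auto
  also have "\<dots> = exp (\<alpha> * y\<^sup>2 / 2 + y * exp (- w))" by (simp add: exp_add)
  also have "\<alpha> * y\<^sup>2 / 2 + y * exp (- w) \<le> y - \<alpha> * y\<^sup>2 / 2 + \<alpha> * y / 2 + \<alpha>\<^sup>2 * y ^ 3 / 2"
  proof -
    have "y * exp (- w) \<le> y * (1 - w + w\<^sup>2 / 2)"
      using y by (intro mult_left_mono exp_neg_le_quadratic w0) simp
    moreover have "w\<^sup>2 \<le> \<alpha>\<^sup>2 * y\<^sup>2"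
      unfolding w_def power_mult_distrib using y by (intro mult_left_mono power_mono) auto
    then have "y * w\<^sup>2 \<le> \<alpha>\<^sup>2 * y ^ 3"
      using y mult_left_mono[of "w\<^sup>2" "\<alpha>\<^sup>2 * y\<^sup>2" y] by (simp add: power3_eq_cube power2_eq_square mult_ac)
    moreover have "y * w = \<alpha> * y\<^sup>2 - \<alpha> * y / 2" by (simp add: w_def algebra_simps power2_eq_square)
    ultimately show ?thesis by (simp add: distrib_left right_diff_distrib)
  qed
  finally show ?thesis by simp
qed


text \<open>The terms of order \<open>sqrt n\<close> in the exponent are \<open>N * a\<close> and
  \<open>y\<close>, each about \<open>c^2 * sqrt n / (2 * \<theta>)\<close>, against
  \<open>(m + m') * \<eta>\<close>, about twice as large. They have to be cancelled algebraically
  before limits are taken. What this leaves of the sizes is the product of their deviations from the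
  mean, negligible by \<open>D\<close>. The sizes are arbitrary sequences; uniformity over them is
  recovered later by choosing a worst pair for every \<open>n\<close>.\<close>

lemma second_moment_exponent_limit:
  fixes p \<pi> q :: "nat \<Rightarrow> real" and m m' :: "nat \<Rightarrow> nat" and c \<theta> :: real
  assumes p: "\<And>n. n \<ge> 1 \<Longrightarrow> 0 < p n \<and> p n < 1" and T: "(\<lambda>n. p n * sqrt (real n)) \<longlonglongrightarrow> \<theta>" and \<theta>: "\<theta> > 0"
    and \<pi>: "\<And>n. n \<ge> 1 \<Longrightarrow> 0 \<le> \<pi> n \<and> \<pi> n < 1" and P: "(\<lambda>n. real n * \<pi> n) \<longlonglongrightarrow> c" and c: "0 < c" "c < 1 / 2"
    and q: "\<And>n. n \<ge> 1 \<Longrightarrow> q n = p n + \<pi> n * (1 - p n)"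
    and m: "(\<lambda>n. real (m n) / real n) \<longlonglongrightarrow> c / 2" and m': "(\<lambda>n. real (m' n) / real n) \<longlonglongrightarrow> c / 2"
    and D: "(\<lambda>n. (real (m n) - \<pi> n * real (n choose 2)) * (real (m' n) - \<pi> n * real (n choose 2)) / (real n * sqrt (real n))) \<longlonglongrightarrow> 0"
    and eps: "\<epsilon> > 0"
  defines "a0 \<equiv> \<lambda>n. 1 + (q n - p n)\<^sup>2 / (q n * (1 - q n))"
  shows "eventually (\<lambda>n. a0 n ^ (n choose 2) * (p n / q n / a0 n) ^ (m n + m' n) *
      overlap_series n (m n) (m' n) (a0 n * q n / (p n)\<^sup>2 - 1) \<le> exp (c ^ 4 / (2 * \<theta>\<^sup>2) + \<epsilon>)) sequentially"
proof -
  define s where "s n = sqrt (real n)" for n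
  define N where "N n = real (n choose 2)" for n
  define \<eta> where "\<eta> n = (q n - p n) / q n" for n
  define a where "a n = (q n - p n)\<^sup>2 / (q n * (1 - q n))" for n
  \<comment> \<open>Normalised so that \<open>t n = B n / q n\<close>; \<open>B\<close> tends to 1,
    and its distance from \<open>1 - p n\<close> is of order \<open>1 / sqrt n\<close>.\<close>
  define B where "B n = a0 n / (1 - \<eta> n)\<^sup>2 - q n" for n
  define t where "t n = a0 n * q n / (p n)\<^sup>2 - 1" for n
  define y where "y n = 2 * t n * real (m n) * real (m' n) * (1 + 4 / real n) / (real n)\<^sup>2" for n
  define \<alpha> where "\<alpha> n = 1 / real (m n) + 1 / real (m' n) - 4 / real n" for n
  define \<mu> where "\<mu> n = real (m n) / real n" for n
  define \<mu>' where "\<mu>' n = real (m' n) / real n" for n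
  define dd where "dd n = (real (m n) - \<pi> n * N n) * (real (m' n) - \<pi> n * N n)" for n
  define Pn where "Pn n = real n * \<pi> n" for n
  have NN: "N n = real n * (real n - 1) / 2" for n
    unfolding N_def by (cases n; simp add: choose_two real_of_nat_div algebra_simps)
  have s2: "s n * s n = real n" for n by (simp add: s_def)
  have spos: "s n > 0" if "n \<ge> 1" for n using that by (simp add: s_def)
  have is0: "(\<lambda>n. 1 / s n) \<longlonglongrightarrow> 0" unfolding s_def by real_asymp
  have Pl: "Pn \<longlonglongrightarrow> c" using P by (simp add: Pn_def[abs_def])
  have sp: "(\<lambda>n. s n * p n) \<longlonglongrightarrow> \<theta>" using T by (simp add: s_def mult.commute)
  have ev1: "eventually (\<lambda>n::nat. n \<ge> 2) sequentially" by (rule eventually_ge_at_top)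
  have qpos: "0 < q n" "q n < 1" "1 - q n = (1 - p n) * (1 - \<pi> n)" "q n - p n = \<pi> n * (1 - p n)" if "n \<ge> 1" for n
  proof -
    show e: "1 - q n = (1 - p n) * (1 - \<pi> n)" and "q n - p n = \<pi> n * (1 - p n)"
      unfolding q[OF that] by (simp_all add: algebra_simps)
    have "0 < (1 - p n) * (1 - \<pi> n)" using p[OF that] \<pi>[OF that] by (intro mult_pos_pos) auto
    thus "q n < 1" unfolding e[symmetric] by simp
    show "0 < q n" unfolding q[OF that] using p[OF that] \<pi>[OF that] by (intro add_pos_nonneg mult_nonneg_nonneg) auto
  qed
  have p1: "p n = q n * (1 - \<eta> n)" if "n \<ge> 1" for n using qpos(1)[OF that] by (simp add: \<eta>_def field_simps)
  have \<eta>01: "0 \<le> \<eta> n" "\<eta> n < 1" if "n \<ge> 1" for n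
  proof -
    have "0 \<le> q n - p n" unfolding qpos(4)[OF that] using p[OF that] \<pi>[OF that] by simp
    then show "0 \<le> \<eta> n" using qpos(1)[OF that] by (simp add: \<eta>_def)
    show "\<eta> n < 1" using qpos(1)[OF that] p[OF that] by (simp add: \<eta>_def)
  qed
  have p0: "p \<longlonglongrightarrow> 0"
  proof -
    have "(\<lambda>n. s n * p n * (1 / s n)) \<longlonglongrightarrow> \<theta> * 0" by (intro tendsto_mult sp is0)
    moreover have "eventually (\<lambda>n. s n * p n * (1 / s n) = p n) sequentially"
      using ev1 by eventually_elim (use spos in \<open>simp add: less_imp_neq[symmetric]\<close>)
    ultimately show ?thesis by (simp add: Lim_transform_eventually)
  qed
  have \<pi>0: "\<pi> \<longlonglongrightarrow> 0"
  proof -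
    have "(\<lambda>n. Pn n * (1 / real n)) \<longlonglongrightarrow> c * 0" by (intro tendsto_mult Pl lim_1_over_n)
    moreover have "eventually (\<lambda>n. Pn n * (1 / real n) = \<pi> n) sequentially"
      using ev1 by eventually_elim (simp add: Pn_def)
    ultimately show ?thesis by (simp add: Lim_transform_eventually)
  qed
  have sqp: "(\<lambda>n. s n * (q n - p n)) \<longlonglongrightarrow> 0"
  proof -
    have "(\<lambda>n. Pn n * (1 - p n) * (1 / s n)) \<longlonglongrightarrow> c * (1 - 0) * 0" by (intro tendsto_mult tendsto_diff tendsto_const Pl p0 is0)
    moreover have "eventually (\<lambda>n. Pn n * (1 - p n) * (1 / s n) = s n * (q n - p n)) sequentially"
      using ev1 
    proof eventually_elim
      case (elim n)
      then have n: "n \<ge> 1" by simp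
      show ?case using spos[OF n] unfolding qpos(4)[OF n] Pn_def s2[symmetric] by (simp add: field_simps)
    qed
    ultimately show ?thesis by (simp add: Lim_transform_eventually)
  qed
  have sq: "(\<lambda>n. s n * q n) \<longlonglongrightarrow> \<theta>"
    using tendsto_add[OF sp sqp] by (simp add: algebra_simps)
  have q0: "q \<longlonglongrightarrow> 0"
  proof -
    have "(\<lambda>n. s n * q n * (1 / s n)) \<longlonglongrightarrow> \<theta> * 0" by (intro tendsto_mult sq is0)
    moreover have "eventually (\<lambda>n. s n * q n * (1 / s n) = q n) sequentially"
      using ev1 by eventually_elim (use spos in \<open>simp add: less_imp_neq[symmetric]\<close>)
    ultimately show ?thesis by (simp add: Lim_transform_eventually)
  qed
  define E where "E n = s n * \<eta> n" for n
  have El: "E \<longlonglongrightarrow> c / \<theta>"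
  proof -
    have "(\<lambda>n. Pn n * (1 - p n) / (s n * q n)) \<longlonglongrightarrow> c * (1 - 0) / \<theta>"
      using \<theta> by (intro tendsto_divide tendsto_mult tendsto_diff tendsto_const Pl p0 sq) simp
    moreover have "eventually (\<lambda>n. Pn n * (1 - p n) / (s n * q n) = E n) sequentially"
      using ev1
    proof eventually_elim
      case (elim n)
      then have n: "n \<ge> 1" by simp
      show ?case using spos[OF n] qpos(1)[OF n] unfolding E_def \<eta>_def qpos(4)[OF n] Pn_def s2[symmetric] by (simp add: field_simps)
    qed
    ultimately show ?thesis by (simp add: Lim_transform_eventually)
  qed
  have \<eta>0: "\<eta> \<longlonglongrightarrow> 0"
  proof -
    have "(\<lambda>n. E n * (1 / s n)) \<longlonglongrightarrow> c / \<theta> * 0" by (intro tendsto_mult El is0)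
    moreover have "eventually (\<lambda>n. E n * (1 / s n) = \<eta> n) sequentially"
      using ev1 by eventually_elim (use spos in \<open>simp add: E_def less_imp_neq[symmetric]\<close>)
    ultimately show ?thesis by (simp add: Lim_transform_eventually)
  qed
  have sa: "(\<lambda>n. s n * a n) \<longlonglongrightarrow> 0"
  proof -
    have "(\<lambda>n. (E n)\<^sup>2 * (q n / (1 - q n)) * (1 / s n)) \<longlonglongrightarrow> (c / \<theta>)\<^sup>2 * (0 / (1 - 0)) * 0"
      by (intro tendsto_mult tendsto_power tendsto_divide tendsto_diff tendsto_const El q0 is0) simp
    moreover have "eventually (\<lambda>n. (E n)\<^sup>2 * (q n / (1 - q n)) * (1 / s n) = s n * a n) sequentially"
      using ev1
    proof eventually_elim
      case (elim n)
      then have n: "n \<ge> 1" by simp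
      show ?case using spos[OF n] qpos(1,2)[OF n] unfolding E_def \<eta>_def a_def
        by (simp add: field_simps power2_eq_square)
    qed
    ultimately show ?thesis by (simp add: Lim_transform_eventually)
  qed
  have a0a: "a0 n = 1 + a n" for n by (simp add: a0_def a_def)
  have an: "0 \<le> a n" if "n \<ge> 1" for n using qpos(1,2)[OF that] by (simp add: a_def)
  \<comment> \<open>The first-order correction of \<open>B\<close> matters, since it meets the
    factor \<open>m * m' / (N * q)\<close> of order \<open>sqrt n\<close>.\<close>
  have sB: "(\<lambda>n. s n * (B n - (1 - p n))) \<longlonglongrightarrow> 2 * c / \<theta>"
  proof -
    have "(\<lambda>n. (s n * a n + (2 * E n - E n * \<eta> n)) / (1 - \<eta> n)\<^sup>2 - s n * (q n - p n)) \<longlonglongrightarrow>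
        (0 + (2 * (c / \<theta>) - c / \<theta> * 0)) / (1 - 0)\<^sup>2 - 0"
      by (intro tendsto_mult tendsto_add tendsto_power tendsto_divide tendsto_diff tendsto_const El \<eta>0 sa sqp) simp
    moreover have "eventually (\<lambda>n. (s n * a n + (2 * E n - E n * \<eta> n)) / (1 - \<eta> n)\<^sup>2 - s n * (q n - p n) = s n * (B n - (1 - p n))) sequentially"
      using ev1
    proof eventually_elim
      case (elim n)
      then have n: "n \<ge> 1" by simp
      have e: "1 - \<eta> n \<noteq> 0" using \<eta>01(2)[OF n] by simp
      have "B n - (1 - p n) = (a n + (2 * \<eta> n - \<eta> n * \<eta> n)) / (1 - \<eta> n)\<^sup>2 - (q n - p n)"
      proof -
        have "(1 + b) / u\<^sup>2 - r - v = (b + (1 - u\<^sup>2)) / u\<^sup>2 - (r + v - 1)" if "u \<noteq> 0" for b u r v :: real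
          using that by (simp add: field_simps)
        from this[OF e, of "a n" "q n" "1 - p n"] show ?thesis
          unfolding B_def a0a by (simp add: power2_eq_square algebra_simps)
      qed
      have "s n * (B n - (1 - p n)) = s n * (a n + (2 * \<eta> n - \<eta> n * \<eta> n)) / (1 - \<eta> n)\<^sup>2 - s n * (q n - p n)"
        unfolding \<open>B n - (1 - p n) = _\<close> by (simp add: right_diff_distrib)
      also have "s n * (a n + (2 * \<eta> n - \<eta> n * \<eta> n)) = s n * a n + (2 * E n - E n * \<eta> n)"
        by (simp add: E_def algebra_simps)
      finally show ?case by simp
    qed
    ultimately show ?thesis by (simp add: Lim_transform_eventually)
  qed
  have Bl: "B \<longlonglongrightarrow> 1"
  proof -
    have "(\<lambda>n. s n * (B n - (1 - p n)) * (1 / s n) + (1 - p n)) \<longlonglongrightarrow> 2 * c / \<theta> * 0 + (1 - 0)"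
      by (intro tendsto_mult tendsto_add tendsto_diff tendsto_const sB is0 p0)
    moreover have "eventually (\<lambda>n. s n * (B n - (1 - p n)) * (1 / s n) + (1 - p n) = B n) sequentially"
      using ev1 by eventually_elim (use spos in \<open>simp add: less_imp_neq[symmetric]\<close>)
    ultimately show ?thesis by (simp add: Lim_transform_eventually)
  qed
  have tB: "t n = B n / q n" if "n \<ge> 1" for n
  proof -
    have "1 - \<eta> n \<noteq> 0" using \<eta>01(2)[OF that] by simp
    have "A * Q / (Q * U)\<^sup>2 - 1 = (A / U\<^sup>2 - Q) / Q" if "Q > 0" for A Q U :: real
      using that by (simp add: power_mult_distrib power2_eq_square diff_divide_distrib)
    from this[OF qpos(1)[OF that]] show ?thesis unfolding t_def B_def p1[OF that] .
  qed
  have \<mu>l: "\<mu> \<longlonglongrightarrow> c / 2" "\<mu>' \<longlonglongrightarrow> c / 2" using m m' by (simp_all add: \<mu>_def[abs_def] \<mu>'_def[abs_def])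
  define V where "V n = y n / s n" for n
  have Vl: "V \<longlonglongrightarrow> c\<^sup>2 / (2 * \<theta>)"
  proof -
    have "(\<lambda>n. 2 * \<mu> n * \<mu>' n * (1 + 4 * (1 / real n)) * B n / (s n * q n)) \<longlonglongrightarrow> 2 * (c / 2) * (c / 2) * (1 + 4 * 0) * 1 / \<theta>"
      using \<theta> by (intro tendsto_mult tendsto_add tendsto_divide tendsto_const \<mu>l Bl sq lim_1_over_n) simp
    moreover have "eventually (\<lambda>n. 2 * \<mu> n * \<mu>' n * (1 + 4 * (1 / real n)) * B n / (s n * q n) = V n) sequentially"
      using ev1
    proof eventually_elim
      case (elim n)
      then have n: "n \<ge> 1" by simp
      show ?case unfolding V_def y_def tB[OF n] \<mu>_def \<mu>'_def by (simp add: power2_eq_square mult_ac)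
    qed
    ultimately show ?thesis by (simp add: Lim_transform_eventually power2_eq_square)
  qed
  have al: "(\<lambda>n. real n * \<alpha> n) \<longlonglongrightarrow> 4 / c - 4"
  proof -
    have "(\<lambda>n. 1 / \<mu> n + 1 / \<mu>' n - 4) \<longlonglongrightarrow> 1 / (c / 2) + 1 / (c / 2) - 4"
      using c by (intro tendsto_add tendsto_divide tendsto_diff tendsto_const \<mu>l) auto
    moreover have "eventually (\<lambda>n. 1 / \<mu> n + 1 / \<mu>' n - 4 = real n * \<alpha> n) sequentially"
      using ev1 by eventually_elim (simp add: \<mu>_def \<mu>'_def \<alpha>_def algebra_simps)
    ultimately show ?thesis by (simp add: Lim_transform_eventually)
  qed
  have n2N: "(\<lambda>n. (real n)\<^sup>2 / N n) \<longlonglongrightarrow> 2" unfolding NN by real_asymp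
  have Nn2: "(\<lambda>n. N n / (real n)\<^sup>2) \<longlonglongrightarrow> 1 / 2" unfolding NN by real_asymp
  \<comment> \<open>\<open>2 * N n * (1 + 4 / n) / n^2 = 1 + 3 / n - 4 / n^2\<close> is the
    discrepancy between the normalisation of \<open>y\<close> and the one by
    \<open>N n\<close>.\<close>
  have s3n: "(\<lambda>n. s n * (3 / real n - 4 / (real n)\<^sup>2)) \<longlonglongrightarrow> 0" unfolding s_def by real_asymp
  define X where "X n = N n * a n - (real (m n) + real (m' n)) * (\<eta> n + (\<eta> n)\<^sup>2 / 2) +
     (y n - \<alpha> n * (y n)\<^sup>2 / 2 + \<alpha> n * y n / 2 + (\<alpha> n)\<^sup>2 * y n ^ 3 / 2)" for n
  \<comment> \<open>\<open>X\<close> rearranged. With \<open>x0 = (1 - p) / q\<close>, the leading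
    parts of \<open>N * a\<close>, \<open>- (m + m') * \<eta>\<close> and \<open>y\<close> are
    \<open>x0 * N * \<pi>^2\<close>, \<open>- x0 * \<pi> * (m + m')\<close> and
    \<open>x0 * m * m' / N\<close>, which sum to \<open>x0 * dd / N\<close>. Every summand of
    \<open>F\<close> converges.\<close>
  define F where "F n = (1 - p n) / (s n * q n) * (dd n / (real n * s n)) * ((real n)\<^sup>2 / N n)
      + (1 - p n) / (s n * q n) * (N n / (real n)\<^sup>2) * Pn n ^ 3 * (1 / (1 - \<pi> n)) * (1 / s n)
      + \<mu> n * \<mu>' n * ((real n)\<^sup>2 / N n) * (1 / (s n * q n)) * (s n * (B n - (1 - p n)) + B n * (s n * (3 / real n - 4 / (real n)\<^sup>2)))
      - (\<mu> n + \<mu>' n) * (E n)\<^sup>2 / 2 - (real n * \<alpha> n) * (V n)\<^sup>2 / 2 + (real n * \<alpha> n) * V n / 2 * (1 / s n)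
      + (real n * \<alpha> n)\<^sup>2 * V n ^ 3 / 2 * (1 / s n)" for n
  have Dl: "(\<lambda>n. dd n / (real n * s n)) \<longlonglongrightarrow> 0" using D by (simp add: dd_def s_def N_def)
  have "F \<longlonglongrightarrow> (1 - 0) / \<theta> * 0 * 2 + (1 - 0) / \<theta> * (1 / 2) * c ^ 3 * (1 / (1 - 0)) * 0
      + c / 2 * (c / 2) * 2 * (1 / \<theta>) * (2 * c / \<theta> + 1 * 0)
      - (c / 2 + c / 2) * (c / \<theta>)\<^sup>2 / 2 - (4 / c - 4) * (c\<^sup>2 / (2 * \<theta>))\<^sup>2 / 2 + (4 / c - 4) * (c\<^sup>2 / (2 * \<theta>)) / 2 * 0
      + (4 / c - 4)\<^sup>2 * (c\<^sup>2 / (2 * \<theta>)) ^ 3 / 2 * 0"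
    unfolding F_def using \<theta>
    by (intro tendsto_add tendsto_diff tendsto_mult Dl n2N Nn2 s3n sB Bl Vl al El \<mu>l is0 tendsto_power tendsto_divide tendsto_const p0 \<pi>0 Pl sq) auto
  \<comment> \<open>The contributions of \<open>B\<close>, of \<open>\<eta>^2\<close> and of
    \<open>1 / m + 1 / m'\<close> in \<open>\<alpha>\<close> are \<open>c^3 / \<theta>^2\<close>
    times 1, -1/2 and -1/2, and cancel. The \<open>- 4 / n\<close> in \<open>\<alpha>\<close>
    survives and gives \<open>c^4 / (2 * \<theta>^2)\<close>.\<close>
  also have "(1 - 0) / \<theta> * 0 * 2 + (1 - 0) / \<theta> * (1 / 2) * c ^ 3 * (1 / (1 - 0)) * 0
      + c / 2 * (c / 2) * 2 * (1 / \<theta>) * (2 * c / \<theta> + 1 * 0)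
      - (c / 2 + c / 2) * (c / \<theta>)\<^sup>2 / 2 - (4 / c - 4) * (c\<^sup>2 / (2 * \<theta>))\<^sup>2 / 2 + (4 / c - 4) * (c\<^sup>2 / (2 * \<theta>)) / 2 * 0
      + (4 / c - 4)\<^sup>2 * (c\<^sup>2 / (2 * \<theta>)) ^ 3 / 2 * 0 = c ^ 4 / (2 * \<theta>\<^sup>2)"
    using \<theta> c by (simp add: field_simps) (simp add: eval_nat_numeral algebra_simps)
  finally have Fl: "F \<longlonglongrightarrow> c ^ 4 / (2 * \<theta>\<^sup>2)" .
  have XF: "X n = F n" if n: "n \<ge> 2" for n
  proof -
    have n1: "n \<ge> 1" and rn: "real n > 0" and rn1: "real n - 1 > 0" using n by auto
    have Npos: "N n > 0" unfolding NN using rn rn1 by simp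
    note sp = spos[OF n1] and qp = qpos(1)[OF n1]
    have \<pi>1: "1 - \<pi> n > 0" using \<pi>[OF n1] by simp
    define x0 where "x0 = (1 - p n) / q n"
    have x0s: "(1 - p n) / (s n * q n) = x0 / s n" by (simp add: x0_def)
    have e1: "(1 - p n) / (s n * q n) * (dd n / (real n * s n)) * ((real n)\<^sup>2 / N n) = x0 * dd n / N n"
      unfolding x0s s2[symmetric] power2_eq_square using sp by (simp add: field_simps)
    have aa: "a n = x0 * (\<pi> n)\<^sup>2 / (1 - \<pi> n)"
    proof -
      have "(x * w)\<^sup>2 / (r * (w * z)) = w / r * x\<^sup>2 / z" if "w \<noteq> 0" for x w r z :: real
        using that by (simp add: power2_eq_square)
      thus ?thesis unfolding a_def qpos(3,4)[OF n1] x0_def using p[OF n1] by simp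
    qed
    have e2: "(1 - p n) / (s n * q n) * (N n / (real n)\<^sup>2) * Pn n ^ 3 * (1 / (1 - \<pi> n)) * (1 / s n) = N n * a n - x0 * N n * (\<pi> n)\<^sup>2"
    proof -
      have "(1 - p n) / (s n * q n) * (N n / (real n)\<^sup>2) * Pn n ^ 3 * (1 / (1 - \<pi> n)) * (1 / s n) =
         x0 * N n * (\<pi> n) ^ 3 / (1 - \<pi> n) * (real n ^ 3 / ((real n)\<^sup>2 * (s n * s n)))"
        unfolding x0s Pn_def by (simp add: power_mult_distrib mult_ac)
      also have "real n ^ 3 / ((real n)\<^sup>2 * (s n * s n)) = 1"
        unfolding s2 using rn by (simp add: power2_eq_square power3_eq_cube)
      also have "x0 * N n * (\<pi> n) ^ 3 / (1 - \<pi> n) * 1 = N n * a n - x0 * N n * (\<pi> n)\<^sup>2"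
        unfolding aa using \<pi>1 by (simp add: field_simps power2_eq_square power3_eq_cube)
      finally show ?thesis .
    qed
    have e3: "\<mu> n * \<mu>' n * ((real n)\<^sup>2 / N n) * (1 / (s n * q n)) * (s n * (B n - (1 - p n)) + B n * (s n * (3 / real n - 4 / (real n)\<^sup>2)))
       = y n - x0 * (real (m n) * real (m' n)) / N n"
    proof -
      let ?mm = "real (m n) * real (m' n)"
      have "\<mu> n * \<mu>' n * ((real n)\<^sup>2 / N n) * (1 / (s n * q n)) * (s n * (B n - (1 - p n)) + B n * (s n * (3 / real n - 4 / (real n)\<^sup>2)))
        = ?mm / (N n * q n) * (B n * (1 + (3 / real n - 4 / (real n)\<^sup>2)) - (1 - p n))"
      proof -
        have "s n * (B n - (1 - p n)) + B n * (s n * (3 / real n - 4 / (real n)\<^sup>2)) =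
            s n * (B n * (1 + (3 / real n - 4 / (real n)\<^sup>2)) - (1 - p n))" by (simp add: algebra_simps)
        moreover have "d / r * (b / r) * (r\<^sup>2 / v) * (1 / (u * w)) * (u * Z) = d * b / (v * w) * Z" if "r > 0" "u > 0" for d b r u v w Z :: real
          using that by (simp add: power2_eq_square)
        ultimately show ?thesis unfolding \<mu>_def \<mu>'_def using sp rn by simp
      qed
      also have "1 + (3 / real n - 4 / (real n)\<^sup>2) = 2 * N n * (1 + 4 / real n) / (real n)\<^sup>2"
        unfolding NN using rn by (simp add: field_simps power2_eq_square)
      also have "?mm / (N n * q n) * (B n * (2 * N n * (1 + 4 / real n) / (real n)\<^sup>2) - (1 - p n)) = y n - x0 * ?mm / N n"
      proof -
        have "d * b / (v * r) * (u * (2 * v * K / R) - w) = 2 * (u / r) * d * b * K / R - w / r * (d * b) / v"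
          if "v > 0" "r > 0" for d b v r u K R w :: real
          using that by (simp add: right_diff_distrib mult_ac)
        thus ?thesis unfolding y_def tB[OF n1] x0_def using Npos qp by simp
      qed
      finally show ?thesis .
    qed
    have e4: "(\<mu> n + \<mu>' n) * (E n)\<^sup>2 / 2 = (real (m n) + real (m' n)) * ((\<eta> n)\<^sup>2 / 2)"
    proof -
      have "(E n)\<^sup>2 = real n * (\<eta> n)\<^sup>2" unfolding E_def s2[symmetric] by (simp add: power2_eq_square)
      thus ?thesis unfolding \<mu>_def \<mu>'_def using rn by (simp add: field_simps)
    qed
    have yV: "y n = V n * s n" unfolding V_def using sp by simp
    have e5: "(real n * \<alpha> n) * (V n)\<^sup>2 / 2 = \<alpha> n * (y n)\<^sup>2 / 2"
      unfolding yV s2[symmetric] by (simp add: power2_eq_square)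
    have e6: "(real n * \<alpha> n) * V n / 2 * (1 / s n) = \<alpha> n * y n / 2"
      unfolding yV s2[symmetric] using sp by simp
    have e7: "(real n * \<alpha> n)\<^sup>2 * V n ^ 3 / 2 * (1 / s n) = (\<alpha> n)\<^sup>2 * y n ^ 3 / 2"
      unfolding yV s2[symmetric] using sp by (simp add: power2_eq_square power3_eq_cube)
    have e8: "(real (m n) + real (m' n)) * \<eta> n = x0 * (\<pi> n * (real (m n) + real (m' n)))"
      unfolding \<eta>_def qpos(4)[OF n1] x0_def by (simp add: field_simps)
    have e9: "x0 * dd n / N n = x0 * (real (m n) * real (m' n)) / N n - x0 * (\<pi> n * (real (m n) + real (m' n))) + x0 * N n * (\<pi> n)\<^sup>2"
      unfolding dd_def using Npos by (simp add: field_simps power2_eq_square)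
    have e10: "(real (m n) + real (m' n)) * (\<eta> n + (\<eta> n)\<^sup>2 / 2) =
        (real (m n) + real (m' n)) * \<eta> n + (real (m n) + real (m' n)) * ((\<eta> n)\<^sup>2 / 2)"
      by (rule distrib_left)
    show ?thesis unfolding X_def F_def e1 e2 e3 e4 e5 e6 e7 e9 e10 e8 by simp
  qed
  have "eventually (\<lambda>n. F n < c ^ 4 / (2 * \<theta>\<^sup>2) + \<epsilon>) sequentially"
    using order_tendstoD(2)[OF Fl] eps by simp
  moreover have "eventually (\<lambda>n. B n > 0) sequentially" using order_tendstoD(1)[OF Bl, of 0] by simp
  \<comment> \<open>\<open>y\<close> grows like \<open>sqrt n\<close>, since \<open>V\<close> has a
    positive limit.\<close>
  moreover have "eventually (\<lambda>n. y n \<ge> 1 / 2) sequentially"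
  proof -
    have "filterlim (\<lambda>n. V n * s n) at_top sequentially"
    proof (rule filterlim_tendsto_pos_mult_at_top[OF Vl])
      show "0 < c\<^sup>2 / (2 * \<theta>)" using c \<theta> by simp
      show "filterlim s at_top sequentially" unfolding s_def by real_asymp
    qed
    then have "eventually (\<lambda>n. V n * s n \<ge> 1 / 2) sequentially"
      unfolding filterlim_at_top by blast
    with ev1 show ?thesis by eventually_elim (use spos in \<open>simp add: V_def less_imp_neq[symmetric]\<close>)
  qed
  \<comment> \<open>\<open>c < 1 / 2\<close> puts the sizes below \<open>n / 4\<close>, as
    \<open>overlap_series_le\<close> requires.\<close>
  moreover have "eventually (\<lambda>n. 0 < \<mu> n \<and> \<mu> n < 1 / 4) sequentially" "eventually (\<lambda>n. 0 < \<mu>' n \<and> \<mu>' n < 1 / 4) sequentially"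
    using order_tendstoD(1)[OF \<mu>l(1), of 0] order_tendstoD(1)[OF \<mu>l(2), of 0]
      order_tendstoD(2)[OF \<mu>l(1), of "1 / 4"] order_tendstoD(2)[OF \<mu>l(2), of "1 / 4"] c
    by (auto intro!: eventually_conj)
  ultimately show ?thesis using ev1
  proof eventually_elim
    case (elim n)
    then have n: "n \<ge> 1" and rn: "real n > 0" by auto
    have mm: "1 \<le> m n" "4 * m n \<le> n" "1 \<le> m' n" "4 * m' n \<le> n"
      using elim rn by (auto simp: \<mu>_def \<mu>'_def field_simps)
    have t0: "0 \<le> t n" unfolding tB[OF n] using elim qpos(1)[OF n] by simp
    have O: "overlap_series n (m n) (m' n) (t n) \<le> exp (y n - \<alpha> n * (y n)\<^sup>2 / 2 + \<alpha> n * y n / 2 + (\<alpha> n)\<^sup>2 * y n ^ 3 / 2)"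
      using overlap_series_le[OF mm t0] elim unfolding y_def \<alpha>_def by simp
    have a1: "1 \<le> a0 n" unfolding a0a using an[OF n] by simp
    have A: "a0 n ^ (n choose 2) \<le> exp (N n * a n)"
    proof -
      have "a0 n ^ (n choose 2) \<le> exp (a n) ^ (n choose 2)"
        unfolding a0a using an[OF n] by (intro power_mono exp_ge_add_one_self) simp
      thus ?thesis by (simp add: N_def exp_of_nat_mult)
    qed
    have Bb: "(p n / q n / a0 n) ^ (m n + m' n) \<le> exp (- ((real (m n) + real (m' n)) * (\<eta> n + (\<eta> n)\<^sup>2 / 2)))"
    proof -
      have pq: "p n / q n = 1 - \<eta> n" using qpos(1)[OF n] by (simp add: \<eta>_def field_simps)
      have "p n / q n / a0 n \<le> exp (- \<eta> n - (\<eta> n)\<^sup>2 / 2)"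
      proof (rule order.trans[OF _ one_minus_le_exp2[OF \<eta>01[OF n]]])
        have "(1 - \<eta> n) / a0 n \<le> (1 - \<eta> n) / 1" using a1 \<eta>01[OF n] by (intro divide_left_mono) auto
        thus "p n / q n / a0 n \<le> 1 - \<eta> n" by (simp add: pq)
      qed
      then have "(p n / q n / a0 n) ^ (m n + m' n) \<le> exp (- \<eta> n - (\<eta> n)\<^sup>2 / 2) ^ (m n + m' n)"
        using p[OF n] qpos(1)[OF n] a1 by (intro power_mono) auto
      also have "\<dots> = exp (real (m n + m' n) * (- \<eta> n - (\<eta> n)\<^sup>2 / 2))" by (simp only: exp_of_nat_mult)
      also have "real (m n + m' n) * (- \<eta> n - (\<eta> n)\<^sup>2 / 2) = - ((real (m n) + real (m' n)) * (\<eta> n + (\<eta> n)\<^sup>2 / 2))"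
        by (simp add: algebra_simps)
      finally show ?thesis .
    qed
    have O0: "0 \<le> overlap_series n (m n) (m' n) (t n)"
      unfolding overlap_series_def using t0 by (intro sum_nonneg mult_nonneg_nonneg prod_nonneg divide_nonneg_nonneg) auto
    have "a0 n ^ (n choose 2) * (p n / q n / a0 n) ^ (m n + m' n) * overlap_series n (m n) (m' n) (t n) \<le>
       exp (N n * a n) * exp (- ((real (m n) + real (m' n)) * (\<eta> n + (\<eta> n)\<^sup>2 / 2))) *
       exp (y n - \<alpha> n * (y n)\<^sup>2 / 2 + \<alpha> n * y n / 2 + (\<alpha> n)\<^sup>2 * y n ^ 3 / 2)"
      using p[OF n] qpos(1)[OF n] a1 by (intro mult_mono A Bb O O0 mult_nonneg_nonneg) auto
    also have "\<dots> = exp (X n)" unfolding exp_add[symmetric] X_def by simp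
    also have "\<dots> \<le> exp (c ^ 4 / (2 * \<theta>\<^sup>2) + \<epsilon>)" using elim XF[of n] by simp
    finally show ?case unfolding t_def .
  qed
qed

section \<open>The planted law\<close>

definition planted_given :: "'e set \<Rightarrow> real \<Rightarrow> 'e set \<Rightarrow> ('e \<Rightarrow> bool) pmf" where
  "planted_given E p M = Pi_pmf E False (\<lambda>e. if e \<in> M then return_pmf True else bernoulli_pmf p)"

text \<open>The coupling with an unplanted graph: switch on the edges of \<open>M\<close> in an
  independent Bernoulli sample. Expectations given \<open>M\<close> thereby become expectations
  under a product law.\<close>

lemma planted_given_eq_map:
  assumes "finite E" "M \<subseteq> E"
  shows "planted_given E p M = map_pmf (\<lambda>x e. x e \<or> e \<in> M) (bernoulli_product E p)"
proof -
  have "planted_given E p M = Pi_pmf E False (\<lambda>e. bind_pmf (bernoulli_pmf p) (\<lambda>b. return_pmf (b \<or> e \<in> M)))"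
    unfolding planted_given_def
    by (intro Pi_pmf_cong refl) (auto simp: bind_return_pmf' bind_pmf_const)
  also have "\<dots> = bernoulli_product E p \<bind> (\<lambda>x. return_pmf (\<lambda>e. if e \<in> E then x e \<or> e \<in> M else False))"
    unfolding bernoulli_product_def using assms(1) by (subst Pi_pmf_bind[where d' = False]) auto
  also have "\<dots> = bernoulli_product E p \<bind> (\<lambda>x. return_pmf (\<lambda>e. x e \<or> e \<in> M))"
  proof (intro bind_pmf_cong refl arg_cong[where f = return_pmf] ext)
    fix x e assume "x \<in> set_pmf (bernoulli_product E p)"
    then have "x \<in> {f. \<forall>e. e \<notin> E \<longrightarrow> f e = False}"
      unfolding bernoulli_product_def by (rule subsetD[OF set_Pi_pmf_subset[OF assms(1)]])
    then have "e \<notin> E \<Longrightarrow> \<not> x e" by simp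
    moreover have "e \<in> M \<Longrightarrow> e \<in> E" using assms(2) by (rule subsetD)
    ultimately show "(if e \<in> E then x e \<or> e \<in> M else False) = (x e \<or> e \<in> M)"
      by (cases "e \<in> E") auto
  qed
  finally show ?thesis by (simp add: map_pmf_def)
qed

lemma finite_set_planted_given: "finite E \<Longrightarrow> finite (set_pmf (planted_given E p M))"
  unfolding planted_given_def by (subst set_Pi_pmf) auto

definition edge_ratio :: "real \<Rightarrow> real \<Rightarrow> bool \<Rightarrow> bool \<Rightarrow> real" where
  "edge_ratio p q planted b =
     pmf (if planted then return_pmf True else bernoulli_pmf p) b / pmf (bernoulli_pmf q) b"

definition planted_ratio :: "'e set \<Rightarrow> real \<Rightarrow> real \<Rightarrow> 'e set \<Rightarrow> ('e \<Rightarrow> bool) \<Rightarrow> real" where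
  "planted_ratio E p q M x = (\<Prod>e\<in>E. edge_ratio p q (e \<in> M) (x e))"

lemma pmf_planted_given:
  assumes "finite E" "0 < q" "q < 1"
  shows "pmf (planted_given E p M) x = pmf (bernoulli_product E q) x * planted_ratio E p q M x"
proof -
  have nz: "pmf (bernoulli_pmf q) b \<noteq> 0" for b using assms by (cases b) auto
  show ?thesis
    unfolding planted_given_def bernoulli_product_def planted_ratio_def pmf_Pi[OF assms(1)] edge_ratio_def
    using nz by (auto simp: prod.distrib[symmetric] intro!: prod.cong)
qed

lemma expectation_planted_ratio:
  fixes g :: "('e \<Rightarrow> bool) \<Rightarrow> 'b::{banach, second_countable_topology}"
  assumes "finite E" "0 < q" "q < 1"
  shows "measure_pmf.expectation (bernoulli_product E q) (\<lambda>x. planted_ratio E p q M x *\<^sub>R g x) =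
    measure_pmf.expectation (planted_given E p M) g"
proof -
  let ?S = "set_pmf (bernoulli_product E q)"
  have fin: "finite ?S" by (rule finite_set_bernoulli_product[OF assms(1)])
  have "measure_pmf.expectation (bernoulli_product E q) (\<lambda>x. planted_ratio E p q M x *\<^sub>R g x) =
     (\<Sum>x\<in>?S. pmf (bernoulli_product E q) x *\<^sub>R planted_ratio E p q M x *\<^sub>R g x)"
    by (rule integral_measure_pmf[OF fin]) auto
  also have "\<dots> = (\<Sum>x\<in>?S. pmf (planted_given E p M) x *\<^sub>R g x)"
    unfolding pmf_planted_given[OF assms] by simp
  also have "\<dots> = measure_pmf.expectation (planted_given E p M) g"
    by (rule integral_measure_pmf[OF fin, symmetric])
       (auto simp: set_pmf_eq pmf_planted_given[OF assms])
  finally show ?thesis .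
qed

text \<open>\<open>a0\<close> is one plus the chi-square divergence of Bernoulli \<open>p\<close>
  from Bernoulli \<open>q\<close>. The values for an edge in one or in both matchings,
  \<open>p / q\<close> and \<open>1 / q\<close>, are written as corrections of \<open>a0\<close>, so
  that the product over all edges depends only on \<open>card M + card M'\<close> and on the
  overlap.\<close>

lemma edge_ratio_product:
  assumes p: "0 < p" "p < 1" and q: "0 < q" "q < 1"
  defines "a0 \<equiv> 1 + (q - p)\<^sup>2 / (q * (1 - q))"
  shows "measure_pmf.expectation (bernoulli_pmf q) (\<lambda>b. edge_ratio p q s b * edge_ratio p q s' b) =
    a0 * (if s then p / q / a0 else 1) * (if s' then p / q / a0 else 1) * (if s \<and> s' then a0 * q / p\<^sup>2 else 1)"
proof -
  have a0: "a0 > 0" using q by (simp add: a0_def add_pos_nonneg)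
  have "p\<^sup>2 / q + (1 - p)\<^sup>2 / (1 - q) = a0"
  proof -
    have "(p\<^sup>2 / q + (1 - p)\<^sup>2 / (1 - q)) * (q * (1 - q)) = p\<^sup>2 * (1 - q) + (1 - p)\<^sup>2 * q"
      using q by (simp add: field_simps)
    also have "\<dots> = q * (1 - q) + (q - p)\<^sup>2" by (simp add: algebra_simps power2_eq_square)
    also have "\<dots> = a0 * (q * (1 - q))" using q by (simp add: a0_def distrib_right)
    finally show ?thesis using q by simp
  qed
  then have 0: "p / q * (p / q) * q + (1 - p) / (1 - q) * ((1 - p) / (1 - q)) * (1 - q) = a0"
    using q by (simp add: power2_eq_square)
  have 1: "1 / q * (1 / q) * q = a0 * (p / q / a0) * (p / q / a0) * (a0 * q / p\<^sup>2)"
    using q p a0 by (simp add: power2_eq_square)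
  have 2: "p / q * (1 / q) * q = a0 * (p / q / a0)" using q p a0 by simp
  have 3: "1 / q * (p / q) * q = a0 * (p / q / a0)" using 2 by (simp only: mult.commute)
  have e: "measure_pmf.expectation (bernoulli_pmf q) (\<lambda>b. edge_ratio p q s b * edge_ratio p q s' b) =
      edge_ratio p q s True * edge_ratio p q s' True * q + edge_ratio p q s False * edge_ratio p q s' False * (1 - q)"
    using q by simp
  have r: "edge_ratio p q True True = 1 / q" "edge_ratio p q False True = p / q"
    "edge_ratio p q True False = 0" "edge_ratio p q False False = (1 - p) / (1 - q)"
    using p q by (simp_all add: edge_ratio_def)
  show ?thesis unfolding e using 0 1 2 3
    by (cases s; cases s'; simp only: r if_True if_False simp_thms mult_1_right mult_zero_left mult_zero_right add_0_right)
qed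

lemma expectation_planted_ratio_product:
  assumes E: "finite E" and M: "M \<subseteq> E" "M' \<subseteq> E" and p: "0 < p" "p < 1" and q: "0 < q" "q < 1"
  defines "a0 \<equiv> 1 + (q - p)\<^sup>2 / (q * (1 - q))"
  shows "measure_pmf.expectation (bernoulli_product E q) (\<lambda>x. planted_ratio E p q M x * planted_ratio E p q M' x) =
    a0 ^ card E * (p / q / a0) ^ (card M + card M') * (a0 * q / p\<^sup>2) ^ card (M \<inter> M')"
proof -
  have pc: "(\<Prod>e\<in>E. if e \<in> S then z else 1) = z ^ card S" if "S \<subseteq> E" for S and z :: real
  proof -
    have "(\<Prod>e\<in>E. if e \<in> S then z else 1) = (\<Prod>e\<in>E \<inter> S. z)"
      by (rule prod.inter_restrict[OF E, symmetric])
    also have "E \<inter> S = S" using that by blast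
    finally show ?thesis by simp
  qed
  have "measure_pmf.expectation (bernoulli_product E q) (\<lambda>x. planted_ratio E p q M x * planted_ratio E p q M' x) =
     measure_pmf.expectation (bernoulli_product E q) (\<lambda>x. \<Prod>e\<in>E. edge_ratio p q (e \<in> M) (x e) * edge_ratio p q (e \<in> M') (x e))"
    by (simp add: planted_ratio_def prod.distrib)
  also have "\<dots> = (\<Prod>e\<in>E. measure_pmf.expectation (bernoulli_pmf q) (\<lambda>b. edge_ratio p q (e \<in> M) b * edge_ratio p q (e \<in> M') b))"
    unfolding bernoulli_product_def
    by (rule expectation_prod_Pi_pmf[OF E]) (auto simp: edge_ratio_def intro: integrable_measure_pmf_finite)
  also have "\<dots> = (\<Prod>e\<in>E. a0 * (if e \<in> M then p / q / a0 else 1) * (if e \<in> M' then p / q / a0 else 1) * (if e \<in> M \<inter> M' then a0 * q / p\<^sup>2 else 1))"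
    unfolding edge_ratio_product[OF p q] a0_def by simp
  also have "\<dots> = a0 ^ card E * (p / q / a0) ^ card M * (p / q / a0) ^ card M' * (a0 * q / p\<^sup>2) ^ card (M \<inter> M')"
    by (simp only: prod.distrib prod_constant pc[OF M(1)] pc[OF M(2)] pc[OF le_infI1[OF M(1)]])
  finally show ?thesis by (simp add: power_add)
qed

section \<open>The shift of the wedge form under planting\<close>

lemma matching_line_nb:
  assumes M: "M \<in> kmatchings n"
  shows "e \<in> M \<Longrightarrow> line_nb n e \<inter> M = {}" and "e \<in> complete_edges n \<Longrightarrow> card (line_nb n e \<inter> M) \<le> 2"
proof -
  have disj: "f \<inter> f' = {}" if "f \<in> M" "f' \<in> M" "f \<noteq> f'" for f f'
    using M that by (auto simp: matchings_def disjoint_def)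
  show "line_nb n e \<inter> M = {}" if e: "e \<in> M"
  proof (rule ccontr)
    assume "line_nb n e \<inter> M \<noteq> {}"
    then obtain f where f: "f \<in> M" "card (e \<inter> f) = 1" "f \<in> complete_edges n" by (auto simp: line_nb_def)
    then have "e \<noteq> f" by (auto simp: complete_edges_def)
    then show False using disj[OF e f(1)] f(2) by simp
  qed
  assume e: "e \<in> complete_edges n"
  then have ce: "card e = 2" "finite e" by (auto simp: complete_edges_def intro: finite_subset)
  \<comment> \<open>Distinct matching edges meet \<open>e\<close> in distinct vertices, so at most
    two of them are adjacent to \<open>e\<close>.\<close>
  have "inj_on (\<lambda>f. e \<inter> f) (line_nb n e \<inter> M)"
  proof (rule inj_onI)
    fix f f' assume f: "f \<in> line_nb n e \<inter> M" "f' \<in> line_nb n e \<inter> M" and eq: "e \<inter> f = e \<inter> f'"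
    have "e \<inter> f \<noteq> {}" using f by (auto simp: line_nb_def)
    then show "f = f'" using disj[of f f'] f eq by blast
  qed
  then have "card (line_nb n e \<inter> M) = card ((\<lambda>f. e \<inter> f) ` (line_nb n e \<inter> M))" by (simp add: card_image)
  also have "\<dots> \<le> card {X. X \<subseteq> e \<and> card X = 1}"
    using ce by (intro card_mono) (auto simp: line_nb_def)
  also have "\<dots> = 2" using n_subsets[OF ce(2), of 1] ce by simp
  finally show "card (line_nb n e \<inter> M) \<le> 2" .
qed

text \<open>Under the coupling \<open>A = B \<or> M\<close> the centred entry of \<open>A\<close> is \<open>\<beta> (1 - M) + (1 - p) (M - \<pi>)\<close> with
  \<open>\<beta>\<close> the centred entry of \<open>B\<close>; the bilinear form in the deterministic parts gives the mean shift.\<close>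

lemma wedge_form_shift:
  fixes n :: nat and p \<pi> :: real
  assumes M: "M \<in> kmatchings n" and p: "0 \<le> p" "p \<le> 1" and \<pi>: "0 \<le> \<pi>" "\<pi> \<le> 1"
  defines "q \<equiv> p + \<pi> * (1 - p)" and "E \<equiv> complete_edges n"
  defines "form \<equiv> \<lambda>r. regular_form.form E (line_nb n) r"
  defines "offset \<equiv> (1 - p)\<^sup>2 * \<pi> * real (2 * (n - 2)) * (\<pi> * real (card E) - 2 * real (card M))"
  shows "measure_pmf.expectation (bernoulli_product E p)
      (\<lambda>x. \<bar>form q (\<lambda>e. x e \<or> e \<in> M) - form p x - offset\<bar>) \<le>
    real n * (4 * p + 2 * sqrt p * (2 + 2 * real n * \<pi>))"
proof -
  let ?\<Delta> = "2 * (n - 2)"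
  have ME: "M \<subseteq> E" using M by (auto simp: matchings_def E_def)
  have finE: "finite E" by (simp add: E_def complete_edges_finite)
  have q01: "0 \<le> q" "q \<le> 1"
  proof -
    show "0 \<le> q" unfolding q_def using p \<pi> by simp
    have "\<pi> * (1 - p) \<le> 1 * (1 - p)" using p \<pi> by (intro mult_right_mono) auto
    thus "q \<le> 1" by (simp add: q_def)
  qed
  interpret P: regular_form E "line_nb n" ?\<Delta> p unfolding E_def by (rule regular_form_complete[OF p])
  interpret Q: regular_form E "line_nb n" ?\<Delta> q unfolding E_def by (rule regular_form_complete[OF q01])
  \<comment> \<open>\<open>b + h\<close> splits a centred planted entry into its random and its
    deterministic part; \<open>H\<close> is the neighbour sum of \<open>h\<close>, and
    \<open>d e\<close> is the number of matching edges adjacent to \<open>e\<close>.\<close>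
  define I where "I e = (of_bool (e \<in> M) :: real)" for e
  define h where "h e = (1 - p) * (I e - \<pi>)" for e
  define H where "H e = (\<Sum>f\<in>line_nb n e. h f)" for e
  define b where "b x e = (1 - I e) * centred p x e" for x e
  define d where "d e = (\<Sum>f\<in>line_nb n e. I f)" for e
  have swap: "(\<Sum>e\<in>E. \<Sum>f\<in>line_nb n e. F e f) = (\<Sum>e\<in>E. \<Sum>f\<in>line_nb n e. F f e)" for F :: "nat set \<Rightarrow> nat set \<Rightarrow> real"
  proof -
    have i: "(\<Sum>f\<in>line_nb n e. G f) = (\<Sum>f\<in>E. if f \<in> line_nb n e then G f else 0)" if "e \<in> E" for e and G :: "nat set \<Rightarrow> real"
    proof -
      have "line_nb n e = E \<inter> line_nb n e" using P.nb_sub[OF that] by blast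
      thus ?thesis using sum.inter_restrict[OF finE, of G "line_nb n e"] by simp
    qed
    have "(\<Sum>e\<in>E. \<Sum>f\<in>line_nb n e. F e f) = (\<Sum>e\<in>E. \<Sum>f\<in>E. if f \<in> line_nb n e then F e f else 0)"
      using i by simp
    also have "\<dots> = (\<Sum>f\<in>E. \<Sum>e\<in>E. if f \<in> line_nb n e then F e f else 0)" by (rule sum.swap)
    also have "\<dots> = (\<Sum>f\<in>E. \<Sum>e\<in>E. if e \<in> line_nb n f then F e f else 0)"
      using P.nb_sym by (intro sum.cong refl) auto
    also have "\<dots> = (\<Sum>f\<in>E. \<Sum>e\<in>line_nb n f. F e f)" using i by simp
    finally show ?thesis .
  qed
  have centA: "centred q (\<lambda>e. x e \<or> e \<in> M) e = b x e + h e" for x e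
    by (cases "e \<in> M"; cases "x e") (simp_all add: centred_def b_def h_def I_def q_def algebra_simps)
  have d2: "0 \<le> d e" "d e \<le> 2" if "e \<in> E" for e
  proof -
    have "d e = real (card (line_nb n e \<inter> M))"
      unfolding d_def I_def using P.finite_nb[OF that] by (simp add: Int_def)
    thus "0 \<le> d e" "d e \<le> 2" using matching_line_nb(2)[OF M, of e] that by (auto simp: E_def)
  qed
  have d0: "I e * d e = 0" if "e \<in> E" for e
  proof (cases "e \<in> M")
    case True
    then have "d e = real (card (line_nb n e \<inter> M))"
      unfolding d_def I_def using P.finite_nb[OF that] by (simp add: Int_def)
    then show ?thesis using matching_line_nb(1)[OF M True] by simp
  qed (simp add: I_def)
  have HI: "H e = (1 - p) * (d e - \<pi> * real ?\<Delta>)" if "e \<in> E" for e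
    unfolding H_def h_def d_def using P.nb_card[OF that]
    by (simp add: sum_distrib_left[symmetric] sum_subtractf)
  have sumI: "(\<Sum>e\<in>E. I e) = real (card M)"
  proof -
    have "E \<inter> M = M" using ME by blast
    thus ?thesis unfolding I_def using finE by (simp add: Int_def)
  qed
  have sumd: "(\<Sum>e\<in>E. d e) = real (card M) * real ?\<Delta>"
  proof -
    have "(\<Sum>e\<in>E. d e) = (\<Sum>e\<in>E. \<Sum>f\<in>line_nb n e. I e)" unfolding d_def by (rule swap)
    also have "\<dots> = (\<Sum>e\<in>E. I e * real ?\<Delta>)" using P.nb_card by (intro sum.cong refl) simp
    finally show ?thesis using sumI by (simp add: sum_distrib_right[symmetric])
  qed
  \<comment> \<open>A matching contains no wedge, so the terms \<open>I e * d e\<close> drop out and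
    only those with a factor \<open>\<pi>\<close> remain.\<close>
  have const: "(\<Sum>e\<in>E. h e * H e) = offset"
  proof -
    have "(\<Sum>e\<in>E. h e * H e) = (\<Sum>e\<in>E. (1 - p)\<^sup>2 * (I e * d e - \<pi> * real ?\<Delta> * I e - \<pi> * d e + \<pi>\<^sup>2 * real ?\<Delta>))"
    proof (rule sum.cong[OF refl])
      fix e assume e: "e \<in> E"
      have "w * (i - r) * (w * (k - r * D)) = w\<^sup>2 * (i * k - r * D * i - r * k + r\<^sup>2 * D)" for w i r k D :: real
        by (simp add: algebra_simps power2_eq_square)
      thus "h e * H e = (1 - p)\<^sup>2 * (I e * d e - \<pi> * real ?\<Delta> * I e - \<pi> * d e + \<pi>\<^sup>2 * real ?\<Delta>)"
        unfolding HI[OF e] h_def .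
    qed
    also have "\<dots> = (1 - p)\<^sup>2 * (0 - \<pi> * real ?\<Delta> * real (card M) - \<pi> * (real (card M) * real ?\<Delta>) + real (card E) * (\<pi>\<^sup>2 * real ?\<Delta>))"
    proof -
      have "(\<Sum>e\<in>E. I e * d e) = 0" by (intro sum.neutral ballI d0)
      thus ?thesis by (simp only: sum_distrib_left[symmetric] sum.distrib sum_subtractf sumI sumd sum_constant)
          (simp only: mult.assoc mult.commute mult.left_commute)
    qed
    also have "\<dots> = offset"
    proof -
      have "w * (0 - r * D * k - r * (k * D) + N * (r\<^sup>2 * D)) = w * r * D * (r * N - 2 * k)" for w r k D N :: real
        by (simp add: algebra_simps power2_eq_square)
      thus ?thesis unfolding offset_def .
    qed
    finally show ?thesis .
  qed
  \<comment> \<open>\<open>b\<close> vanishes on \<open>M\<close>, so its form differs from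
    \<open>form p x\<close> exactly by the adjacent pairs with at least one edge in
    \<open>M\<close>, which \<open>K\<close> selects; \<open>X2\<close> collects the cross terms of
    \<open>b\<close> and \<open>h\<close>.\<close>
  define K where "K e f = (of_bool (f \<in> line_nb n e) * (1 - (1 - I e) * (1 - I f)) :: real)" for e f
  define X1 where "X1 x = (\<Sum>e\<in>E. \<Sum>f\<in>E - {e}. K e f * centred p x e * centred p x f)" for x
  define X2 where "X2 x = (\<Sum>e\<in>E. (2 * (1 - I e) * H e) * centred p x e)" for x
  have nbE: "(\<Sum>f\<in>line_nb n e. G f) = (\<Sum>f\<in>E - {e}. of_bool (f \<in> line_nb n e) * G f)" if "e \<in> E" for e and G :: "nat set \<Rightarrow> real"
  proof -
    have "line_nb n e = (E - {e}) \<inter> line_nb n e" using P.nb_sub[OF that] P.nb_irrefl[of e] by blast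
    then have "(\<Sum>f\<in>line_nb n e. G f) = (\<Sum>f\<in>E - {e}. if f \<in> line_nb n e then G f else 0)"
      using sum.inter_restrict[of "E - {e}" G "line_nb n e"] finE by simp
    also have "\<dots> = (\<Sum>f\<in>E - {e}. of_bool (f \<in> line_nb n e) * G f)"
      by (intro sum.cong refl) simp
    finally show ?thesis .
  qed
  have split: "form q (\<lambda>e. x e \<or> e \<in> M) - form p x - offset = X2 x - X1 x" for x
  proof -
    have "form q (\<lambda>e. x e \<or> e \<in> M) = (\<Sum>e\<in>E. \<Sum>f\<in>line_nb n e. (b x e + h e) * (b x f + h f))"
      unfolding form_def Q.form_def Q.nbsum_def centA sum_distrib_left ..
    also have "\<dots> = (\<Sum>e\<in>E. \<Sum>f\<in>line_nb n e. b x e * b x f) + (\<Sum>e\<in>E. \<Sum>f\<in>line_nb n e. b x e * h f) +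
       (\<Sum>e\<in>E. \<Sum>f\<in>line_nb n e. h e * b x f) + (\<Sum>e\<in>E. \<Sum>f\<in>line_nb n e. h e * h f)"
    proof -
      have "(b x e + h e) * (b x f + h f) = b x e * b x f + b x e * h f + h e * b x f + h e * h f" for e f
        by (simp add: algebra_simps)
      thus ?thesis by (simp only: sum.distrib)
    qed
    also have "(\<Sum>e\<in>E. \<Sum>f\<in>line_nb n e. h e * b x f) = (\<Sum>e\<in>E. \<Sum>f\<in>line_nb n e. b x e * h f)"
      by (subst swap) (simp add: mult.commute)
    also have "(\<Sum>e\<in>E. \<Sum>f\<in>line_nb n e. h e * h f) = offset"
      unfolding const[symmetric] H_def sum_distrib_left ..
    finally have 1: "form q (\<lambda>e. x e \<or> e \<in> M) = (\<Sum>e\<in>E. \<Sum>f\<in>line_nb n e. b x e * b x f)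
      + 2 * (\<Sum>e\<in>E. \<Sum>f\<in>line_nb n e. b x e * h f) + offset" by simp
    have 2: "X2 x = 2 * (\<Sum>e\<in>E. \<Sum>f\<in>line_nb n e. b x e * h f)"
      unfolding X2_def H_def b_def sum_distrib_left sum_distrib_right by (intro sum.cong refl) (simp add: mult_ac)
    have 3: "X1 x = form p x - (\<Sum>e\<in>E. \<Sum>f\<in>line_nb n e. b x e * b x f)"
    proof -
      have "form p x - (\<Sum>e\<in>E. \<Sum>f\<in>line_nb n e. b x e * b x f) =
         (\<Sum>e\<in>E. \<Sum>f\<in>line_nb n e. (1 - (1 - I e) * (1 - I f)) * centred p x e * centred p x f)"
        unfolding form_def P.form_def P.nbsum_def sum_distrib_left sum_subtractf[symmetric] b_def
        by (intro sum.cong refl) (simp add: algebra_simps)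
      also have "\<dots> = X1 x"
        unfolding X1_def by (rule sum.cong[OF refl]) (simp add: nbE K_def mult.assoc)
      finally show ?thesis ..
    qed
    show ?thesis unfolding 1 2 3 by simp
  qed
  have cardM: "2 * real (card M) \<le> real n" using two_card_matching_le[OF M] by linarith
  have \<Delta>n: "real ?\<Delta> \<le> 2 * real n" by simp
  have E1: "measure_pmf.expectation (bernoulli_product E p) (\<lambda>x. (X1 x)\<^sup>2) \<le> (4 * p * real n)\<^sup>2"
  proof -
    have Ksym: "K e f = K f e" if "e \<in> E" "f \<in> E" for e f
      unfolding K_def using P.nb_sym[OF that] by (simp add: mult.commute)
    \<comment> \<open>Cut off outside \<open>E\<close>, where the neighbour relation need not be
      symmetric: the variance formula asks for symmetry at all arguments.\<close>
    define K' where "K' e f = (if e \<in> E \<and> f \<in> E then K e f else 0)" for e f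
    have K'sym: "K' e f = K' f e" for e f unfolding K'_def using Ksym by auto
    have "X1 x = (\<Sum>e\<in>E. \<Sum>f\<in>E - {e}. K' e f * centred p x e * centred p x f)" for x
      unfolding X1_def K'_def by (intro sum.cong refl) auto
    then have "measure_pmf.expectation (bernoulli_product E p) (\<lambda>x. (X1 x)\<^sup>2) = 2 * (p * (1 - p))\<^sup>2 * (\<Sum>e\<in>E. \<Sum>f\<in>E - {e}. (K' e f)\<^sup>2)"
      using expectation_centred_quadratic_offdiag[OF finE p K'sym order.refl] by simp
    \<comment> \<open>Only adjacent pairs with an edge in \<open>M\<close> count: at most
      \<open>2 * card M * ?\<Delta>\<close> ordered pairs, of order \<open>n^2\<close>, whereas all
      adjacent pairs together are of order \<open>n^3\<close>.\<close>
    also have "(\<Sum>e\<in>E. \<Sum>f\<in>E - {e}. (K' e f)\<^sup>2) \<le> (\<Sum>e\<in>E. \<Sum>f\<in>line_nb n e. I e + I f)"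
    proof (intro sum_mono)
      fix e assume e: "e \<in> E"
      have "(\<Sum>f\<in>E - {e}. (K' e f)\<^sup>2) \<le> (\<Sum>f\<in>E - {e}. of_bool (f \<in> line_nb n e) * (I e + I f))"
        by (intro sum_mono) (auto simp: K'_def K_def I_def)
      thus "(\<Sum>f\<in>E - {e}. (K' e f)\<^sup>2) \<le> (\<Sum>f\<in>line_nb n e. I e + I f)" by (simp only: nbE[OF e])
    qed
    also have "(\<Sum>e\<in>E. \<Sum>f\<in>line_nb n e. I e + I f) = 2 * (real (card M) * real ?\<Delta>)"
    proof -
      have "(\<Sum>e\<in>E. \<Sum>f\<in>line_nb n e. I e) = (\<Sum>e\<in>E. d e)" unfolding d_def by (rule swap)
      thus ?thesis using sumd by (simp add: sum.distrib d_def)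
    qed
    finally have "measure_pmf.expectation (bernoulli_product E p) (\<lambda>x. (X1 x)\<^sup>2) \<le> 2 * (p * (1 - p))\<^sup>2 * (2 * (real (card M) * real ?\<Delta>))"
      by (simp add: mult_left_mono)
    also have "\<dots> \<le> 2 * p\<^sup>2 * (real n * (2 * real n))"
    proof -
      have A: "2 * (real (card M) * real ?\<Delta>) \<le> real n * (2 * real n)"
        using mult_mono[OF cardM \<Delta>n] by (simp only: mult.assoc of_nat_0_le_iff)
      have B: "2 * (p * (1 - p))\<^sup>2 \<le> 2 * p\<^sup>2"
        by (rule mult_left_mono[OF power_mono[OF P.v_le P.v_nonneg]]) simp
      show ?thesis by (rule mult_mono[OF B A]) simp_all
    qed
    also have "\<dots> \<le> (4 * p * real n)\<^sup>2" using p by (simp add: power2_eq_square)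
    finally show ?thesis .
  qed
  have E2: "measure_pmf.expectation (bernoulli_product E p) (\<lambda>x. (X2 x)\<^sup>2) \<le> (real n * (2 * sqrt p * (2 + 2 * real n * \<pi>)))\<^sup>2"
  proof -
    have Nn: "real (card E) \<le> (real n)\<^sup>2"
      unfolding E_def card_complete_edges
      by (cases n; simp add: choose_two real_of_nat_div power2_eq_square algebra_simps)
    have Hb: "(2 * (1 - I e) * H e)\<^sup>2 \<le> (2 * (2 + 2 * real n * \<pi>))\<^sup>2" if e: "e \<in> E" for e
    proof -
      have "0 \<le> \<pi> * real ?\<Delta>" using \<pi> by simp
      moreover have "\<pi> * real ?\<Delta> \<le> \<pi> * (2 * real n)" using \<pi>(1) by (intro mult_left_mono \<Delta>n)
      moreover have "2 * real n * \<pi> = \<pi> * (2 * real n)" by simp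
      ultimately have dd: "\<bar>d e - \<pi> * real ?\<Delta>\<bar> \<le> 2 + 2 * real n * \<pi>"
        using d2[OF e] by (intro abs_leI) linarith+
      have "\<bar>H e\<bar> = \<bar>1 - p\<bar> * \<bar>d e - \<pi> * real ?\<Delta>\<bar>" unfolding HI[OF e] by (rule abs_mult)
      also have "\<dots> \<le> 1 * (2 + 2 * real n * \<pi>)" using p by (intro mult_mono dd) auto
      finally have "2 * \<bar>H e\<bar> \<le> 2 * (2 + 2 * real n * \<pi>)" by simp
      moreover have "\<bar>2 * (1 - I e) * H e\<bar> \<le> 2 * \<bar>H e\<bar>" by (cases "e \<in> M") (simp_all add: I_def abs_mult)
      ultimately have "\<bar>2 * (1 - I e) * H e\<bar> \<le> 2 * (2 + 2 * real n * \<pi>)" by linarith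
      from power_mono[OF this abs_ge_zero, of 2] show ?thesis by (simp only: power2_abs)
    qed
    have "measure_pmf.expectation (bernoulli_product E p) (\<lambda>x. (X2 x)\<^sup>2) = p * (1 - p) * (\<Sum>e\<in>E. (2 * (1 - I e) * H e)\<^sup>2)"
      unfolding X2_def by (rule expectation_centred_linear_sq[OF finE p order.refl])
    also have "\<dots> \<le> p * (real (card E) * (2 * (2 + 2 * real n * \<pi>))\<^sup>2)"
      using sum_bounded_above[of E "\<lambda>e. (2 * (1 - I e) * H e)\<^sup>2", OF Hb] p(1)
      by (intro mult_mono P.v_le sum_nonneg) simp_all
    also have "\<dots> \<le> p * ((real n)\<^sup>2 * (2 * (2 + 2 * real n * \<pi>))\<^sup>2)"
      using p Nn by (intro mult_left_mono mult_right_mono) auto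
    also have "\<dots> = (real n * (2 * sqrt p * (2 + 2 * real n * \<pi>)))\<^sup>2"
      by (simp only: power_mult_distrib real_sqrt_pow2[OF p(1)] mult_ac)
    finally show ?thesis .
  qed
  note fin = finite_set_bernoulli_product[OF finE, of p]
  have "measure_pmf.expectation (bernoulli_product E p) (\<lambda>x. \<bar>X2 x - X1 x\<bar>) \<le>
     measure_pmf.expectation (bernoulli_product E p) (\<lambda>x. \<bar>X1 x\<bar> + \<bar>X2 x\<bar>)"
    using finE by (intro integral_mono) auto
  also have "\<dots> = measure_pmf.expectation (bernoulli_product E p) (\<lambda>x. \<bar>X1 x\<bar>) + measure_pmf.expectation (bernoulli_product E p) (\<lambda>x. \<bar>X2 x\<bar>)"
    using finE by simp
  also have "\<dots> \<le> sqrt ((4 * p * real n)\<^sup>2) + sqrt ((real n * (2 * sqrt p * (2 + 2 * real n * \<pi>)))\<^sup>2)"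
    by (intro add_mono order.trans[OF integral_abs_le_sqrt_second_moment[OF fin] real_sqrt_le_mono] E1 E2)
  also have "sqrt ((4 * p * real n)\<^sup>2) = 4 * p * real n"
    using p by (intro real_sqrt_unique refl) simp
  also have "sqrt ((real n * (2 * sqrt p * (2 + 2 * real n * \<pi>)))\<^sup>2) = real n * (2 * sqrt p * (2 + 2 * real n * \<pi>))"
    using p \<pi> by (intro real_sqrt_unique refl) simp
  also have "4 * p * real n + real n * (2 * sqrt p * (2 + 2 * real n * \<pi>)) = real n * (4 * p + 2 * sqrt p * (2 + 2 * real n * \<pi>))"
    unfolding distrib_left[of "real n"] by simp
  finally show ?thesis unfolding split .
qed

section \<open>Gaussian limits and likelihood ratios\<close>

lemma std_normal_affine:
  assumes "\<alpha> \<noteq> 0"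
  shows "distr std_normal_distribution borel (\<lambda>x. \<beta> + \<alpha> * x) = density lborel (\<lambda>x. ennreal (normal_density \<beta> \<bar>\<alpha>\<bar> x))"
proof -
  interpret prob_space std_normal_distribution by (rule prob_space_normal_density) simp
  have "distributed std_normal_distribution lborel (\<lambda>x. x) (\<lambda>x. ennreal (std_normal_density x))"
    unfolding distributed_def by (auto intro!: distr_id2[symmetric, THEN sym] simp: distr_id2)
  from normal_density_affine[OF this, of \<alpha> \<beta>] assms
  have "distributed std_normal_distribution lborel (\<lambda>x. \<beta> + \<alpha> * x) (\<lambda>x. ennreal (normal_density \<beta> \<bar>\<alpha>\<bar> x))" by simp
  then have "distr std_normal_distribution lborel (\<lambda>x. \<beta> + \<alpha> * x) = density lborel (\<lambda>x. ennreal (normal_density \<beta> \<bar>\<alpha>\<bar> x))"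
    by (simp add: distributed_def)
  moreover have "distr std_normal_distribution lborel (\<lambda>x. \<beta> + \<alpha> * x) = distr std_normal_distribution borel (\<lambda>x. \<beta> + \<alpha> * x)"
    by (intro distr_cong) auto
  ultimately show ?thesis by simp
qed

lemma gaussian_eq_distr:
  "v > 0 \<Longrightarrow> gaussian a v = distr std_normal_distribution borel (\<lambda>x. a + sqrt v * x)"
  unfolding gaussian_def using std_normal_affine[of "sqrt v" a] by simp

lemma real_distribution_gaussian: "v > 0 \<Longrightarrow> real_distribution (gaussian a v)"
  unfolding gaussian_def real_distribution_def real_distribution_axioms_def
  by (auto intro!: prob_space_normal_density)

lemma char_gaussian:
  assumes "v > 0"
  shows "char (gaussian a v) t = iexp (t * a) * of_real (exp (- v * t\<^sup>2 / 2))"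
proof -
  have "char (gaussian a v) t = (CLINT x|std_normal_distribution. iexp (t * a) * iexp ((t * sqrt v) * x))"
    unfolding gaussian_eq_distr[OF assms] char_def
    by (subst integral_distr) (auto simp: exp_add[symmetric] algebra_simps)
  also have "\<dots> = iexp (t * a) * char std_normal_distribution (t * sqrt v)"
    unfolding char_def by simp
  also have "char std_normal_distribution (t * sqrt v) = of_real (exp (- v * t\<^sup>2 / 2))"
    using assms by (simp add: char_std_normal_distribution power_mult_distrib mult.commute)
  finally show ?thesis .
qed

text \<open>Completing the square: multiplying the density by \<open>exp\<close> shifts the mean by
  \<open>v\<close>.\<close>

lemma gaussian_exp_moment:
  assumes "v > 0"
  shows "integrable (gaussian a v) exp" and "integral\<^sup>L (gaussian a v) exp = exp (a + v / 2)"
proof -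
  have eq: "normal_density a (sqrt v) x * exp x = exp (a + v / 2) * normal_density (a + v) (sqrt v) x" for x
  proof -
    have "- (x - a)\<^sup>2 / (2 * v) + x = (a + v / 2) - (x - (a + v))\<^sup>2 / (2 * v)"
      using assms by (simp add: field_simps power2_eq_square)
    then have "exp (- (x - a)\<^sup>2 / (2 * v)) * exp x = exp (a + v / 2) * exp (- (x - (a + v))\<^sup>2 / (2 * v))"
      unfolding exp_add[symmetric] by simp
    thus ?thesis using assms by (simp add: normal_density_def)
  qed
  show "integrable (gaussian a v) exp"
    using assms unfolding gaussian_def
    by (subst integrable_real_density) (auto simp: normal_density_nonneg eq intro!: integrable_normal_density)
  show "integral\<^sup>L (gaussian a v) exp = exp (a + v / 2)"
    using assms unfolding gaussian_def
    by (subst integral_real_density) (auto simp: normal_density_nonneg eq integral_normal_density)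
qed

lemma cdf_gaussian:
  assumes "v > 0"
  shows "cdf (gaussian a v) x = std_normal_cdf ((x - a) / sqrt v)"
proof -
  have "(\<lambda>y. a + sqrt v * y) -` {..x} = {..(x - a) / sqrt v}"
    using assms by (auto simp: field_simps)
  thus ?thesis
    unfolding std_normal_cdf_def cdf_def gaussian_eq_distr[OF assms]
    by (subst measure_distr) auto
qed

lemma gaussian_singleton:
  assumes "v > 0"
  shows "measure (gaussian a v) {x} = 0"
proof -
  have "emeasure (gaussian a v) {x} = 0"
    unfolding gaussian_def by (subst emeasure_density) (auto simp: nn_integral_cong_AE intro!: nn_integral_0_iff_AE[THEN iffD2] AE_I'[of "{x}"])
  thus ?thesis by (simp add: measure_def)
qed

lemma std_normal_cdf_minus: "std_normal_cdf (- x) = 1 - std_normal_cdf x"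
proof -
  interpret S: real_distribution std_normal_distribution by (rule real_dist_normal_dist)
  have g01: "std_normal_distribution = gaussian 0 1" by (simp add: gaussian_def)
  have "std_normal_distribution = distr std_normal_distribution borel (\<lambda>x. 0 + (- 1) * x)"
    by (subst std_normal_affine) auto
  then have "std_normal_cdf (- x) = measure (distr std_normal_distribution borel (\<lambda>x. 0 + (- 1) * x)) {..- x}"
    unfolding std_normal_cdf_def cdf_def by simp
  also have "\<dots> = measure std_normal_distribution {x..}"
    by (subst measure_distr) (auto intro!: arg_cong[where f = "measure _"])
  also have "\<dots> = measure std_normal_distribution (UNIV - {..<x})"
    by (intro arg_cong[where f = "measure _"]) auto
  also have "\<dots> = 1 - measure std_normal_distribution {..<x}"
    using S.prob_compl[of "{..<x}"] by simp
  also have "measure std_normal_distribution {..<x} = measure std_normal_distribution {..x}"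
  proof -
    have "{..x} = {..<x} \<union> {x}" by auto
    then have "measure std_normal_distribution {..x} = measure std_normal_distribution {..<x} + measure std_normal_distribution {x}"
      by (simp only:) (rule S.finite_measure_Union, auto)
    moreover have "measure std_normal_distribution {x} = 0" unfolding g01 by (rule gaussian_singleton) simp
    ultimately show ?thesis by simp
  qed
  finally show ?thesis by (simp add: std_normal_cdf_def cdf_def)
qed

lemma isCont_cdf_gaussian: "v > 0 \<Longrightarrow> isCont (cdf (gaussian a v)) x"
  using real_distribution_gaussian[of v a] gaussian_singleton[of v a x]
  by (simp add: finite_borel_measure.isCont_cdf real_distribution.finite_borel_measure_M)

lemma real_distribution_distr_pmf: "real_distribution (distr (measure_pmf M) borel (f :: _ \<Rightarrow> real))"
  by (intro prob_space.real_distribution_distr measure_pmf.prob_space_axioms) simp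

text \<open>The optimal test compares the two mass functions.\<close>

lemma total_variation_pmf:
  fixes P Q :: "'a pmf"
  shows "total_variation (measure_pmf P) (measure_pmf Q) =
      measure_pmf.prob P {x. pmf Q x < pmf P x} - measure_pmf.prob Q {x. pmf Q x < pmf P x}"
    and "(INF \<psi> :: 'a \<Rightarrow> bool. measure_pmf.prob P {x. \<not> \<psi> x} + measure_pmf.prob Q {x. \<psi> x}) =
      1 - total_variation (measure_pmf P) (measure_pmf Q)"
proof -
  let ?N = "{x. pmf Q x < pmf P x}"
  let ?d = "\<lambda>B. measure_pmf.prob P B - measure_pmf.prob Q B"
  have le: "measure_pmf.prob p S \<le> measure_pmf.prob p' S" if "\<And>x. x \<in> S \<Longrightarrow> pmf p x \<le> pmf p' x" for p p' :: "'a pmf" and S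
  proof -
    have "emeasure (measure_pmf p) S \<le> emeasure (measure_pmf p') S"
      unfolding nn_integral_pmf[symmetric] using that by (intro nn_integral_mono) (auto intro: ennreal_leI)
    thus ?thesis by (simp add: measure_pmf.emeasure_eq_measure)
  qed
  have max: "?d B \<le> ?d ?N" for B
  proof -
    have u: "measure_pmf.prob p B = measure_pmf.prob p (B \<inter> ?N) + measure_pmf.prob p (B - ?N)"
      "measure_pmf.prob p ?N = measure_pmf.prob p (B \<inter> ?N) + measure_pmf.prob p (?N - B)" for p :: "'a pmf"
    proof -
      have "B = (B \<inter> ?N) \<union> (B - ?N)" "?N = (B \<inter> ?N) \<union> (?N - B)" by blast+
      then show "measure_pmf.prob p B = measure_pmf.prob p (B \<inter> ?N) + measure_pmf.prob p (B - ?N)"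
        "measure_pmf.prob p ?N = measure_pmf.prob p (B \<inter> ?N) + measure_pmf.prob p (?N - B)"
        using measure_pmf.finite_measure_Union[of "B \<inter> ?N" p "B - ?N"]
          measure_pmf.finite_measure_Union[of "B \<inter> ?N" p "?N - B"] by auto
    qed
    have "measure_pmf.prob P (B - ?N) \<le> measure_pmf.prob Q (B - ?N)" by (rule le) auto
    moreover have "measure_pmf.prob Q (?N - B) \<le> measure_pmf.prob P (?N - B)" by (rule le) auto
    ultimately show ?thesis using u[of P] u[of Q] by linarith
  qed
  have compl: "?d (- B) = - ?d B" for B
    using measure_pmf.prob_compl[of B P] measure_pmf.prob_compl[of B Q] by (simp add: Compl_eq_Diff_UNIV)
  have abs: "\<bar>?d B\<bar> \<le> ?d ?N" for B using max[of B] max[of "- B"] compl[of B] by linarith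
  have pos: "0 \<le> ?d ?N" using abs[of "{}"] by simp
  show tv: "total_variation (measure_pmf P) (measure_pmf Q) = ?d ?N"
    unfolding total_variation_def
  proof (rule cSup_eq_maximum)
    show "?d ?N \<in> (\<lambda>B. \<bar>?d B\<bar>) ` sets (measure_pmf P)" using pos by (intro image_eqI[of _ _ ?N]) auto
  qed (use abs in auto)
  have test: "measure_pmf.prob P {x. \<not> \<psi> x} + measure_pmf.prob Q {x. \<psi> x} = 1 - ?d {x. \<psi> x}" for \<psi>
    using compl[of "{x. \<psi> x}"] measure_pmf.prob_compl[of "{x. \<psi> x}" P] by (simp add: Compl_eq_Diff_UNIV Collect_neg_eq)
  show "(INF \<psi> :: 'a \<Rightarrow> bool. measure_pmf.prob P {x. \<not> \<psi> x} + measure_pmf.prob Q {x. \<psi> x}) =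
      1 - total_variation (measure_pmf P) (measure_pmf Q)"
    unfolding tv test
  proof (rule cInf_eq_minimum)
    show "1 - ?d ?N \<in> range (\<lambda>\<psi>. 1 - ?d {x. \<psi> x})" by (rule image_eqI[of _ _ "\<lambda>x. pmf Q x < pmf P x"]) auto
  next
    fix y assume "y \<in> range (\<lambda>\<psi>. 1 - ?d {x. \<psi> x})"
    then obtain \<psi> where "y = 1 - ?d {x. \<psi> x}" by blast
    with max[of "{x. \<psi> x}"] show "1 - ?d ?N \<le> y" by linarith
  qed
qed

text \<open>\<open>RN_deriv\<close> is determined only almost everywhere, which for a discrete law
  means at every point of the support; hence the restriction to \<open>set_pmf Q\<close>.\<close>

lemma log_likelihood_ratio_pmf:
  fixes P Q :: "'a pmf"
  assumes sub: "set_pmf P \<subseteq> set_pmf Q" and x: "x \<in> set_pmf Q"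
  shows "log_likelihood_ratio (measure_pmf P) (measure_pmf Q) x = ln (pmf P x / pmf Q x)"
proof -
  have "density (measure_pmf Q) (\<lambda>x. ennreal (pmf P x / pmf Q x)) = measure_pmf P"
  proof (rule measure_eqI)
    fix A assume "A \<in> sets (density (measure_pmf Q) (\<lambda>x. ennreal (pmf P x / pmf Q x)))"
    have "emeasure (density (measure_pmf Q) (\<lambda>x. ennreal (pmf P x / pmf Q x))) A =
       (\<integral>\<^sup>+x. ennreal (pmf Q x) * (ennreal (pmf P x / pmf Q x) * indicator A x) \<partial>count_space UNIV)"
      by (simp add: emeasure_density nn_integral_measure_pmf)
    also have "\<dots> = (\<integral>\<^sup>+x. ennreal (pmf P x) * indicator A x \<partial>count_space UNIV)"
    proof (intro nn_integral_cong)
      fix x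
      have "pmf Q x = 0 \<Longrightarrow> pmf P x = 0" using sub by (auto simp: set_pmf_eq)
      then have "pmf Q x * (pmf P x / pmf Q x) = pmf P x" by (cases "pmf Q x = 0") auto
      then show "ennreal (pmf Q x) * (ennreal (pmf P x / pmf Q x) * indicator A x) = ennreal (pmf P x) * indicator A x"
        by (simp add: mult.assoc[symmetric] ennreal_mult[symmetric])
    qed
    also have "\<dots> = emeasure (measure_pmf P) A"
      by (simp add: nn_integral_measure_pmf[symmetric] flip: nn_integral_indicator)
    finally show "emeasure (density (measure_pmf Q) (\<lambda>x. ennreal (pmf P x / pmf Q x))) A = emeasure (measure_pmf P) A" .
  qed simp
  then have "AE x in measure_pmf Q. ennreal (pmf P x / pmf Q x) = RN_deriv (measure_pmf Q) (measure_pmf P) x"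
    by (intro measure_pmf.RN_deriv_unique) auto
  then have "ennreal (pmf P x / pmf Q x) = RN_deriv (measure_pmf Q) (measure_pmf P) x"
    using x by (simp add: AE_measure_pmf_iff)
  then have "RN_deriv (measure_pmf Q) (measure_pmf P) x = ennreal (pmf P x / pmf Q x)" by (rule sym)
  thus ?thesis by (simp add: log_likelihood_ratio_def)
qed

text \<open>Second-moment comparison: with \<open>f w = exp (w - v / 2)\<close> the bounds below make
  \<open>E (L - min (f W) K)^2\<close> small, because \<open>E (L * min (f W) K)\<close> is a \<open>P\<close>-expectation.\<close>

lemma likelihood_ratio_lognormal:
  fixes P Q :: "nat \<Rightarrow> 'a pmf" and W L LR :: "nat \<Rightarrow> 'a \<Rightarrow> real" and v :: real
  assumes v: "v > 0"
    and finQ: "\<And>n. n \<ge> 1 \<Longrightarrow> finite (set_pmf (Q n))"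
    and PQ: "\<And>n g. n \<ge> 1 \<Longrightarrow> measure_pmf.expectation (P n) g = measure_pmf.expectation (Q n) (\<lambda>x. L n x * g x)"
    and LR: "\<And>n x. n \<ge> 1 \<Longrightarrow> 0 \<le> LR n x" "\<And>n x. n \<ge> 1 \<Longrightarrow> LR n x \<le> L n x"
    and rest: "(\<lambda>n. measure_pmf.expectation (Q n) (\<lambda>x. L n x - LR n x)) \<longlonglongrightarrow> 0"
    and second: "\<And>\<epsilon>. \<epsilon> > 0 \<Longrightarrow> eventually (\<lambda>n. measure_pmf.expectation (Q n) (\<lambda>x. (LR n x)\<^sup>2) \<le> exp v + \<epsilon>) sequentially"
    and WQ: "weak_conv_m (\<lambda>n. distr (measure_pmf (Q n)) borel (W n)) (gaussian 0 v)"
    and WP: "weak_conv_m (\<lambda>n. distr (measure_pmf (P n)) borel (W n)) (gaussian v v)"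
    and \<delta>: "0 < \<delta>" "\<delta> \<le> 1"
  shows "(\<lambda>n. measure_pmf.prob (Q n) {x. \<not> \<bar>ln (L n x) - (W n x - v / 2)\<bar> \<le> \<delta>}) \<longlonglongrightarrow> 0"
    and "(\<lambda>n. measure_pmf.prob (P n) {x. \<not> \<bar>ln (L n x) - (W n x - v / 2)\<bar> \<le> \<delta>}) \<longlonglongrightarrow> 0"
proof -
  let ?EQ = "\<lambda>n. measure_pmf.expectation (Q n)"
  define f where "f w = exp (w - v / 2)" for w :: real
  \<comment> \<open>Truncated at \<open>K\<close> because weak convergence gives limits of means
    only for bounded continuous functions.\<close>
  define fK where "fK K w = min (f w) K" for K w :: real
  have fpos: "0 < f w" for w by (simp add: f_def)
  have contfK: "isCont (fK K) x" for K x unfolding fK_def[abs_def] f_def by (intro continuous_intros)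
  note int = integrable_measure_pmf_finite[OF finQ]
  note rd = real_distribution_distr_pmf
  interpret G0: real_distribution "gaussian 0 v" by (rule real_distribution_gaussian[OF v])
  interpret Gv: real_distribution "gaussian v v" by (rule real_distribution_gaussian[OF v])
  have limQ: "(\<lambda>n. ?EQ n (\<lambda>x. (fK K (W n x))\<^sup>2)) \<longlonglongrightarrow> (\<integral>w. (fK K w)\<^sup>2 \<partial>gaussian 0 v)" if "K > 0" for K
  proof -
    have "(\<lambda>n. (\<integral>w. (fK K w)\<^sup>2 \<partial>distr (measure_pmf (Q n)) borel (W n))) \<longlonglongrightarrow> (\<integral>w. (fK K w)\<^sup>2 \<partial>gaussian 0 v)"
    proof (rule weak_conv_imp_integral_bdd_continuous_conv[OF rd _ WQ, where B = "K\<^sup>2"])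
      show "isCont (\<lambda>w. (fK K w)\<^sup>2) x" for x by (intro continuous_intros contfK)
      show "norm ((fK K x)\<^sup>2) \<le> K\<^sup>2" for x
        using fpos[of x] that by (auto simp: fK_def min_def intro!: power_mono)
    qed (rule G0.real_distribution_axioms)
    moreover have "(\<lambda>w. (fK K w)\<^sup>2) \<in> borel_measurable borel" unfolding fK_def f_def by measurable
    ultimately show ?thesis by (simp add: integral_distr)
  qed
  have limP: "(\<lambda>n. measure_pmf.expectation (P n) (\<lambda>x. fK K (W n x))) \<longlonglongrightarrow> (\<integral>w. fK K w \<partial>gaussian v v)" if "K > 0" for K
  proof -
    have "(\<lambda>n. (\<integral>w. fK K w \<partial>distr (measure_pmf (P n)) borel (W n))) \<longlonglongrightarrow> (\<integral>w. fK K w \<partial>gaussian v v)"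
    proof (rule weak_conv_imp_integral_bdd_continuous_conv[OF rd _ WP contfK, where B = K])
      show "norm (fK K x) \<le> K" for x
        using fpos[of x] that by (auto simp: fK_def min_def)
    qed (rule Gv.real_distribution_axioms)
    moreover have "fK K \<in> borel_measurable borel" unfolding fK_def[abs_def] f_def by measurable
    ultimately show ?thesis by (simp add: integral_distr)
  qed
  have fexp: "f w = exp (- v / 2) * exp w" for w unfolding f_def exp_add[symmetric] by simp
  have f_int: "integrable (gaussian v v) f" "(\<integral>w. f w \<partial>gaussian v v) = exp v"
  proof -
    show "integrable (gaussian v v) f" unfolding fexp[abs_def] using gaussian_exp_moment(1)[OF v] by simp
    have "exp (- v / 2) * exp (v + v / 2) = exp v" unfolding exp_add[symmetric] by simp
    then show "(\<integral>w. f w \<partial>gaussian v v) = exp v"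
      unfolding fexp[abs_def] using gaussian_exp_moment(2)[OF v, of v] by simp
  qed
  have Ak: "(\<lambda>k. \<integral>w. fK (real k) w \<partial>gaussian v v) \<longlonglongrightarrow> exp v"
    unfolding f_int(2)[symmetric]
  proof (rule integral_dominated_convergence[where w = f])
    show "AE w in gaussian v v. (\<lambda>k. fK (real k) w) \<longlonglongrightarrow> f w"
    proof (rule AE_I2)
      fix w
      obtain k0 where "f w \<le> real k0" using real_arch_simple by blast
      then have "eventually (\<lambda>k. fK (real k) w = f w) sequentially"
        by (intro eventually_sequentiallyI[of k0]) (simp add: fK_def min_def)
      thus "(\<lambda>k. fK (real k) w) \<longlonglongrightarrow> f w" by (rule tendsto_eventually)
    qed
    show "AE w in gaussian v v. norm (fK (real k) w) \<le> f w" for k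
      using fpos by (intro AE_I2) (auto simp: fK_def min_def less_imp_le)
    show "f \<in> borel_measurable (gaussian v v)" using f_int by auto
    show "fK (real k) \<in> borel_measurable (gaussian v v)" for k
      unfolding fK_def[abs_def] using f_int by (auto intro!: borel_measurable_min)
  qed (rule f_int)
  \<comment> \<open>The mean of \<open>f^2\<close> under \<open>gaussian 0 v\<close> is
    \<open>exp (- v) * exp (2 * v)\<close>, the same value as the mean of \<open>f\<close> under
    \<open>gaussian v v\<close>. Doubling the variable multiplies its variance by 4.\<close>
  have Bk: "(\<integral>w. (fK K w)\<^sup>2 \<partial>gaussian 0 v) \<le> exp v" if "K > 0" for K
  proof -
    have sq: "(f w)\<^sup>2 = exp (- v) * exp (2 * w)" for w
      by (simp add: f_def power2_eq_square exp_add[symmetric])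
    have g2: "distr (gaussian 0 v) borel (\<lambda>w. 2 * w) = gaussian 0 (4 * v)"
    proof -
      have "distr (gaussian 0 v) borel (\<lambda>w. 2 * w) = distr std_normal_distribution borel ((\<lambda>w. 2 * w) \<circ> (\<lambda>x. 0 + sqrt v * x))"
        unfolding gaussian_eq_distr[OF v] by (subst distr_distr) auto
      also have "\<dots> = gaussian 0 (4 * v)"
      proof -
        have "(\<lambda>w. 2 * w) \<circ> (\<lambda>x. 0 + sqrt v * x) = (\<lambda>x. 0 + sqrt (4 * v) * x)"
          by (auto simp: fun_eq_iff real_sqrt_mult)
        thus ?thesis using gaussian_eq_distr[of "4 * v" 0] v by simp
      qed
      finally show ?thesis .
    qed
    have i2: "integrable (gaussian 0 v) (\<lambda>w. exp (2 * w))" "(\<integral>w. exp (2 * w) \<partial>gaussian 0 v) = exp (2 * v)"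
    proof -
      have m: "(\<lambda>w. 2 * w) \<in> measurable (gaussian 0 v) (borel :: real measure)" by simp
      show "integrable (gaussian 0 v) (\<lambda>w. exp (2 * w))"
        using integrable_distr[OF m, of exp] gaussian_exp_moment(1)[of "4 * v" 0] v unfolding g2 by simp
      have "(\<integral>w. exp (2 * w) \<partial>gaussian 0 v) = integral\<^sup>L (distr (gaussian 0 v) borel (\<lambda>w. 2 * w)) exp"
        by (subst integral_distr[OF m]) auto
      also have "\<dots> = exp (2 * v)" unfolding g2 using gaussian_exp_moment(2)[of "4 * v" 0] v by simp
      finally show "(\<integral>w. exp (2 * w) \<partial>gaussian 0 v) = exp (2 * v)" .
    qed
    have fi: "integrable (gaussian 0 v) (\<lambda>w. (f w)\<^sup>2)" unfolding sq using i2(1) by simp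
    have le: "(fK K w)\<^sup>2 \<le> (f w)\<^sup>2" for w
      using fpos[of w] that by (intro power_mono) (auto simp: fK_def)
    have "(\<integral>w. (fK K w)\<^sup>2 \<partial>gaussian 0 v) \<le> (\<integral>w. (f w)\<^sup>2 \<partial>gaussian 0 v)"
    proof (rule integral_mono[OF _ fi le])
      show "integrable (gaussian 0 v) (\<lambda>w. (fK K w)\<^sup>2)"
      proof (rule Bochner_Integration.integrable_bound[OF fi])
        show "(\<lambda>w. (fK K w)\<^sup>2) \<in> borel_measurable (gaussian 0 v)"
          unfolding fK_def f_def by simp
      qed (use le in auto)
    qed
    also have "\<dots> = exp (- v) * exp (2 * v)" unfolding sq using i2(2) by simp
    also have "\<dots> = exp v" by (simp add: exp_add[symmetric])
    finally show ?thesis .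
  qed
  \<comment> \<open>Expand the square: the two second moments are at most about \<open>exp v\<close>
    and the mixed term is at least about \<open>exp v\<close>, so the bound is about
    \<open>exp v - 2 * exp v + exp v = 0\<close>. The truncation level is chosen first, then
    \<open>n\<close>.\<close>
  have approx: "eventually (\<lambda>k. eventually (\<lambda>n. ?EQ n (\<lambda>x. (LR n x - fK (real k) (W n x))\<^sup>2) \<le> \<epsilon>) sequentially) sequentially"
    if eps: "\<epsilon> > 0" for \<epsilon>
  proof -
    have "eventually (\<lambda>k. (\<integral>w. fK (real k) w \<partial>gaussian v v) > exp v - \<epsilon> / 8) sequentially"
      using order_tendstoD(1)[OF Ak] eps by simp
    with eventually_gt_at_top[of 0] show ?thesis
    proof eventually_elim
      case (elim k)
      define K where "K = real k"
      have K: "K > 0" using elim by (simp add: K_def)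
      have 1: "eventually (\<lambda>n. ?EQ n (\<lambda>x. (LR n x)\<^sup>2) \<le> exp v + \<epsilon> / 8) sequentially" using second eps by simp
      have 2: "eventually (\<lambda>n. measure_pmf.expectation (P n) (\<lambda>x. fK K (W n x)) > exp v - \<epsilon> / 8) sequentially"
        using order_tendstoD(1)[OF limP[OF K], of "exp v - \<epsilon> / 8"] elim by (simp add: K_def)
      have 3: "eventually (\<lambda>n. ?EQ n (\<lambda>x. (fK K (W n x))\<^sup>2) < exp v + \<epsilon> / 8) sequentially"
        using order_tendstoD(2)[OF limQ[OF K], of "exp v + \<epsilon> / 8"] Bk[OF K] eps by simp
      have 4: "eventually (\<lambda>n. ?EQ n (\<lambda>x. L n x - LR n x) < \<epsilon> / (8 * K)) sequentially"
        using order_tendstoD(2)[OF rest, of "\<epsilon> / (8 * K)"] eps K by simp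
      show ?case using 1 2 3 4 eventually_ge_at_top[of 1]
      proof eventually_elim
        case (elim n)
        then have n: "n \<ge> 1" by simp
        note [simp] = int[OF n]
        \<comment> \<open>The mixed term is a \<open>P\<close>-mean except that \<open>LR\<close>
          stands in place of \<open>L\<close>; as \<open>fK\<close> is at most \<open>K\<close>, the
          replacement costs at most \<open>K\<close> times the discarded mass.\<close>
        have "measure_pmf.expectation (P n) (\<lambda>x. fK K (W n x)) = ?EQ n (\<lambda>x. LR n x * fK K (W n x)) + ?EQ n (\<lambda>x. (L n x - LR n x) * fK K (W n x))"
          unfolding PQ[OF n] by (subst Bochner_Integration.integral_add[symmetric]) (simp_all add: algebra_simps)
        also have "?EQ n (\<lambda>x. (L n x - LR n x) * fK K (W n x)) \<le> ?EQ n (\<lambda>x. (L n x - LR n x) * K)"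
          using LR[OF n] by (intro integral_mono mult_left_mono) (auto simp: fK_def)
        also have "\<dots> = ?EQ n (\<lambda>x. L n x - LR n x) * K" by (simp only: integral_mult_left_zero)
        also have "\<dots> \<le> \<epsilon> / (8 * K) * K" using elim K by (intro mult_right_mono) auto
        also have "\<dots> = \<epsilon> / 8" using K by simp
        finally have c: "exp v - \<epsilon> / 4 \<le> ?EQ n (\<lambda>x. LR n x * fK K (W n x))" using elim by simp
        have "?EQ n (\<lambda>x. (LR n x - fK K (W n x))\<^sup>2) = ?EQ n (\<lambda>x. (LR n x)\<^sup>2 - 2 * (LR n x * fK K (W n x)) + (fK K (W n x))\<^sup>2)"
          by (simp add: power2_diff algebra_simps)
        also have "\<dots> = ?EQ n (\<lambda>x. (LR n x)\<^sup>2) - 2 * ?EQ n (\<lambda>x. LR n x * fK K (W n x)) + ?EQ n (\<lambda>x. (fK K (W n x))\<^sup>2)"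
          by simp
        also have "\<dots> \<le> \<epsilon>" using c elim eps by simp
        finally show ?case by (simp add: K_def)
      qed
    qed
  qed
  define Bad where "Bad n = {x. \<not> \<bar>ln (L n x) - (W n x - v / 2)\<bar> \<le> \<delta>}" for n
  \<comment> \<open>Outside the three events the truncation is inactive, since
    \<open>f (W n x) <= exp b <= K\<close>, and \<open>f (W n x) >= exp (- b - v / 2)\<close> turns
    the absolute error \<open>2 * \<eta>\<close> into a relative error \<open>\<delta> / 2\<close>.
    This dictates the choice of \<open>\<eta>\<close>.\<close>
  have Bad: "Bad n \<subseteq> {x. b < \<bar>W n x\<bar>} \<union> {x. \<eta> \<le> \<bar>LR n x - fK K (W n x)\<bar>} \<union> {x. \<eta> \<le> L n x - LR n x}"
    if b: "\<eta> = exp (- b - v / 2) * \<delta> / 4" "exp b \<le> K" and n: "n \<ge> 1" for b \<eta> K n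
  proof (rule subsetI, rule ccontr)
    fix x assume x: "x \<in> Bad n" and "x \<notin> {x. b < \<bar>W n x\<bar>} \<union> {x. \<eta> \<le> \<bar>LR n x - fK K (W n x)\<bar>} \<union> {x. \<eta> \<le> L n x - LR n x}"
    then have w: "\<bar>W n x\<bar> \<le> b" and l: "\<bar>LR n x - fK K (W n x)\<bar> < \<eta>" "L n x - LR n x < \<eta>" by auto
    define F where "F = f (W n x)"
    have "F \<le> exp b" unfolding F_def f_def using w v by simp
    then have "fK K (W n x) = F" using b(2) by (simp add: fK_def F_def)
    then have LF: "\<bar>L n x - F\<bar> < 2 * \<eta>" using l LR(2)[OF n, of x] by auto
    have "exp (- b - v / 2) \<le> F" unfolding F_def f_def using w by simp
    then have \<eta>F: "2 * \<eta> \<le> \<delta> / 2 * F" unfolding b(1) using \<delta> mult_left_mono[of "exp (- b - v / 2)" F "\<delta> / 2"] by (simp add: mult.commute)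
    have F0: "0 < F" unfolding F_def by (rule fpos)
    define r where "r = L n x / F"
    have "\<bar>r - 1\<bar> \<le> \<delta> / 2"
    proof -
      have "(r - 1) * F = L n x - F" using F0 by (simp add: r_def left_diff_distrib)
      then have "\<bar>r - 1\<bar> * F = \<bar>L n x - F\<bar>" using F0 abs_mult[of "r - 1" F] by simp
      then have "\<bar>r - 1\<bar> * F \<le> \<delta> / 2 * F" using LF \<eta>F by linarith
      thus ?thesis using F0 by simp
    qed
    then have r: "1 - \<delta> / 2 \<le> r" "r \<le> 1 + \<delta> / 2" by linarith+
    then have r0: "0 < r" using \<delta> by linarith
    have "ln r \<le> r - 1" using r0 by (rule ln_le_minus_one)
    then have u: "ln r \<le> \<delta>" using r \<delta> by linarith
    have "- (\<delta> / 2) - 2 * (\<delta> / 2)\<^sup>2 \<le> ln (1 - \<delta> / 2)" using \<delta> by (intro ln_one_minus_pos_lower_bound) auto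
    also have "\<dots> \<le> ln r" using r \<delta> by simp
    finally have "- (\<delta> / 2) - 2 * (\<delta> / 2)\<^sup>2 \<le> ln r" .
    moreover have "2 * (\<delta> / 2)\<^sup>2 \<le> \<delta> / 2" using \<delta> by (simp add: power2_eq_square mult_left_le)
    ultimately have lo: "- \<delta> \<le> ln r" by linarith
    have "L n x = r * F" using F0 by (simp add: r_def)
    then have "ln (L n x) = ln r + (W n x - v / 2)" using r0 F0 by (simp add: ln_mult F_def f_def)
    then have "\<bar>ln (L n x) - (W n x - v / 2)\<bar> \<le> \<delta>" using u lo by simp
    thus False using x by (simp add: Bad_def)
  qed
  have QBad: "(\<lambda>n. measure_pmf.prob (Q n) (Bad n)) \<longlonglongrightarrow> 0"
  proof (rule order_tendstoI)
    fix \<epsilon> :: real assume eps: "0 < \<epsilon>"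
    have "((\<lambda>b. measure (gaussian 0 v) {- real b<..<real b}) \<longlongrightarrow> measure (gaussian 0 v) (\<Union>b. {- real b<..<real b})) sequentially"
      by (intro G0.finite_Lim_measure_incseq) (auto simp: incseq_def)
    moreover have "(\<Union>b. {- real b<..<real b}) = UNIV"
    proof (rule UNIV_eq_I[symmetric])
      fix x :: real
      obtain b where "\<bar>x\<bar> < real b" using reals_Archimedean2 by blast
      then show "x \<in> (\<Union>b. {- real b<..<real b})" by (intro UN_I[of b]) auto
    qed
    ultimately have "(\<lambda>b. measure (gaussian 0 v) {- real b<..<real b}) \<longlonglongrightarrow> 1" using G0.prob_space by simp
    from order_tendstoD(1)[OF this, of "1 - \<epsilon> / 4"] eps
    have "eventually (\<lambda>b. measure (gaussian 0 v) {- real b<..<real b} > 1 - \<epsilon> / 4) sequentially" by simp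
    then obtain b0 :: nat where b0: "measure (gaussian 0 v) {- real b0<..<real b0} > 1 - \<epsilon> / 4"
      unfolding eventually_sequentially by blast
    define b where "b = real b0"
    \<comment> \<open>The interval carries nearly all of the Gaussian mass and has a null boundary,
      so weak convergence keeps \<open>W\<close> inside it with high
      \<open>Q\<close>-probability.\<close>
    have "(\<lambda>n. measure (distr (measure_pmf (Q n)) borel (W n)) {-b<..<b}) \<longlonglongrightarrow> measure (gaussian 0 v) {-b<..<b}"
    proof (rule weak_conv_imp_continuity_set_conv[OF rd G0.real_distribution_axioms WQ])
      have "closure {-b<..<b} \<subseteq> {-b..b}" by (rule closure_minimal) auto
      moreover have "frontier {-b<..<b} = closure {-b<..<b} - {-b<..<b}" by (simp add: frontier_def interior_open)
      ultimately have "frontier {-b<..<b} \<subseteq> {-b} \<union> {b}" by fastforce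
      then have "measure (gaussian 0 v) (frontier {-b<..<b}) \<le> measure (gaussian 0 v) ({-b} \<union> {b})"
        by (intro G0.finite_measure_mono) auto
      also have "\<dots> \<le> measure (gaussian 0 v) {-b} + measure (gaussian 0 v) {b}"
        by (intro measure_Un_le) auto
      also have "\<dots> = 0" using gaussian_singleton[OF v] by simp
      finally show "emeasure (gaussian 0 v) (frontier {-b<..<b}) = 0" by (simp add: measure_le_0_iff G0.emeasure_eq_measure)
    qed auto
    then have "eventually (\<lambda>n. measure (distr (measure_pmf (Q n)) borel (W n)) {-b<..<b} > 1 - \<epsilon> / 4) sequentially"
      using order_tendstoD(1) b0 unfolding b_def by blast
    then have 1: "eventually (\<lambda>n. measure_pmf.prob (Q n) {x. b < \<bar>W n x\<bar>} < \<epsilon> / 4) sequentially"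
    proof eventually_elim
      case (elim n)
      have "measure (distr (measure_pmf (Q n)) borel (W n)) {-b<..<b} = measure_pmf.prob (Q n) {x. W n x \<in> {-b<..<b}}"
        by (subst measure_distr) (auto simp: vimage_def)
      moreover have "measure_pmf.prob (Q n) {x. b < \<bar>W n x\<bar>} \<le> measure_pmf.prob (Q n) (UNIV - {x. W n x \<in> {-b<..<b}})"
        by (intro measure_pmf.finite_measure_mono) auto
      moreover have "measure_pmf.prob (Q n) (UNIV - {x. W n x \<in> {-b<..<b}}) = 1 - measure_pmf.prob (Q n) {x. W n x \<in> {-b<..<b}}"
        using measure_pmf.prob_compl[of "{x. W n x \<in> {-b<..<b}}" "Q n"] by simp
      ultimately show ?case using elim by linarith
    qed
    define \<eta> where "\<eta> = exp (- b - v / 2) * \<delta> / 4"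
    have \<eta>: "\<eta> > 0" using \<delta> by (simp add: \<eta>_def)
    have "eventually (\<lambda>k. exp b \<le> real k) sequentially"
    proof -
      obtain k0 where "exp b \<le> real k0" using real_arch_simple by blast
      thus ?thesis by (intro eventually_sequentiallyI[of k0]) auto
    qed
    moreover have "0 < \<epsilon> / 4 * \<eta>\<^sup>2" using eps \<eta> by simp
    then have "eventually (\<lambda>k. eventually (\<lambda>n. ?EQ n (\<lambda>x. (LR n x - fK (real k) (W n x))\<^sup>2) \<le> \<epsilon> / 4 * \<eta>\<^sup>2) sequentially) sequentially"
      by (rule approx)
    ultimately have "eventually (\<lambda>k. exp b \<le> real k \<and>
        eventually (\<lambda>n. ?EQ n (\<lambda>x. (LR n x - fK (real k) (W n x))\<^sup>2) \<le> \<epsilon> / 4 * \<eta>\<^sup>2) sequentially) sequentially"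
      by (rule eventually_conj)
    from eventually_happens'[OF sequentially_bot this]
    obtain k where k: "exp b \<le> real k" "eventually (\<lambda>n. ?EQ n (\<lambda>x. (LR n x - fK (real k) (W n x))\<^sup>2) \<le> \<epsilon> / 4 * \<eta>\<^sup>2) sequentially"
      by (elim exE conjE)
    have 2: "eventually (\<lambda>n. ?EQ n (\<lambda>x. L n x - LR n x) < \<epsilon> / 4 * \<eta>) sequentially"
      by (rule order_tendstoD(2)[OF rest]) (use eps \<eta> in simp)
    show "eventually (\<lambda>n. measure_pmf.prob (Q n) (Bad n) < \<epsilon>) sequentially"
      using 1 k(2) 2 eventually_ge_at_top[of 1]
    proof eventually_elim
      case (elim n)
      then have n: "n \<ge> 1" by simp
      note [simp] = int[OF n]
      have m1: "measure_pmf.prob (Q n) {x. \<eta> \<le> \<bar>LR n x - fK (real k) (W n x)\<bar>} \<le> \<epsilon> / 4"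
      proof -
        have "\<eta>\<^sup>2 * measure_pmf.prob (Q n) {x. \<eta> \<le> \<bar>LR n x - fK (real k) (W n x)\<bar>} =
            ?EQ n (\<lambda>x. \<eta>\<^sup>2 * indicator {x. \<eta> \<le> \<bar>LR n x - fK (real k) (W n x)\<bar>} x)" by simp
        also have "\<dots> \<le> ?EQ n (\<lambda>x. (LR n x - fK (real k) (W n x))\<^sup>2)"
          using \<eta> by (intro integral_mono) (auto simp: indicator_def abs_le_square_iff[symmetric])
        also have "\<dots> \<le> \<epsilon> / 4 * \<eta>\<^sup>2" using elim by simp
        finally show ?thesis using \<eta> by (simp add: mult.commute)
      qed
      have m2: "measure_pmf.prob (Q n) {x. \<eta> \<le> L n x - LR n x} < \<epsilon> / 4"
      proof -
        have "\<eta> * measure_pmf.prob (Q n) {x. \<eta> \<le> L n x - LR n x} = ?EQ n (\<lambda>x. \<eta> * indicator {x. \<eta> \<le> L n x - LR n x} x)" by simp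
        also have "\<dots> \<le> ?EQ n (\<lambda>x. L n x - LR n x)"
          using LR[OF n] by (intro integral_mono) (auto simp: indicator_def)
        also have "\<dots> < \<epsilon> / 4 * \<eta>" using elim by simp
        finally show ?thesis using \<eta> by (simp add: mult.commute)
      qed
      have "measure_pmf.prob (Q n) (Bad n) \<le> measure_pmf.prob (Q n) ({x. b < \<bar>W n x\<bar>} \<union> {x. \<eta> \<le> \<bar>LR n x - fK (real k) (W n x)\<bar>} \<union> {x. \<eta> \<le> L n x - LR n x})"
        using Bad[OF \<eta>_def k(1) n] by (intro measure_pmf.finite_measure_mono) auto
      also have "\<dots> \<le> measure_pmf.prob (Q n) {x. b < \<bar>W n x\<bar>} + measure_pmf.prob (Q n) {x. \<eta> \<le> \<bar>LR n x - fK (real k) (W n x)\<bar>}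
          + measure_pmf.prob (Q n) {x. \<eta> \<le> L n x - LR n x}"
        by (rule order.trans[OF measure_Un_le add_right_mono[OF measure_Un_le]]) auto
      also have "\<dots> < \<epsilon>" using m1 m2 elim eps by linarith
      finally show ?case .
    qed
  qed (auto intro: always_eventually less_le_trans[OF _ measure_nonneg])
  then show "(\<lambda>n. measure_pmf.prob (Q n) {x. \<not> \<bar>ln (L n x) - (W n x - v / 2)\<bar> \<le> \<delta>}) \<longlonglongrightarrow> 0" by (simp add: Bad_def)
  have "(\<lambda>n. measure_pmf.prob (P n) (Bad n)) \<longlonglongrightarrow> 0"
  proof (rule order_tendstoI)
    fix \<epsilon> :: real assume eps: "0 < \<epsilon>"
    \<comment> \<open>Transfer from \<open>Q\<close> to \<open>P\<close> by uniform integrability: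
      on the bad event \<open>L\<close> is at most \<open>(L - LR) + T + LR^2 / T\<close>, and this
      \<open>T\<close> makes the bound \<open>(exp v + 1) / T\<close> for the last mean equal to
      \<open>\<epsilon> / 3\<close>.\<close>
    define T where "T = 3 * (exp v + 1) / \<epsilon>"
    have T: "T > 0" using eps by (simp add: T_def add_pos_pos)
    have 1: "eventually (\<lambda>n. ?EQ n (\<lambda>x. (LR n x)\<^sup>2) \<le> exp v + 1) sequentially" using second by simp
    have 2: "eventually (\<lambda>n. ?EQ n (\<lambda>x. L n x - LR n x) < \<epsilon> / 3) sequentially"
      by (rule order_tendstoD(2)[OF rest]) (use eps in simp)
    have 3: "eventually (\<lambda>n. measure_pmf.prob (Q n) (Bad n) < \<epsilon> / (3 * T)) sequentially"
      using order_tendstoD(2)[OF QBad, of "\<epsilon> / (3 * T)"] eps T by simp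
    show "eventually (\<lambda>n. measure_pmf.prob (P n) (Bad n) < \<epsilon>) sequentially"
      using 1 2 3 eventually_ge_at_top[of 1]
    proof eventually_elim
      case (elim n)
      then have n: "n \<ge> 1" by simp
      note [simp] = int[OF n]
      have "measure_pmf.prob (P n) (Bad n) = measure_pmf.expectation (P n) (indicator (Bad n))" by simp
      also have "\<dots> = ?EQ n (\<lambda>x. L n x * indicator (Bad n) x)" by (rule PQ[OF n])
      also have "\<dots> \<le> ?EQ n (\<lambda>x. (L n x - LR n x) + (T * indicator (Bad n) x + (LR n x)\<^sup>2 / T))"
      proof (intro integral_mono)
        fix x
        have "LR n x \<le> T + (LR n x)\<^sup>2 / T"
        proof (cases "LR n x \<le> T")
          case True
          thus ?thesis using T by (simp add: add_increasing2)
        next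
          case False
          then have "LR n x * T \<le> LR n x * LR n x" using T by (intro mult_left_mono) auto
          then have "LR n x \<le> (LR n x)\<^sup>2 / T" using T by (simp add: field_simps power2_eq_square)
          thus ?thesis using T by linarith
        qed
        moreover have "0 \<le> L n x - LR n x" "0 \<le> (LR n x)\<^sup>2 / T" using LR(2)[OF n, of x] T by auto
        ultimately show "L n x * indicator (Bad n) x \<le> (L n x - LR n x) + (T * indicator (Bad n) x + (LR n x)\<^sup>2 / T)"
          by (cases "x \<in> Bad n") auto
      qed simp_all
      also have "\<dots> = ?EQ n (\<lambda>x. L n x - LR n x) + (T * measure_pmf.prob (Q n) (Bad n) + ?EQ n (\<lambda>x. (LR n x)\<^sup>2) / T)"
        by simp
      also have "\<dots> < \<epsilon> / 3 + (\<epsilon> / 3 + \<epsilon> / 3)"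
      proof -
        have "T * measure_pmf.prob (Q n) (Bad n) < T * (\<epsilon> / (3 * T))" using elim T by (intro mult_strict_left_mono) auto
        then have "T * measure_pmf.prob (Q n) (Bad n) < \<epsilon> / 3" using T by simp
        moreover have "?EQ n (\<lambda>x. (LR n x)\<^sup>2) / T \<le> (exp v + 1) / T" using elim T by (intro divide_right_mono) auto
        moreover have "z / (3 * z / \<epsilon>) = \<epsilon> / 3" if "z > 0" for z using that eps by simp
        from this[of "exp v + 1"] have "(exp v + 1) / T = \<epsilon> / 3" by (simp add: T_def add_pos_pos)
        ultimately show ?thesis using elim by linarith
      qed
      finally show ?case by simp
    qed
  qed (auto intro: always_eventually less_le_trans[OF _ measure_nonneg])
  then show "(\<lambda>n. measure_pmf.prob (P n) {x. \<not> \<bar>ln (L n x) - (W n x - v / 2)\<bar> \<le> \<delta>}) \<longlonglongrightarrow> 0" by (simp add: Bad_def)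
qed

section \<open>Characteristic functions under small perturbations\<close>

lemma char_distr_pmf:
  "char (distr (measure_pmf M) borel (f :: _ \<Rightarrow> real)) t = measure_pmf.expectation M (\<lambda>x. iexp (t * f x))"
  unfolding char_def by (subst integral_distr) auto

text \<open>Slutsky's theorem for characteristic functions: \<open>iexp (t * Y)\<close> and
  \<open>iexp (t * X)\<close> differ by at most \<open>|t| * \<delta>\<close> where the variables
  are close, and by at most 2 elsewhere.\<close>

lemma char_distr_limit_perturb:
  fixes M :: "nat \<Rightarrow> 'a pmf" and X Y :: "nat \<Rightarrow> 'a \<Rightarrow> real"
  assumes lim: "\<And>t. (\<lambda>n. char (distr (measure_pmf (M n)) borel (X n)) t) \<longlonglongrightarrow> \<phi> t"
    and close: "\<And>\<delta>. 0 < \<delta> \<Longrightarrow> \<delta> \<le> 1 \<Longrightarrow> (\<lambda>n. measure_pmf.prob (M n) {x. \<not> \<bar>Y n x - X n x\<bar> \<le> \<delta>}) \<longlonglongrightarrow> 0"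
  shows "(\<lambda>n. char (distr (measure_pmf (M n)) borel (Y n)) t) \<longlonglongrightarrow> \<phi> t"
proof -
  have bnd: "cmod (char (distr (measure_pmf (M n)) borel (Y n)) t - char (distr (measure_pmf (M n)) borel (X n)) t)
     \<le> \<bar>t\<bar> * \<delta> + 2 * measure_pmf.prob (M n) {x. \<not> \<bar>Y n x - X n x\<bar> \<le> \<delta>}" if d: "0 < \<delta>" for n \<delta>
  proof -
    let ?B = "{x. \<not> \<bar>Y n x - X n x\<bar> \<le> \<delta>}"
    have i: "integrable (measure_pmf (M n)) (\<lambda>x. iexp (t * Z x))" for Z :: "'a \<Rightarrow> real"
      by (intro measure_pmf.integrable_const_bound[where B = 1]) auto
    have "cmod (char (distr (measure_pmf (M n)) borel (Y n)) t - char (distr (measure_pmf (M n)) borel (X n)) t) =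
       cmod (measure_pmf.expectation (M n) (\<lambda>x. iexp (t * Y n x) - iexp (t * X n x)))"
      unfolding char_distr_pmf by (simp only: Bochner_Integration.integral_diff[OF i i])
    also have "\<dots> \<le> measure_pmf.expectation (M n) (\<lambda>x. cmod (iexp (t * Y n x) - iexp (t * X n x)))"
      by (rule integral_norm_bound)
    also have "\<dots> \<le> measure_pmf.expectation (M n) (\<lambda>x. \<bar>t\<bar> * \<delta> + 2 * indicator ?B x)"
    proof (intro integral_mono)
      show "integrable (measure_pmf (M n)) (\<lambda>x. cmod (iexp (t * Y n x) - iexp (t * X n x)))"
        by (intro integrable_norm Bochner_Integration.integrable_diff i)
      show "integrable (measure_pmf (M n)) (\<lambda>x. \<bar>t\<bar> * \<delta> + 2 * indicator ?B x)"
        by (intro measure_pmf.integrable_const_bound[where B = "\<bar>t\<bar> * \<delta> + 2"]) (use d in \<open>auto simp: indicator_def\<close>)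
      fix x
      show "cmod (iexp (t * Y n x) - iexp (t * X n x)) \<le> \<bar>t\<bar> * \<delta> + 2 * indicator ?B x"
      proof (cases "x \<in> ?B")
        case True
        have "cmod (iexp (t * Y n x) - iexp (t * X n x)) \<le> cmod (iexp (t * Y n x)) + cmod (iexp (t * X n x))"
          by (rule norm_triangle_ineq4)
        also have "\<dots> = 2" by simp
        finally show ?thesis using True d by (simp add: add_increasing)
      next
        case False
        have "iexp (t * Y n x) - iexp (t * X n x) = iexp (t * X n x) * (iexp (t * (Y n x - X n x)) - 1)"
          by (simp add: right_diff_distrib exp_add[symmetric])
        then have "cmod (iexp (t * Y n x) - iexp (t * X n x)) = cmod (iexp (t * (Y n x - X n x)) - 1)"
          by (simp only: norm_mult norm_exp_i_times mult_1)
        also have "\<dots> \<le> \<bar>t * (Y n x - X n x)\<bar>" using iexp_approx1[of "t * (Y n x - X n x)" 0] by simp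
        also have "\<dots> \<le> \<bar>t\<bar> * \<delta>" unfolding abs_mult using False by (intro mult_left_mono) auto
        finally show ?thesis using False by simp
      qed
    qed
    also have "\<dots> = \<bar>t\<bar> * \<delta> + 2 * measure_pmf.prob (M n) ?B"
    proof -
      have "integrable (measure_pmf (M n)) (\<lambda>x. 2 * indicator ?B x :: real)"
        by (intro measure_pmf.integrable_const_bound[where B = 2]) (auto simp: indicator_def)
      from Bochner_Integration.integral_add[OF _ this, of "\<lambda>_. \<bar>t\<bar> * \<delta>"] show ?thesis by simp
    qed
    finally show ?thesis .
  qed
  have "(\<lambda>n. char (distr (measure_pmf (M n)) borel (Y n)) t - char (distr (measure_pmf (M n)) borel (X n)) t) \<longlonglongrightarrow> 0"
  proof (rule tendstoI)
    fix \<epsilon> :: real assume eps: "0 < \<epsilon>"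
    \<comment> \<open>The minimum with 1 is taken because closeness is assumed only for
      \<open>\<delta> <= 1\<close>.\<close>
    define \<delta> where "\<delta> = min 1 (\<epsilon> / (2 * (\<bar>t\<bar> + 1)))"
    have \<delta>: "0 < \<delta>" "\<delta> \<le> 1" using eps by (auto simp: \<delta>_def)
    have "\<bar>t\<bar> * \<delta> \<le> (\<bar>t\<bar> + 1) * (\<epsilon> / (2 * (\<bar>t\<bar> + 1)))" using \<delta> by (intro mult_mono) (auto simp: \<delta>_def)
    moreover have "z * (\<epsilon> / (2 * z)) = \<epsilon> / 2" if "z > 0" for z using that by simp
    from this[of "\<bar>t\<bar> + 1"] have "(\<bar>t\<bar> + 1) * (\<epsilon> / (2 * (\<bar>t\<bar> + 1))) = \<epsilon> / 2" by linarith
    ultimately have t: "\<bar>t\<bar> * \<delta> \<le> \<epsilon> / 2" by linarith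
    have "eventually (\<lambda>n. measure_pmf.prob (M n) {x. \<not> \<bar>Y n x - X n x\<bar> \<le> \<delta>} < \<epsilon> / 4) sequentially"
      using order_tendstoD(2)[OF close[OF \<delta>], of "\<epsilon> / 4"] eps by simp
    then show "eventually (\<lambda>n. dist (char (distr (measure_pmf (M n)) borel (Y n)) t - char (distr (measure_pmf (M n)) borel (X n)) t) 0 < \<epsilon>) sequentially"
    proof eventually_elim
      case (elim n)
      then show ?case using bnd[OF \<delta>(1), of n] t by (simp only: dist_0_norm dist_commute[of _ 0])
    qed
  qed
  from tendsto_add[OF this lim[of t]] show ?thesis by simp
qed

section \<open>The planted matching model\<close>

locale planted_model =
  fixes \<zeta> \<theta> c :: real and lam p q :: "nat \<Rightarrow> real"
  assumes \<zeta>: "\<zeta> \<ge> 60" and \<theta>: "\<theta> > 0"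
    and lam: "\<And>n. n \<ge> 1 \<Longrightarrow> lam n = 1 / (\<zeta> * real n)"
    and p: "\<And>n. n \<ge> 1 \<Longrightarrow> 0 < p n \<and> p n < 1"
    and plim: "(\<lambda>n. p n * sqrt (real n)) \<longlonglongrightarrow> \<theta>"
    and q: "\<And>n. n \<ge> 1 \<Longrightarrow> q n = p n +
           measure_pmf.expectation (monomer_dimer (lam n) (complete_edges n)) (\<lambda>M. real (card M))
             / real (n choose 2) * (1 - p n)"
    and c: "c = 1 - 1 / 2 * (sqrt (\<zeta>\<^sup>2 + 4 * \<zeta>) - \<zeta>)"
begin

abbreviation "E \<equiv> complete_edges"
abbreviation "MD n \<equiv> monomer_dimer (lam n) (E n)"
definition "mean n = measure_pmf.expectation (MD n) (\<lambda>M. real (card M))"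
text \<open>By symmetry this is the probability that a given pair belongs to the matching, and
  \<open>q\<close> is then the edge density of the planted model.\<close>

definition "\<pi> n = mean n / real (n choose 2)"
definition "w n M = lam n ^ card M / partition_function (lam n) (E n)"
text \<open>Any exponent strictly between \<open>1 / 2\<close> (fluctuations of the matching size) and \<open>3 / 4\<close>
  (sensitivity of the second moment to the sizes) would do.\<close>

definition "\<tau> n = real n powr (5 / 8)"
definition "sizes n = {m. m \<le> n \<and> \<bar>real m - c * real n / 2\<bar> \<le> \<tau> n}"
definition "typical n = {M \<in> kmatchings n. card M \<in> sizes n}"
definition "v = c ^ 4 / (2 * \<theta>\<^sup>2)"

section \<open>Matching size, edge densities and their limits\<close>

lemma c_bounds: "0 < c" "c < 1 / 2" and c_root: "(1 - c)\<^sup>2 / \<zeta> + (1 - c) = 1"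
proof -
  define s where "s = sqrt (\<zeta>\<^sup>2 + 4 * \<zeta>)"
  have s2: "s\<^sup>2 = \<zeta>\<^sup>2 + 4 * \<zeta>" using \<zeta> by (simp add: s_def)
  \<comment> \<open>The bounds \<open>\<zeta> + 1 < s < \<zeta> + 2\<close> amount to
    \<open>0 < c < 1 / 2\<close>.\<close>
  have "s < \<zeta> + 2" unfolding s_def using \<zeta> by (intro real_less_lsqrt) (auto simp: power2_eq_square algebra_simps)
  moreover have "\<zeta> + 1 < s" unfolding s_def using \<zeta> by (intro real_less_rsqrt) (auto simp: power2_eq_square algebra_simps)
  ultimately show "0 < c" "c < 1 / 2" unfolding c s_def[symmetric] by simp_all
  \<comment> \<open>\<open>1 - c\<close> is the positive root of the quadratic in
    \<open>matching_size_concentration\<close>.\<close>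
  have u: "1 - c = (s - \<zeta>) / 2" unfolding c s_def by simp
  have "(s - \<zeta>)\<^sup>2 = \<zeta> * (2 * \<zeta> + 4 - 2 * s)" using s2 by (simp add: power2_diff algebra_simps power2_eq_square)
  then show "(1 - c)\<^sup>2 / \<zeta> + (1 - c) = 1" unfolding u using \<zeta> by (simp add: power_divide field_simps)
qed

lemma v_pos: "v > 0" using c_bounds \<theta> by (simp add: v_def)

lemma lam_nonneg: "n \<ge> 1 \<Longrightarrow> 0 \<le> lam n" using lam \<zeta> by simp

lemma finite_kmatchings: "finite (kmatchings n)" using matchings_finite[OF complete_edges_finite] .

lemma w_nonneg: "n \<ge> 1 \<Longrightarrow> 0 \<le> w n M"
  unfolding w_def using lam_nonneg partition_function_pos[OF complete_edges_finite, of "lam n" n] by simp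

lemma expectation_MD: "n \<ge> 1 \<Longrightarrow> measure_pmf.expectation (MD n) h = (\<Sum>M\<in>kmatchings n. w n M * (h M :: real))"
  unfolding w_def using expectation_monomer_dimer[OF lam_nonneg] by simp

lemma sum_w: "n \<ge> 1 \<Longrightarrow> (\<Sum>M\<in>kmatchings n. w n M) = 1"
  using expectation_MD[of n "\<lambda>_. 1"] by simp

lemma variance_size: "n \<ge> 1 \<Longrightarrow> (\<Sum>M\<in>kmatchings n. w n M * (real (card M) - c * real n / 2)\<^sup>2) \<le> real n"
  using matching_size_concentration[of n \<zeta> "1 - c"] c_bounds c_root \<zeta> lam[of n] expectation_MD[of n "\<lambda>M. (real (card M) - c * real n / 2)\<^sup>2"]
  by simp

lemma mean_dev: 
  assumes n: "n \<ge> 1"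
  shows "\<bar>mean n - c * real n / 2\<bar> \<le> sqrt (real n)"
proof -
  note int = integrable_monomer_dimer[OF lam_nonneg[OF n]]
  have "mean n - c * real n / 2 = measure_pmf.expectation (MD n) (\<lambda>M. real (card M) - c * real n / 2)"
    unfolding mean_def using int by simp
  also have "\<bar>\<dots>\<bar> \<le> measure_pmf.expectation (MD n) (\<lambda>M. \<bar>real (card M) - c * real n / 2\<bar>)"
    by (rule integral_abs_bound)
  also have "\<dots> \<le> sqrt (measure_pmf.expectation (MD n) (\<lambda>M. (real (card M) - c * real n / 2)\<^sup>2))"
  proof (rule integral_abs_le_sqrt_second_moment)
    have "set_pmf (MD n) \<subseteq> kmatchings n"
      by (auto simp: set_pmf_eq pmf_monomer_dimer[OF complete_edges_finite lam_nonneg[OF n]] split: if_splits)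
    thus "finite (set_pmf (MD n))" using finite_kmatchings finite_subset by blast
  qed
  also have "\<dots> \<le> sqrt (real n)"
    unfolding expectation_MD[OF n] using variance_size[OF n] by (rule real_sqrt_le_mono)
  finally show ?thesis .
qed

lemma choose_two_real: "real (n choose 2) = real n * (real n - 1) / 2"
  by (cases n; simp add: choose_two real_of_nat_div algebra_simps)

lemma mean_pi: "n \<ge> 2 \<Longrightarrow> \<pi> n * real (n choose 2) = mean n"
  unfolding \<pi>_def choose_two_real by simp

text \<open>The balance equation with constant \<open>h\<close> bounds the mean size by
  \<open>lam n\<close> times the number of pairs, so that
  \<open>\<pi> n <= lam n < 1\<close>.\<close>

lemma pi_bounds: 
  assumes n: "n \<ge> 1"
  shows "0 \<le> \<pi> n \<and> \<pi> n < 1"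
proof (cases "n = 1")
  \<comment> \<open>There are no pairs for \<open>n = 1\<close>, and division by zero makes
    \<open>\<pi> 1 = 0\<close>.\<close>
  case True
  thus ?thesis by (simp add: \<pi>_def binomial_eq_0)
next
  case False
  then have n2: "n \<ge> 2" using n by simp
  have N: "real (n choose 2) > 0" unfolding choose_two_real using n2 by simp
  have "mean n = lam n / 2 * (\<Sum>M\<in>kmatchings n. w n M * ((real n - 2 * real (card M)) * (real n - 2 * real (card M) - 1)))"
    using expectation_matching_size_shift[OF lam_nonneg[OF n], of n "\<lambda>_. 1"]
    unfolding mean_def by (simp add: expectation_MD[OF n])
  also have "\<dots> \<le> lam n / 2 * (\<Sum>M\<in>kmatchings n. w n M * (real n * (real n - 1)))"
  proof (intro mult_left_mono sum_mono w_nonneg[OF n])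
    fix M assume M: "M \<in> kmatchings n"
    have y: "real n - 2 * real (card M) = real (n - 2 * card M)" using two_card_matching_le[OF M] by (simp add: of_nat_diff)
    \<comment> \<open>Monotonicity of the product uses that the second factor is nonnegative, which
      fails only when no vertex is left; then the product is zero.\<close>
    show "(real n - 2 * real (card M)) * (real n - 2 * real (card M) - 1) \<le> real n * (real n - 1)"
    proof (cases "n - 2 * card M = 0")
      case True
      then show ?thesis unfolding y using n by simp
    next
      case False
      then show ?thesis unfolding y using n by (intro mult_mono) auto
    qed
  qed (use lam_nonneg[OF n] in auto)
  also have "\<dots> = lam n * real (n choose 2)"
    unfolding sum_distrib_right[symmetric] sum_w[OF n] choose_two_real by simp
  finally have "\<pi> n \<le> lam n" unfolding \<pi>_def using N by (simp add: divide_le_eq)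
  also have "lam n < 1"
  proof -
    have "1 * 1 < \<zeta> * real n" using \<zeta> n by (intro mult_less_le_imp_less) auto
    thus ?thesis using lam[OF n] by simp
  qed
  finally have "\<pi> n < 1" .
  moreover have "0 \<le> mean n" unfolding mean_def by simp
  ultimately show ?thesis unfolding \<pi>_def by simp
qed

lemma q_pi: "n \<ge> 1 \<Longrightarrow> q n = p n + \<pi> n * (1 - p n)"
  unfolding \<pi>_def mean_def by (rule q)

lemma q_bounds: 
  assumes n: "n \<ge> 1"
  shows "0 < q n" "q n < 1"
proof -
  have "1 - q n = (1 - p n) * (1 - \<pi> n)" unfolding q_pi[OF n] by (simp add: algebra_simps)
  moreover have "0 < (1 - p n) * (1 - \<pi> n)" using p[OF n] pi_bounds[OF n] by (intro mult_pos_pos) auto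
  ultimately show "q n < 1" by simp
  show "0 < q n" unfolding q_pi[OF n] using p[OF n] pi_bounds[OF n] by (intro add_pos_nonneg mult_nonneg_nonneg) auto
qed

lemma mean_lim: "(\<lambda>n. mean n / real n) \<longlonglongrightarrow> c / 2"
proof -
  have "(\<lambda>n. mean n / real n - c / 2) \<longlonglongrightarrow> 0"
  proof (rule Lim_null_comparison)
    show "eventually (\<lambda>n. norm (mean n / real n - c / 2) \<le> sqrt (real n) / real n) sequentially"
      using eventually_ge_at_top[of 1]
    proof eventually_elim
      case (elim n)
      have "mean n / real n - c / 2 = (mean n - c * real n / 2) / real n" using elim by (simp add: field_simps)
      thus ?case using mean_dev[OF elim] elim by (simp add: divide_right_mono)
    qed
    show "(\<lambda>n. sqrt (real n) / real n) \<longlonglongrightarrow> 0" by real_asymp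
  qed
  thus ?thesis by (simp add: LIM_zero_iff)
qed

lemma pi_lim: "(\<lambda>n. real n * \<pi> n) \<longlonglongrightarrow> c"
proof -
  have "(\<lambda>n. (real n)\<^sup>2 / real (n choose 2)) \<longlonglongrightarrow> 2" unfolding choose_two_real by real_asymp
  from tendsto_mult[OF mean_lim this] have "(\<lambda>n. mean n / real n * ((real n)\<^sup>2 / real (n choose 2))) \<longlonglongrightarrow> c" by simp
  moreover have "eventually (\<lambda>n. mean n / real n * ((real n)\<^sup>2 / real (n choose 2)) = real n * \<pi> n) sequentially"
    using eventually_ge_at_top[of 1] by eventually_elim (simp add: \<pi>_def power2_eq_square)
  ultimately show ?thesis by (rule Lim_transform_eventually)
qed

lemma p_lim: "p \<longlonglongrightarrow> 0"
proof -
  have "(\<lambda>n. 1 / sqrt (real n)) \<longlonglongrightarrow> 0" by real_asymp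
  from tendsto_mult[OF plim this] have "(\<lambda>n. p n * sqrt (real n) * (1 / sqrt (real n))) \<longlonglongrightarrow> 0" by simp
  moreover have "eventually (\<lambda>n. p n * sqrt (real n) * (1 / sqrt (real n)) = p n) sequentially"
    using eventually_ge_at_top[of 1] by eventually_elim simp
  ultimately show ?thesis by (rule Lim_transform_eventually)
qed

lemma q_lim: "(\<lambda>n. q n * sqrt (real n)) \<longlonglongrightarrow> \<theta>"
proof -
  have "(\<lambda>n. 1 / sqrt (real n)) \<longlonglongrightarrow> 0" by real_asymp
  then have "(\<lambda>n. p n * sqrt (real n) + real n * \<pi> n * (1 - p n) * (1 / sqrt (real n))) \<longlonglongrightarrow> \<theta> + c * (1 - 0) * 0"
    by (intro tendsto_add tendsto_mult tendsto_diff tendsto_const plim pi_lim p_lim)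
  moreover have "eventually (\<lambda>n. p n * sqrt (real n) + real n * \<pi> n * (1 - p n) * (1 / sqrt (real n)) = q n * sqrt (real n)) sequentially"
    using eventually_ge_at_top[of 1]
  proof eventually_elim
    case (elim n)
    have "real n * z * (1 / sqrt (real n)) = z * sqrt (real n)" for z
    proof -
      have "real n * z * (1 / sqrt (real n)) = z * (real n / sqrt (real n))" by simp
      thus ?thesis by (simp only: real_div_sqrt of_nat_0_le_iff)
    qed
    from this[of "\<pi> n * (1 - p n)"] show ?case unfolding q_pi[OF elim] by (simp add: distrib_right mult.assoc)
  qed
  ultimately show ?thesis by (simp add: Lim_transform_eventually)
qed

text \<open>Chebyshev's inequality: a second moment of at most \<open>n\<close> against
  \<open>(\<tau> n)^2 = n^(5/4)\<close>.\<close>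

lemma untypical: "(\<lambda>n. \<Sum>M\<in>kmatchings n - typical n. w n M) \<longlonglongrightarrow> 0"
proof (rule Lim_null_comparison)
  show "eventually (\<lambda>n. norm (\<Sum>M\<in>kmatchings n - typical n. w n M) \<le> real n / (\<tau> n)\<^sup>2) sequentially"
    using eventually_ge_at_top[of 1]
  proof eventually_elim
    case (elim n)
    have \<tau>: "\<tau> n > 0" using elim by (simp add: \<tau>_def)
    have "(\<tau> n)\<^sup>2 * (\<Sum>M\<in>kmatchings n - typical n. w n M) = (\<Sum>M\<in>kmatchings n - typical n. w n M * (\<tau> n)\<^sup>2)"
      by (simp add: sum_distrib_left mult.commute)
    also have "\<dots> \<le> (\<Sum>M\<in>kmatchings n - typical n. w n M * (real (card M) - c * real n / 2)\<^sup>2)"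
    proof (intro sum_mono mult_left_mono w_nonneg[OF elim])
      fix M assume M: "M \<in> kmatchings n - typical n"
      then have "card M \<le> n" using two_card_matching_le[of M n] by simp
      then have "\<tau> n < \<bar>real (card M) - c * real n / 2\<bar>" using M by (auto simp: typical_def sizes_def)
      from power_mono[OF less_imp_le[OF this], of 2] \<tau> show "(\<tau> n)\<^sup>2 \<le> (real (card M) - c * real n / 2)\<^sup>2" by simp
    qed
    also have "\<dots> \<le> (\<Sum>M\<in>kmatchings n. w n M * (real (card M) - c * real n / 2)\<^sup>2)"
      using finite_kmatchings by (intro sum_mono2) (auto intro!: mult_nonneg_nonneg w_nonneg[OF elim])
    also have "\<dots> \<le> real n" by (rule variance_size[OF elim])
    finally have "(\<Sum>M\<in>kmatchings n - typical n. w n M) \<le> real n / (\<tau> n)\<^sup>2" using \<tau> by (simp add: field_simps)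
    moreover have "0 \<le> (\<Sum>M\<in>kmatchings n - typical n. w n M)" using w_nonneg[OF elim] by (intro sum_nonneg) auto
    ultimately show ?case by simp
  qed
  show "(\<lambda>n. real n / (\<tau> n)\<^sup>2) \<longlonglongrightarrow> 0" unfolding \<tau>_def by real_asymp
qed

section \<open>The likelihood ratio, its truncation and the wedge statistic\<close>

definition "ratio n M x = planted_ratio (E n) (p n) (q n) M x"
definition "LR n x = (\<Sum>M\<in>typical n. w n M * ratio n M x)"
definition "L n x = (\<Sum>M\<in>kmatchings n. w n M * ratio n M x)"
text \<open>The sign is negative because a matching has no wedges and so lowers the signed wedge
  count. The factor \<open>c^2 / \<theta>^2\<close> makes the limiting null variance equal to
  \<open>v\<close>, and then the limiting planted mean is \<open>v\<close> as well.\<close>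

definition "W n x = - (c\<^sup>2 / \<theta>\<^sup>2) / real n * regular_form.form (E n) (line_nb n) (q n) x / 2"

abbreviation "QQ n \<equiv> bernoulli_product (E n) (q n)"
abbreviation "PP n \<equiv> planted_matching n (p n) (lam n)"

lemma typical_sub: "typical n \<subseteq> kmatchings n" by (auto simp: typical_def)

lemma finite_typical: "finite (typical n)" using typical_sub finite_kmatchings finite_subset by blast

lemma ratio_nonneg: "0 \<le> ratio n M x"
  unfolding ratio_def planted_ratio_def edge_ratio_def by (intro prod_nonneg) simp

lemma expectation_ratio:
  fixes g :: "_ \<Rightarrow> 'b::{banach, second_countable_topology}"
  shows "n \<ge> 1 \<Longrightarrow> measure_pmf.expectation (QQ n) (\<lambda>x. ratio n M x *\<^sub>R g x) = measure_pmf.expectation (planted_given (E n) (p n) M) g"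
  unfolding ratio_def by (rule expectation_planted_ratio[OF complete_edges_finite q_bounds])

lemma expectation_ratio_1: "n \<ge> 1 \<Longrightarrow> measure_pmf.expectation (QQ n) (ratio n M) = 1"
  using expectation_ratio[of n M "\<lambda>_. 1 :: real"] by simp

lemma integrable_QQ [simp]: "integrable (measure_pmf (QQ n)) (f :: _ \<Rightarrow> 'b::{banach, second_countable_topology})"
  by (rule integrable_bernoulli_product[OF complete_edges_finite])

lemma expectation_PP:
  fixes g :: "_ \<Rightarrow> 'b::{banach, second_countable_topology}"
  assumes n: "n \<ge> 1"
  shows "measure_pmf.expectation (PP n) g = (\<Sum>M\<in>kmatchings n. w n M *\<^sub>R measure_pmf.expectation (planted_given (E n) (p n) M) g)"
proof -
  note pmf = pmf_monomer_dimer[OF complete_edges_finite lam_nonneg[OF n], of n]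
  have "measure_pmf.expectation (PP n) g = measure_pmf.expectation (MD n \<bind> planted_given (E n) (p n)) g"
    unfolding planted_matching_def planted_given_def ..
  also have "\<dots> = (\<Sum>M\<in>kmatchings n. pmf (MD n) M *\<^sub>R measure_pmf.expectation (planted_given (E n) (p n) M) g)"
    using finite_kmatchings finite_set_planted_given[OF complete_edges_finite]
    by (intro pmf_expectation_bind) (auto simp: set_pmf_eq pmf split: if_splits)
  also have "\<dots> = (\<Sum>M\<in>kmatchings n. w n M *\<^sub>R measure_pmf.expectation (planted_given (E n) (p n) M) g)"
    by (intro sum.cong refl) (simp add: pmf w_def)
  finally show ?thesis .
qed

lemma expectation_PP_QQ:
  fixes g :: "_ \<Rightarrow> real"
  assumes n: "n \<ge> 1"
  shows "measure_pmf.expectation (PP n) g = measure_pmf.expectation (QQ n) (\<lambda>x. L n x * g x)"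
proof -
  have "measure_pmf.expectation (QQ n) (\<lambda>x. L n x * g x) = measure_pmf.expectation (QQ n) (\<lambda>x. \<Sum>M\<in>kmatchings n. w n M * (ratio n M x *\<^sub>R g x))"
    unfolding L_def by (simp add: sum_distrib_right mult.assoc)
  also have "\<dots> = (\<Sum>M\<in>kmatchings n. w n M * measure_pmf.expectation (QQ n) (\<lambda>x. ratio n M x *\<^sub>R g x))"
    by (simp only: Bochner_Integration.integral_sum[OF integrable_QQ] integral_mult_right_zero)
  also have "\<dots> = measure_pmf.expectation (PP n) g"
    unfolding expectation_PP[OF n] expectation_ratio[OF n] by simp
  finally show ?thesis ..
qed

lemma LR_bounds:
  assumes n: "n \<ge> 1"
  shows "0 \<le> LR n x" "LR n x \<le> L n x"
proof -
  show "0 \<le> LR n x" unfolding LR_def using w_nonneg[OF n] ratio_nonneg by (intro sum_nonneg mult_nonneg_nonneg)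
  show "LR n x \<le> L n x" unfolding LR_def L_def
    using typical_sub finite_kmatchings by (intro sum_mono2) (auto intro!: mult_nonneg_nonneg w_nonneg[OF n] ratio_nonneg)
qed

text \<open>Every planted ratio has mean one under \<open>QQ n\<close>, so the mean of the discarded
  part of \<open>L\<close> is the probability of an untypical matching.\<close>

lemma untypical_ratio_lim: "(\<lambda>n. measure_pmf.expectation (QQ n) (\<lambda>x. L n x - LR n x)) \<longlonglongrightarrow> 0"
proof (rule Lim_transform_eventually[OF untypical])
  show "eventually (\<lambda>n. (\<Sum>M\<in>kmatchings n - typical n. w n M) = measure_pmf.expectation (QQ n) (\<lambda>x. L n x - LR n x)) sequentially"
    using eventually_ge_at_top[of 1]
  proof eventually_elim
    case (elim n)
    have "L n x - LR n x = (\<Sum>M\<in>kmatchings n - typical n. w n M * ratio n M x)" for x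
      unfolding L_def LR_def using finite_kmatchings typical_sub by (simp add: sum_diff)
    then have "measure_pmf.expectation (QQ n) (\<lambda>x. L n x - LR n x) = (\<Sum>M\<in>kmatchings n - typical n. w n M * measure_pmf.expectation (QQ n) (ratio n M))"
      by (simp only: Bochner_Integration.integral_sum[OF integrable_QQ] integral_mult_right_zero)
    thus ?case using expectation_ratio_1[OF elim] by simp
  qed
qed

section \<open>The second moment restricted to typical sizes\<close>

definition "a0 n = 1 + (q n - p n)\<^sup>2 / (q n * (1 - q n))"
definition "G n m m' = a0 n ^ (n choose 2) * (p n / q n / a0 n) ^ (m + m') * overlap_series n m m' (a0 n * q n / (p n)\<^sup>2 - 1)"

text \<open>Uniformity by selection: for each \<open>n\<close> take a pair of sizes that violates
  the bound, if there is one, and apply the limit lemma along these sequences. Both sizes are within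
  \<open>\<tau> n + sqrt n\<close> of the mean, and the square of this is
  \<open>o(n^(3/2))\<close>.\<close>

lemma G_bound:
  assumes eps: "\<epsilon> > 0"
  shows "eventually (\<lambda>n. \<forall>m\<in>sizes n. \<forall>m'\<in>sizes n. G n m m' \<le> exp (v + \<epsilon>)) sequentially"
proof -
  define bad where "bad n x = (fst x \<in> sizes n \<and> snd x \<in> sizes n \<and> \<not> G n (fst x) (snd x) \<le> exp (v + \<epsilon>))" for n x
  \<comment> \<open>Default when no pair violates the bound; the rounded centre lies within
    \<open>1 <= \<tau> n\<close> of \<open>c * n / 2\<close>.\<close>
  define m0 where "m0 n = nat \<lfloor>c * real n / 2\<rfloor>" for n
  define sel where "sel n = (if \<exists>x. bad n x then SOME x. bad n x else (m0 n, m0 n))" for n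
  define m where "m n = fst (sel n)" for n
  define m' where "m' n = snd (sel n)" for n
  have m0: "\<bar>real (m0 n) - c * real n / 2\<bar> \<le> \<tau> n" if "n \<ge> 1" for n
  proof -
    have "0 \<le> c * real n / 2" using c_bounds by simp
    then have "real (m0 n) = real_of_int \<lfloor>c * real n / 2\<rfloor>" by (simp add: m0_def)
    then have "\<bar>real (m0 n) - c * real n / 2\<bar> \<le> 1" by linarith
    also have "1 \<le> \<tau> n" using that by (simp add: \<tau>_def ge_one_powr_ge_zero)
    finally show ?thesis .
  qed
  have dev: "\<bar>real (m n) - c * real n / 2\<bar> \<le> \<tau> n \<and> \<bar>real (m' n) - c * real n / 2\<bar> \<le> \<tau> n" if n: "n \<ge> 1" for n
  proof (cases "\<exists>x. bad n x")
    case True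
    then have "bad n (sel n)" unfolding sel_def by (simp add: someI_ex)
    thus ?thesis by (simp add: bad_def m_def m'_def sizes_def)
  next
    case False
    thus ?thesis using m0[OF n] by (simp add: m_def m'_def sel_def)
  qed
  have lim: "(\<lambda>n. real (k n) / real n) \<longlonglongrightarrow> c / 2" if "\<And>n. n \<ge> 1 \<Longrightarrow> \<bar>real (k n) - c * real n / 2\<bar> \<le> \<tau> n" for k :: "nat \<Rightarrow> nat"
  proof -
    have "(\<lambda>n. real (k n) / real n - c / 2) \<longlonglongrightarrow> 0"
    proof (rule Lim_null_comparison)
      show "eventually (\<lambda>n. norm (real (k n) / real n - c / 2) \<le> \<tau> n / real n) sequentially"
        using eventually_ge_at_top[of 1]
      proof eventually_elim
        case (elim n)
        have "real (k n) / real n - c / 2 = (real (k n) - c * real n / 2) / real n" using elim by (simp add: field_simps)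
        thus ?case using that[OF elim] elim by (simp add: divide_right_mono)
      qed
      show "(\<lambda>n. \<tau> n / real n) \<longlonglongrightarrow> 0" unfolding \<tau>_def by real_asymp
    qed
    thus ?thesis by (simp add: LIM_zero_iff)
  qed
  have D: "(\<lambda>n. (real (m n) - \<pi> n * real (n choose 2)) * (real (m' n) - \<pi> n * real (n choose 2)) / (real n * sqrt (real n))) \<longlonglongrightarrow> 0"
  proof (rule Lim_null_comparison)
    show "eventually (\<lambda>n. norm ((real (m n) - \<pi> n * real (n choose 2)) * (real (m' n) - \<pi> n * real (n choose 2)) / (real n * sqrt (real n)))
       \<le> (\<tau> n + sqrt (real n))\<^sup>2 / (real n * sqrt (real n))) sequentially"
      using eventually_ge_at_top[of 2]
    proof eventually_elim
      case (elim n)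
      then have n: "n \<ge> 1" by simp
      have b: "\<bar>real (m n) - mean n\<bar> \<le> \<tau> n + sqrt (real n)" "\<bar>real (m' n) - mean n\<bar> \<le> \<tau> n + sqrt (real n)"
        using dev[OF n] mean_dev[OF n] by linarith+
      have "\<bar>real (m n) - mean n\<bar> * \<bar>real (m' n) - mean n\<bar> \<le> (\<tau> n + sqrt (real n))\<^sup>2"
        unfolding power2_eq_square using b by (intro mult_mono) (auto simp: \<tau>_def)
      thus ?case unfolding mean_pi[OF elim] by (simp add: abs_mult divide_right_mono)
    qed
    show "(\<lambda>n. (\<tau> n + sqrt (real n))\<^sup>2 / (real n * sqrt (real n))) \<longlonglongrightarrow> 0" unfolding \<tau>_def by real_asymp
  qed
  have "eventually (\<lambda>n. G n (m n) (m' n) \<le> exp (v + \<epsilon>)) sequentially"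
    unfolding G_def a0_def v_def
    by (rule second_moment_exponent_limit[OF p plim \<theta> pi_bounds pi_lim c_bounds q_pi lim lim D eps]) (use dev in auto)
  then show ?thesis
  proof eventually_elim
    case (elim n)
    have "\<not> (\<exists>x. bad n x)"
    proof
      assume "\<exists>x. bad n x"
      then have "bad n (sel n)" unfolding sel_def by (simp add: someI_ex)
      then show False using elim by (simp add: bad_def m_def m'_def)
    qed
    then show ?case by (auto simp: bad_def)
  qed
qed

text \<open>Given its size, a monomer-dimer matching is uniform, so grouping by sizes reduces the
  double sum to \<open>sum_overlap\<close> with \<open>1 + t = a0 * q / p^2\<close>. The weights of
  the typical sizes sum to at most one.\<close>

lemma second_moment_eventually:
  assumes eps: "\<epsilon> > 0"
  shows "eventually (\<lambda>n. measure_pmf.expectation (QQ n) (\<lambda>x. (LR n x)\<^sup>2) \<le> exp v + \<epsilon>) sequentially"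
proof -
  define \<epsilon>' where "\<epsilon>' = ln (1 + \<epsilon> / exp v)"
  have e1: "1 < 1 + \<epsilon> / exp v" using eps by simp
  then have e': "\<epsilon>' > 0" unfolding \<epsilon>'_def by (rule ln_gt_zero)
  have "exp (v + \<epsilon>') = exp v * (1 + \<epsilon> / exp v)" unfolding exp_add \<epsilon>'_def using e1 by simp
  then have ee: "exp (v + \<epsilon>') = exp v + \<epsilon>" by (simp add: distrib_left)
  show ?thesis using G_bound[OF e'] eventually_ge_at_top[of 1]
  proof eventually_elim
    case (elim n)
    then have n: "n \<ge> 1" by simp
    let ?r = "a0 n * q n / (p n)\<^sup>2"
    let ?F = "\<lambda>M M'. a0 n ^ (n choose 2) * (p n / q n / a0 n) ^ (card M + card M') * ?r ^ card (M \<inter> M')"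
    let ?A = "matchings_above n {}"
    let ?wm = "\<lambda>m. lam n ^ m / partition_function (lam n) (E n)"
    have fs: "finite (sizes n)" unfolding sizes_def by simp
    have group: "(\<Sum>M\<in>typical n. F M) = (\<Sum>m\<in>sizes n. \<Sum>M\<in>?A m. F M)" for F :: "_ \<Rightarrow> real"
    proof -
      have "(\<Sum>M\<in>typical n. F M) = (\<Sum>m\<in>sizes n. sum F {M. M \<in> typical n \<and> card M = m})"
        using finite_typical fs by (intro sum.group[symmetric]) (auto simp: typical_def)
      also have "\<dots> = (\<Sum>m\<in>sizes n. sum F (?A m))"
        by (intro sum.cong refl arg_cong[where f = "sum F"]) (auto simp: typical_def matchings_above_def)
      finally show ?thesis .
    qed
    have "measure_pmf.expectation (QQ n) (\<lambda>x. (LR n x)\<^sup>2) =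
       measure_pmf.expectation (QQ n) (\<lambda>x. \<Sum>M\<in>typical n. \<Sum>M'\<in>typical n. w n M * w n M' * (ratio n M x * ratio n M' x))"
      unfolding LR_def power2_eq_square sum_product by (simp add: mult_ac)
    also have "\<dots> = (\<Sum>M\<in>typical n. \<Sum>M'\<in>typical n. w n M * w n M' * measure_pmf.expectation (QQ n) (\<lambda>x. ratio n M x * ratio n M' x))"
      by (simp only: Bochner_Integration.integral_sum[OF integrable_QQ] integral_mult_right_zero)
    also have "\<dots> = (\<Sum>M\<in>typical n. \<Sum>M'\<in>typical n. w n M * w n M' * ?F M M')"
    proof (intro sum.cong refl)
      fix M M' assume "M \<in> typical n" "M' \<in> typical n"
      then have "M \<subseteq> E n" "M' \<subseteq> E n" by (auto simp: typical_def matchings_def)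
      from expectation_planted_ratio_product[OF complete_edges_finite this p[OF n, THEN conjunct1] p[OF n, THEN conjunct2] q_bounds[OF n]]
      show "w n M * w n M' * measure_pmf.expectation (QQ n) (\<lambda>x. ratio n M x * ratio n M' x) = w n M * w n M' * ?F M M'"
        unfolding ratio_def a0_def card_complete_edges by simp
    qed
    also have "\<dots> = (\<Sum>m\<in>sizes n. \<Sum>m'\<in>sizes n. \<Sum>M\<in>?A m. \<Sum>M'\<in>?A m'. w n M * w n M' * ?F M M')"
      unfolding group by (intro sum.cong refl sum.swap)
    also have "\<dots> = (\<Sum>m\<in>sizes n. \<Sum>m'\<in>sizes n. (?wm m * real (card (?A m))) * (?wm m' * real (card (?A m'))) * G n m m')"
    proof (intro sum.cong refl)
      fix m m'
      show "(\<Sum>M\<in>?A m. \<Sum>M'\<in>?A m'. w n M * w n M' * ?F M M') = (?wm m * real (card (?A m))) * (?wm m' * real (card (?A m'))) * G n m m'"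
      proof (cases "?A m = {} \<or> ?A m' = {}")
        case True
        thus ?thesis by auto
      next
        case False
        let ?c = "?wm m * ?wm m' * (a0 n ^ (n choose 2) * (p n / q n / a0 n) ^ (m + m'))"
        have "(\<Sum>M\<in>?A m. \<Sum>M'\<in>?A m'. w n M * w n M' * ?F M M') = (\<Sum>M\<in>?A m. \<Sum>M'\<in>?A m'. ?c * (1 + (?r - 1)) ^ card (M \<inter> M'))"
          by (intro sum.cong refl) (auto simp: matchings_above_def w_def)
        also have "\<dots> = ?c * (\<Sum>M\<in>?A m. \<Sum>M'\<in>?A m'. (1 + (?r - 1)) ^ card (M \<inter> M'))"
          by (simp only: sum_distrib_left)
        also have "(\<Sum>M\<in>?A m. \<Sum>M'\<in>?A m'. (1 + (?r - 1)) ^ card (M \<inter> M')) = real (card (?A m)) * real (card (?A m')) * overlap_series n m m' (?r - 1)"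
          using False by (intro sum_overlap) auto
        also have "?c * (real (card (?A m)) * real (card (?A m')) * overlap_series n m m' (?r - 1)) = (?wm m * real (card (?A m))) * (?wm m' * real (card (?A m'))) * G n m m'"
          unfolding G_def by (simp only: mult_ac)
        finally show ?thesis .
      qed
    qed
    also have "\<dots> \<le> (\<Sum>m\<in>sizes n. \<Sum>m'\<in>sizes n. (?wm m * real (card (?A m))) * (?wm m' * real (card (?A m'))) * (exp v + \<epsilon>))"
    proof (intro sum_mono mult_left_mono)
      fix m m' assume "m \<in> sizes n" "m' \<in> sizes n"
      then show "G n m m' \<le> exp v + \<epsilon>" using elim unfolding ee by blast
      show "0 \<le> (?wm m * real (card (?A m))) * (?wm m' * real (card (?A m')))"
        using lam_nonneg[OF n] partition_function_pos[OF complete_edges_finite lam_nonneg[OF n], of n] by (intro mult_nonneg_nonneg) auto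
    qed
    also have "\<dots> = (\<Sum>m\<in>sizes n. ?wm m * real (card (?A m))) * (\<Sum>m\<in>sizes n. ?wm m * real (card (?A m))) * (exp v + \<epsilon>)"
    proof -
      have "(\<Sum>m\<in>S. \<Sum>m'\<in>S. a m * a m' * K) = (\<Sum>m\<in>S. a m) * (\<Sum>m\<in>S. a m) * K" for a :: "nat \<Rightarrow> real" and S K
        by (simp only: sum_distrib_right[symmetric] sum_distrib_left[symmetric])
      thus ?thesis .
    qed
    also have "(\<Sum>m\<in>sizes n. ?wm m * real (card (?A m))) = (\<Sum>M\<in>typical n. w n M)"
      unfolding group by (intro sum.cong refl) (simp add: w_def matchings_above_def)
    also have "(\<Sum>M\<in>typical n. w n M) * (\<Sum>M\<in>typical n. w n M) * (exp v + \<epsilon>) \<le> 1 * 1 * (exp v + \<epsilon>)"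
    proof -
      have "(\<Sum>M\<in>typical n. w n M) \<le> 1"
        unfolding sum_w[OF n, symmetric] using finite_kmatchings typical_sub w_nonneg[OF n] by (intro sum_mono2) auto
      moreover have "0 \<le> (\<Sum>M\<in>typical n. w n M)" using w_nonneg[OF n] by (intro sum_nonneg)
      ultimately show ?thesis using eps by (intro mult_mono) (auto simp: add_pos_pos less_imp_le)
    qed
    finally show ?case by simp
  qed
qed

section \<open>Limit laws of the wedge statistic\<close>

lemma form_char_lim:
  assumes "\<And>n. n \<ge> 1 \<Longrightarrow> 0 \<le> r n \<and> r n \<le> 1" and "(\<lambda>n. r n * sqrt (real n)) \<longlonglongrightarrow> \<theta>"
  shows "(\<lambda>n. measure_pmf.expectation (bernoulli_product (E n) (r n))
      (\<lambda>x. iexp (t * (- (c\<^sup>2 / \<theta>\<^sup>2) / real n * regular_form.form (E n) (line_nb n) (r n) x / 2)))) \<longlonglongrightarrow> of_real (exp (- v * t\<^sup>2 / 2))"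
proof -
  \<comment> \<open>The limit variance \<open>K^2 * \<theta>^2 / 2\<close> at
    \<open>K = - (c^2 / \<theta>^2)\<close>. The density \<open>r\<close> will be \<open>q\<close>
    for the null law and \<open>p\<close> for the unplanted sample of the coupling.\<close>
  have "(- (c\<^sup>2 / \<theta>\<^sup>2))\<^sup>2 * \<theta>\<^sup>2 / 2 = v" using \<theta> by (simp add: v_def power2_eq_square eval_nat_numeral)
  with wedge_form_char_limit[OF assms, of t "- (c\<^sup>2 / \<theta>\<^sup>2)"] show ?thesis by simp
qed

lemma W_char_Q: "(\<lambda>n. char (distr (measure_pmf (QQ n)) borel (W n)) t) \<longlonglongrightarrow> char (gaussian 0 v) t"
  unfolding char_distr_pmf W_def char_gaussian[OF v_pos]
  using form_char_lim[of q t] q_bounds q_lim by (simp add: less_imp_le)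

text \<open>Given a typical \<open>M\<close>, the coupling compares \<open>W\<close> with the
  statistic \<open>Wp\<close> of the unplanted sample plus \<open>v\<close>, with an error
  \<open>err n\<close> that does not depend on \<open>M\<close>. Untypical matchings contribute at
  most twice their probability, as characteristic functions have modulus at most one.\<close>

lemma W_char_P: "(\<lambda>n. char (distr (measure_pmf (PP n)) borel (W n)) t) \<longlonglongrightarrow> char (gaussian v v) t"
proof -
  define Wp where "Wp n x = - (c\<^sup>2 / \<theta>\<^sup>2) / real n * regular_form.form (E n) (line_nb n) (p n) x / 2" for n x
  define B where "B n = bernoulli_product (E n) (p n)" for n
  define target where "target n = measure_pmf.expectation (B n) (\<lambda>x. iexp (t * (Wp n x + v)))" for n
  have intB: "integrable (measure_pmf (B n)) f" for n and f :: "_ \<Rightarrow> 'b::{banach, second_countable_topology}"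
    unfolding B_def by (rule integrable_bernoulli_product[OF complete_edges_finite])
  have "(\<lambda>n. iexp (t * v) * measure_pmf.expectation (B n) (\<lambda>x. iexp (t * Wp n x))) \<longlonglongrightarrow> iexp (t * v) * of_real (exp (- v * t\<^sup>2 / 2))"
    unfolding B_def Wp_def using form_char_lim[of p t] p plim by (intro tendsto_mult tendsto_const) (simp add: less_imp_le)
  moreover have "iexp (t * v) * measure_pmf.expectation (B n) (\<lambda>x. iexp (t * Wp n x)) = target n" for n
    unfolding target_def integral_mult_right_zero[symmetric]
    by (intro Bochner_Integration.integral_cong refl) (simp add: exp_add[symmetric] algebra_simps)
  ultimately have "target \<longlonglongrightarrow> iexp (t * v) * of_real (exp (- v * t\<^sup>2 / 2))" by (simp only:)
  then have tgt: "target \<longlonglongrightarrow> char (gaussian v v) t" unfolding char_gaussian[OF v_pos] .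
  \<comment> \<open>The normalised offset is \<open>C n * ((2 * card M - mean n) / n)\<close>. For
    typical \<open>M\<close> the quotient tends to \<open>c / 2\<close> and \<open>C n\<close> tends
    to \<open>c^3 / \<theta>^2\<close>, so the shift tends to
    \<open>c^4 / (2 * \<theta>^2) = v\<close>.\<close>
  define C where "C n = c\<^sup>2 / \<theta>\<^sup>2 * (1 - p n)\<^sup>2 * (real n * \<pi> n) * ((real n - 2) / real n)" for n
  define err where "err n = c\<^sup>2 / \<theta>\<^sup>2 / 2 * (4 * p n + 2 * sqrt (p n) * (2 + 2 * (real n * \<pi> n))) + (\<bar>C n * (c / 2) - v\<bar> + \<bar>C n\<bar> * ((2 * \<tau> n + sqrt (real n)) / real n))" for n
  have Cl: "C \<longlonglongrightarrow> c\<^sup>2 / \<theta>\<^sup>2 * (1 - 0)\<^sup>2 * c * 1"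
  proof -
    have "(\<lambda>n. (real n - 2) / real n) \<longlonglongrightarrow> 1" by real_asymp
    thus ?thesis unfolding C_def[abs_def] by (intro tendsto_mult tendsto_power tendsto_diff tendsto_const p_lim pi_lim)
  qed
  have "(\<lambda>n. (2 * \<tau> n + sqrt (real n)) / real n) \<longlonglongrightarrow> 0" unfolding \<tau>_def by real_asymp
  then have "err \<longlonglongrightarrow> c\<^sup>2 / \<theta>\<^sup>2 / 2 * (4 * 0 + 2 * sqrt 0 * (2 + 2 * c)) + (\<bar>c\<^sup>2 / \<theta>\<^sup>2 * (1 - 0)\<^sup>2 * c * 1 * (c / 2) - v\<bar> + \<bar>c\<^sup>2 / \<theta>\<^sup>2 * (1 - 0)\<^sup>2 * c * 1\<bar> * 0)"
    unfolding err_def[abs_def] by (intro tendsto_add tendsto_mult tendsto_rabs tendsto_diff tendsto_const tendsto_real_sqrt p_lim pi_lim Cl)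
  moreover have "c\<^sup>2 / \<theta>\<^sup>2 * (1 - 0)\<^sup>2 * c * 1 * (c / 2) = v" by (simp add: v_def eval_nat_numeral)
  ultimately have errl: "err \<longlonglongrightarrow> 0" by simp
  have close: "cmod (measure_pmf.expectation (planted_given (E n) (p n) M) (\<lambda>x. iexp (t * W n x)) - target n) \<le> \<bar>t\<bar> * err n"
    if n: "n \<ge> 2" and M: "M \<in> typical n" for n M
  proof -
    have n1: "n \<ge> 1" using n by simp
    have MK: "M \<in> kmatchings n" using M typical_sub by blast
    have ME: "M \<subseteq> E n" using MK by (auto simp: matchings_def)
    let ?x' = "\<lambda>x e. x e \<or> e \<in> M"
    define F where "F x = regular_form.form (E n) (line_nb n) (q n) (?x' x) - regular_form.form (E n) (line_nb n) (p n) x" for x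
    define off where "off = (1 - p n)\<^sup>2 * \<pi> n * real (2 * (n - 2)) * (\<pi> n * real (card (E n)) - 2 * real (card M))"
    have Fb: "measure_pmf.expectation (B n) (\<lambda>x. \<bar>F x - off\<bar>) \<le> real n * (4 * p n + 2 * sqrt (p n) * (2 + 2 * real n * \<pi> n))"
      using wedge_form_shift[OF MK, of "p n" "\<pi> n"] p[OF n1] pi_bounds[OF n1] unfolding q_pi[OF n1, symmetric] B_def F_def off_def
      by (simp add: less_imp_le)
    define k where "k = c\<^sup>2 / \<theta>\<^sup>2"
    have k0: "0 \<le> k" by (simp add: k_def)
    have Wd: "W n (?x' x) - Wp n x - v = - (k / (2 * real n)) * (F x - off) + (- (k / (2 * real n)) * off - v)" for x
      unfolding W_def Wp_def F_def k_def[symmetric] by (simp add: algebra_simps diff_divide_distrib)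
    have offC: "\<bar>- (k / (2 * real n)) * off - v\<bar> \<le> \<bar>C n * (c / 2) - v\<bar> + \<bar>C n\<bar> * ((2 * \<tau> n + sqrt (real n)) / real n)"
    proof -
      define e where "e = (2 * real (card M) - mean n) / real n - c / 2"
      have "- (k / (2 * real n)) * off = C n * ((2 * real (card M) - mean n) / real n)"
      proof -
        have N: "\<pi> n * real (card (E n)) = mean n" unfolding card_complete_edges by (rule mean_pi[OF n])
        have "real (2 * (n - 2)) = 2 * (real n - 2)" using n by (simp add: of_nat_diff)
        then have "- (k / (2 * real n)) * off = (k * (1 - p n)\<^sup>2 * \<pi> n * (real n - 2)) * ((2 * real (card M) - mean n) / real n)"
          unfolding off_def N using n by (simp add: field_simps)
        moreover have "k * (1 - p n)\<^sup>2 * \<pi> n * (real n - 2) = C n"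
          unfolding C_def k_def using n by simp
        ultimately show ?thesis by simp
      qed
      also have "\<dots> - v = (C n * (c / 2) - v) + C n * e" unfolding e_def by (simp add: algebra_simps)
      finally have eq: "- (k / (2 * real n)) * off - v = (C n * (c / 2) - v) + C n * e" .
      have "\<bar>e\<bar> \<le> (2 * \<tau> n + sqrt (real n)) / real n"
      proof -
        have "e = (2 * (real (card M) - c * real n / 2) - (mean n - c * real n / 2)) / real n"
          unfolding e_def using n by (simp add: field_simps)
        moreover have "\<bar>2 * (real (card M) - c * real n / 2) - (mean n - c * real n / 2)\<bar> \<le> 2 * \<tau> n + sqrt (real n)"
          using M mean_dev[OF n1] by (auto simp: typical_def sizes_def)
        ultimately show ?thesis by (simp add: divide_right_mono)
      qed
      then have "\<bar>C n * e\<bar> \<le> \<bar>C n\<bar> * ((2 * \<tau> n + sqrt (real n)) / real n)" unfolding abs_mult by (rule mult_left_mono) simp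
      thus ?thesis unfolding eq by linarith
    qed
    have "measure_pmf.expectation (planted_given (E n) (p n) M) (\<lambda>x. iexp (t * W n x)) = measure_pmf.expectation (B n) (\<lambda>x. iexp (t * W n (?x' x)))"
      unfolding planted_given_eq_map[OF complete_edges_finite ME] B_def by simp
    then have "cmod (measure_pmf.expectation (planted_given (E n) (p n) M) (\<lambda>x. iexp (t * W n x)) - target n) =
       cmod (measure_pmf.expectation (B n) (\<lambda>x. iexp (t * W n (?x' x)) - iexp (t * (Wp n x + v))))"
      unfolding target_def by (simp only: Bochner_Integration.integral_diff[OF intB intB])
    also have "\<dots> \<le> measure_pmf.expectation (B n) (\<lambda>x. cmod (iexp (t * W n (?x' x)) - iexp (t * (Wp n x + v))))"
      by (rule integral_norm_bound)
    also have "\<dots> \<le> measure_pmf.expectation (B n) (\<lambda>x. \<bar>t\<bar> * (k / (2 * real n) * \<bar>F x - off\<bar> + \<bar>- (k / (2 * real n)) * off - v\<bar>))"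
    proof (intro integral_mono intB)
      fix x
      define a where "a = t * (Wp n x + v)"
      define d where "d = t * (W n (?x' x) - Wp n x - v)"
      have "t * W n (?x' x) = a + d" by (simp add: a_def d_def algebra_simps)
      then have "iexp (t * W n (?x' x)) - iexp a = iexp a * (iexp d - 1)" by (simp add: exp_add algebra_simps)
      then have "cmod (iexp (t * W n (?x' x)) - iexp a) = cmod (iexp d - 1)" by (simp only: norm_mult norm_exp_i_times mult_1)
      also have "\<dots> \<le> \<bar>d\<bar>" using iexp_approx1[of d 0] by simp
      also have "\<dots> = \<bar>t\<bar> * \<bar>W n (?x' x) - Wp n x - v\<bar>" unfolding d_def by (rule abs_mult)
      also have "\<dots> \<le> \<bar>t\<bar> * (k / (2 * real n) * \<bar>F x - off\<bar> + \<bar>- (k / (2 * real n)) * off - v\<bar>)"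
      proof (rule mult_left_mono)
        have "\<bar>- (k / (2 * real n)) * (F x - off)\<bar> = k / (2 * real n) * \<bar>F x - off\<bar>" using k0 unfolding abs_mult by simp
        then show "\<bar>W n (?x' x) - Wp n x - v\<bar> \<le> k / (2 * real n) * \<bar>F x - off\<bar> + \<bar>- (k / (2 * real n)) * off - v\<bar>"
          unfolding Wd by linarith
      qed simp
      finally show "cmod (iexp (t * W n (?x' x)) - iexp (t * (Wp n x + v))) \<le> \<bar>t\<bar> * (k / (2 * real n) * \<bar>F x - off\<bar> + \<bar>- (k / (2 * real n)) * off - v\<bar>)"
        unfolding a_def .
    qed
    also have "\<dots> = \<bar>t\<bar> * (k / (2 * real n) * measure_pmf.expectation (B n) (\<lambda>x. \<bar>F x - off\<bar>) + \<bar>- (k / (2 * real n)) * off - v\<bar>)"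
      by (subst integral_mult_right_zero, subst Bochner_Integration.integral_add[OF intB intB], subst integral_mult_right_zero) simp
    also have "\<dots> \<le> \<bar>t\<bar> * err n"
    proof (rule mult_left_mono)
      have "k / (2 * real n) * measure_pmf.expectation (B n) (\<lambda>x. \<bar>F x - off\<bar>) \<le> k / (2 * real n) * (real n * (4 * p n + 2 * sqrt (p n) * (2 + 2 * real n * \<pi> n)))"
        using k0 by (intro mult_left_mono Fb) simp
      also have "\<dots> = k / 2 * (4 * p n + 2 * sqrt (p n) * (2 + 2 * (real n * \<pi> n)))" using n by (simp add: mult.assoc)
      finally show "k / (2 * real n) * measure_pmf.expectation (B n) (\<lambda>x. \<bar>F x - off\<bar>) + \<bar>- (k / (2 * real n)) * off - v\<bar> \<le> err n"
        unfolding err_def k_def[symmetric] using offC by linarith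
    qed simp
    finally show ?thesis .
  qed
  have "(\<lambda>n. char (distr (measure_pmf (PP n)) borel (W n)) t - target n) \<longlonglongrightarrow> 0"
  proof (rule Lim_null_comparison)
    show "eventually (\<lambda>n. norm (char (distr (measure_pmf (PP n)) borel (W n)) t - target n) \<le>
        \<bar>t\<bar> * \<bar>err n\<bar> + 2 * (\<Sum>M\<in>kmatchings n - typical n. w n M)) sequentially"
      using eventually_ge_at_top[of 2]
    proof eventually_elim
      case (elim n)
      then have n1: "n \<ge> 1" by simp
      let ?D = "\<lambda>M. measure_pmf.expectation (planted_given (E n) (p n) M) (\<lambda>x. iexp (t * W n x)) - target n"
      have tsum: "target n = (\<Sum>M\<in>kmatchings n. w n M *\<^sub>R target n)"
        unfolding scaleR_sum_left[symmetric] sum_w[OF n1] by simp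
      have "char (distr (measure_pmf (PP n)) borel (W n)) t - target n = (\<Sum>M\<in>kmatchings n. w n M *\<^sub>R ?D M)"
        unfolding char_distr_pmf expectation_PP[OF n1] by (subst tsum) (simp only: sum_subtractf[symmetric] scaleR_diff_right)
      then have "norm (char (distr (measure_pmf (PP n)) borel (W n)) t - target n) \<le> (\<Sum>M\<in>kmatchings n. norm (w n M *\<^sub>R ?D M))"
        by (simp only: norm_sum)
      also have "\<dots> = (\<Sum>M\<in>kmatchings n. w n M * norm (?D M))"
        using w_nonneg[OF n1] by (intro sum.cong refl) (simp only: norm_scaleR abs_of_nonneg[OF w_nonneg[OF n1]])
      also have "\<dots> = (\<Sum>M\<in>kmatchings n - typical n. w n M * norm (?D M)) + (\<Sum>M\<in>typical n. w n M * norm (?D M))"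
        by (rule sum.subset_diff[OF typical_sub finite_kmatchings])
      also have "\<dots> \<le> (\<Sum>M\<in>kmatchings n - typical n. w n M * 2) + (\<Sum>M\<in>typical n. w n M * (\<bar>t\<bar> * \<bar>err n\<bar>))"
      proof (intro add_mono sum_mono mult_left_mono w_nonneg[OF n1])
        fix M
        have 1: "norm (measure_pmf.expectation N (\<lambda>x. iexp (f x))) \<le> 1" for N :: "(nat set \<Rightarrow> bool) pmf" and f :: "_ \<Rightarrow> real"
        proof -
          have "norm (measure_pmf.expectation N (\<lambda>x. iexp (f x))) \<le> measure_pmf.expectation N (\<lambda>x. norm (iexp (f x)))"
            by (rule integral_norm_bound)
          thus ?thesis by simp
        qed
        show "norm (?D M) \<le> 2"
          unfolding target_def using norm_triangle_ineq4[of "measure_pmf.expectation (planted_given (E n) (p n) M) (\<lambda>x. iexp (t * W n x))" "measure_pmf.expectation (B n) (\<lambda>x. iexp (t * (Wp n x + v)))"]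
            1[of "planted_given (E n) (p n) M" "\<lambda>x. t * W n x"] 1[of "B n" "\<lambda>x. t * (Wp n x + v)"] by linarith
      next
        fix M assume "M \<in> typical n"
        from close[OF elim this] show "norm (?D M) \<le> \<bar>t\<bar> * \<bar>err n\<bar>"
          by (rule order.trans) (intro mult_left_mono, auto)
      qed
      also have "\<dots> \<le> 2 * (\<Sum>M\<in>kmatchings n - typical n. w n M) + 1 * (\<bar>t\<bar> * \<bar>err n\<bar>)"
      proof (rule add_mono)
        have "(\<Sum>M\<in>typical n. w n M) \<le> 1"
          unfolding sum_w[OF n1, symmetric] using finite_kmatchings typical_sub w_nonneg[OF n1] by (intro sum_mono2) auto
        then show "(\<Sum>M\<in>typical n. w n M * (\<bar>t\<bar> * \<bar>err n\<bar>)) \<le> 1 * (\<bar>t\<bar> * \<bar>err n\<bar>)"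
          unfolding sum_distrib_right[symmetric] by (intro mult_right_mono) auto
      qed (simp add: sum_distrib_left mult.commute)
      finally show ?case by simp
    qed
    have "(\<lambda>n. \<bar>t\<bar> * \<bar>err n\<bar> + 2 * (\<Sum>M\<in>kmatchings n - typical n. w n M)) \<longlonglongrightarrow> \<bar>t\<bar> * \<bar>0\<bar> + 2 * 0"
      by (intro tendsto_add tendsto_mult tendsto_const tendsto_rabs errl untypical)
    thus "(\<lambda>n. \<bar>t\<bar> * \<bar>err n\<bar> + 2 * (\<Sum>M\<in>kmatchings n - typical n. w n M)) \<longlonglongrightarrow> 0" by simp
  qed
  from tendsto_add[OF this tgt] show ?thesis by simp
qed

section \<open>Limit laws of the log-likelihood ratio and the testing error\<close>

lemma weak_conv_W:
  "weak_conv_m (\<lambda>n. distr (measure_pmf (QQ n)) borel (W n)) (gaussian 0 v)"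
  "weak_conv_m (\<lambda>n. distr (measure_pmf (PP n)) borel (W n)) (gaussian v v)"
  by (intro levy_continuity real_distribution_distr_pmf real_distribution_gaussian v_pos W_char_Q W_char_P)+

lemma pmf_PP_QQ:
  assumes n: "n \<ge> 1"
  shows "pmf (PP n) x = L n x * pmf (QQ n) x"
proof -
  have "pmf (PP n) x = measure_pmf.expectation (PP n) (indicator {x})"
    by (simp add: measure_pmf_single)
  also have "\<dots> = measure_pmf.expectation (QQ n) (\<lambda>y. L n y * indicator {x} y)" by (rule expectation_PP_QQ[OF n])
  also have "\<dots> = measure_pmf.expectation (QQ n) (\<lambda>y. L n x * indicator {x} y)"
    by (intro Bochner_Integration.integral_cong refl) (auto simp: indicator_def)
  also have "\<dots> = L n x * pmf (QQ n) x" by (simp add: measure_pmf_single)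
  finally show ?thesis .
qed

lemma set_PP_QQ: "n \<ge> 1 \<Longrightarrow> set_pmf (PP n) \<subseteq> set_pmf (QQ n)"
  by (auto simp: set_pmf_eq pmf_PP_QQ)

abbreviation "llr n \<equiv> log_likelihood_ratio (measure_pmf (PP n)) (measure_pmf (QQ n))"

lemma llr_eq: "n \<ge> 1 \<Longrightarrow> x \<in> set_pmf (QQ n) \<Longrightarrow> llr n x = ln (L n x)"
  using log_likelihood_ratio_pmf[OF set_PP_QQ] by (simp add: pmf_PP_QQ set_pmf_eq)

text \<open>The log-likelihood ratio is close to \<open>W - v / 2\<close> in probability under both
  laws, so the limiting means \<open>v\<close> and \<open>0\<close> of \<open>W\<close> become
  \<open>v / 2\<close> and \<open>- (v / 2)\<close>.\<close>

lemma weak_conv_llr: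
  "weak_conv_m (\<lambda>n. distr (measure_pmf (PP n)) borel (llr n)) (gaussian (v / 2) v)"
  "weak_conv_m (\<lambda>n. distr (measure_pmf (QQ n)) borel (llr n)) (gaussian (- (v / 2)) v)"
proof -
  have shift: "char (distr (measure_pmf M) borel (\<lambda>x. f x - v / 2)) t = iexp (- (t * (v / 2))) * char (distr (measure_pmf M) borel f) t"
    for M :: "(nat set \<Rightarrow> bool) pmf" and f t
    unfolding char_distr_pmf integral_mult_right_zero[symmetric]
    by (intro Bochner_Integration.integral_cong refl) (simp add: exp_add[symmetric] algebra_simps)
  note conv = likelihood_ratio_lognormal[where P = PP and Q = QQ and W = W and L = L and LR = LR and v = v,
      OF v_pos finite_set_bernoulli_product[OF complete_edges_finite] expectation_PP_QQ LR_bounds untypical_ratio_lim second_moment_eventually weak_conv_W]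
  \<comment> \<open>\<open>llr n\<close> is known to be \<open>ln (L n x)\<close> only on the
    support of \<open>QQ n\<close>, which contains that of \<open>PP n\<close>.\<close>
  have eqprob: "measure_pmf.prob M {x. \<not> \<bar>ln (L n x) - (W n x - v / 2)\<bar> \<le> \<delta>} = measure_pmf.prob M {x. \<not> \<bar>llr n x - (W n x - v / 2)\<bar> \<le> \<delta>}"
    if n: "n \<ge> 1" and M: "set_pmf M \<subseteq> set_pmf (QQ n)" for M n \<delta>
    by (rule measure_pmf.finite_measure_eq_AE) (use llr_eq[OF n] M in \<open>auto simp: AE_measure_pmf_iff subset_iff\<close>)
  have closeP: "(\<lambda>n. measure_pmf.prob (PP n) {x. \<not> \<bar>llr n x - (W n x - v / 2)\<bar> \<le> \<delta>}) \<longlonglongrightarrow> 0" if "0 < \<delta>" "\<delta> \<le> 1" for \<delta>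
    by (rule Lim_transform_eventually[OF conv(2)[rotated 4, OF that]])
       (auto intro!: eventually_sequentiallyI[of 1] eqprob set_PP_QQ)
  have closeQ: "(\<lambda>n. measure_pmf.prob (QQ n) {x. \<not> \<bar>llr n x - (W n x - v / 2)\<bar> \<le> \<delta>}) \<longlonglongrightarrow> 0" if "0 < \<delta>" "\<delta> \<le> 1" for \<delta>
    by (rule Lim_transform_eventually[OF conv(1)[rotated 4, OF that]])
       (auto intro!: eventually_sequentiallyI[of 1] eqprob)
  have combine: "iexp (- (t * (v / 2))) * char (gaussian a v) t = char (gaussian (a - v / 2) v) t" for a t
    unfolding char_gaussian[OF v_pos] mult.assoc[symmetric] exp_add[symmetric]
    by (intro arg_cong2[where f = "(*)"] arg_cong[where f = exp] refl) (simp add: algebra_simps)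
  have cP: "(\<lambda>n. char (distr (measure_pmf (PP n)) borel (\<lambda>x. W n x - v / 2)) t) \<longlonglongrightarrow> char (gaussian (v - v / 2) v) t" for t
    unfolding shift combine[symmetric] by (intro tendsto_mult tendsto_const W_char_P)
  have cQ: "(\<lambda>n. char (distr (measure_pmf (QQ n)) borel (\<lambda>x. W n x - v / 2)) t) \<longlonglongrightarrow> char (gaussian (0 - v / 2) v) t" for t
    unfolding shift combine[symmetric] by (intro tendsto_mult tendsto_const W_char_Q)
  have "weak_conv_m (\<lambda>n. distr (measure_pmf (PP n)) borel (llr n)) (gaussian (v - v / 2) v)"
    by (intro levy_continuity real_distribution_distr_pmf real_distribution_gaussian v_pos char_distr_limit_perturb[OF cP closeP])
  moreover have "weak_conv_m (\<lambda>n. distr (measure_pmf (QQ n)) borel (llr n)) (gaussian (0 - v / 2) v)"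
    by (intro levy_continuity real_distribution_distr_pmf real_distribution_gaussian v_pos char_distr_limit_perturb[OF cQ closeQ])
  moreover have "v - v / 2 = v / 2" "0 - v / 2 = - (v / 2)" by simp_all
  ultimately show "weak_conv_m (\<lambda>n. distr (measure_pmf (PP n)) borel (llr n)) (gaussian (v / 2) v)"
    "weak_conv_m (\<lambda>n. distr (measure_pmf (QQ n)) borel (llr n)) (gaussian (- (v / 2)) v)" by simp_all
qed

text \<open>The optimal rejection region is \<open>llr > 0\<close> up to null sets, so the total
  variation is a difference of two distribution functions at 0, where both Gaussian limits are
  continuous.\<close>

lemma total_variation_lim:
  "(\<lambda>n. 1 - total_variation (measure_pmf (PP n)) (measure_pmf (QQ n))) \<longlonglongrightarrow> 2 * std_normal_cdf (- (sqrt v / 2))"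
proof -
  have cdf: "(\<lambda>n. cdf (distr (measure_pmf (PP n)) borel (llr n)) 0) \<longlonglongrightarrow> cdf (gaussian (v / 2) v) 0"
    "(\<lambda>n. cdf (distr (measure_pmf (QQ n)) borel (llr n)) 0) \<longlonglongrightarrow> cdf (gaussian (- (v / 2)) v) 0"
    using weak_conv_llr isCont_cdf_gaussian[OF v_pos] unfolding weak_conv_m_def weak_conv_def by blast+
  have sv: "v / 2 / sqrt v = sqrt v / 2" using v_pos real_div_sqrt[of v] by (simp add: field_simps)
  have "cdf (gaussian (v / 2) v) 0 = std_normal_cdf (- (sqrt v / 2))" "cdf (gaussian (- (v / 2)) v) 0 = std_normal_cdf (sqrt v / 2)"
    unfolding cdf_gaussian[OF v_pos] by (simp_all only: diff_0 minus_minus minus_divide_left[symmetric] sv)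
  then have "(\<lambda>n. 1 - (cdf (distr (measure_pmf (QQ n)) borel (llr n)) 0 - cdf (distr (measure_pmf (PP n)) borel (llr n)) 0)) \<longlonglongrightarrow>
     1 - (std_normal_cdf (sqrt v / 2) - std_normal_cdf (- (sqrt v / 2)))"
    using cdf by (intro tendsto_diff tendsto_const) simp_all
  moreover have "1 - (std_normal_cdf (sqrt v / 2) - std_normal_cdf (- (sqrt v / 2))) = 2 * std_normal_cdf (- (sqrt v / 2))"
    by (simp add: std_normal_cdf_minus)
  moreover have "eventually (\<lambda>n. 1 - (cdf (distr (measure_pmf (QQ n)) borel (llr n)) 0 - cdf (distr (measure_pmf (PP n)) borel (llr n)) 0) =
      1 - total_variation (measure_pmf (PP n)) (measure_pmf (QQ n))) sequentially"
  proof (rule eventually_sequentiallyI[of 1])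
    fix n :: nat assume n: "1 \<le> n"
    let ?N = "{x. pmf (QQ n) x < pmf (PP n) x}"
    have N: "measure_pmf.prob M ?N = 1 - cdf (distr (measure_pmf M) borel (llr n)) 0" if M: "set_pmf M \<subseteq> set_pmf (QQ n)" for M
    proof -
      have "measure_pmf.prob M ?N = measure_pmf.prob M (UNIV - {x. llr n x \<le> 0})"
      proof (rule measure_pmf.finite_measure_eq_AE)
        show "AE x in measure_pmf M. (x \<in> ?N) = (x \<in> UNIV - {x. llr n x \<le> 0})"
        proof (rule AE_pmfI)
          fix x assume "x \<in> set_pmf M"
          then have x: "x \<in> set_pmf (QQ n)" using M by blast
          then have pos: "0 < pmf (QQ n) x" by (simp add: set_pmf_iff pmf_pos)
          have L0: "0 \<le> L n x" using LR_bounds[OF n, of x] by linarith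
          have "(x \<in> ?N) = (1 < L n x)" using pos by (simp add: pmf_PP_QQ[OF n])
          \<comment> \<open>\<open>ln 0 = 0\<close>, so both sides are false when the likelihood
            ratio vanishes.\<close>
          also have "\<dots> = (0 < ln (L n x))"
          proof (cases "L n x = 0")
            case False
            then show ?thesis using L0 by simp
          qed simp
          finally show "(x \<in> ?N) = (x \<in> UNIV - {x. llr n x \<le> 0})" using llr_eq[OF n x] by auto
        qed
      qed auto
      also have "\<dots> = 1 - measure_pmf.prob M {x. llr n x \<le> 0}" using measure_pmf.prob_compl[of "{x. llr n x \<le> 0}" M] by simp
      also have "measure_pmf.prob M {x. llr n x \<le> 0} = cdf (distr (measure_pmf M) borel (llr n)) 0"
        unfolding cdf_def by (subst measure_distr) (auto simp: vimage_def)
      finally show ?thesis .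
    qed
    show "1 - (cdf (distr (measure_pmf (QQ n)) borel (llr n)) 0 - cdf (distr (measure_pmf (PP n)) borel (llr n)) 0) =
      1 - total_variation (measure_pmf (PP n)) (measure_pmf (QQ n))"
      unfolding total_variation_pmf(1) N[OF set_PP_QQ[OF n]] N[OF order.refl] by simp
  qed
  ultimately show ?thesis using Lim_transform_eventually by fastforce
qed

end

theorem theorem2p12:
  fixes \<zeta> \<theta> c :: real
    and lam p q :: "nat \<Rightarrow> real"
    and P Q :: "nat \<Rightarrow> adjacency pmf"
  assumes "\<zeta> \<ge> 60" and "\<theta> > 0"
    and "\<And>n. n \<ge> 1 \<Longrightarrow> lam n = 1 / (\<zeta> * real n)"
    and "\<And>n. n \<ge> 1 \<Longrightarrow> 0 < p n \<and> p n < 1"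
    and "(\<lambda>n. p n * sqrt (real n)) \<longlonglongrightarrow> \<theta>"
    and "\<And>n. n \<ge> 1 \<Longrightarrow> q n = p n +
           measure_pmf.expectation (monomer_dimer (lam n) (complete_edges n)) (\<lambda>M. real (card M))
             / real (n choose 2) * (1 - p n)"
    and "c = 1 - 1 / 2 * (sqrt (\<zeta>\<^sup>2 + 4 * \<zeta>) - \<zeta>)"
    and "\<And>n. n \<ge> 1 \<Longrightarrow> P n = planted_matching n (p n) (lam n)"
    and "\<And>n. n \<ge> 1 \<Longrightarrow> Q n = erdos_renyi n (q n)"
  shows "0 < c \<and> c < 1
    \<and> weak_conv_m
        (\<lambda>n. distr (measure_pmf (P n)) borel (log_likelihood_ratio (measure_pmf (P n)) (measure_pmf (Q n))))
        (gaussian (c ^ 4 / (4 * \<theta>\<^sup>2)) (c ^ 4 / (2 * \<theta>\<^sup>2)))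
    \<and> weak_conv_m
        (\<lambda>n. distr (measure_pmf (Q n)) borel (log_likelihood_ratio (measure_pmf (P n)) (measure_pmf (Q n))))
        (gaussian (- (c ^ 4 / (4 * \<theta>\<^sup>2))) (c ^ 4 / (2 * \<theta>\<^sup>2)))
    \<and> (\<forall>n\<ge>1. (INF \<psi> :: adjacency \<Rightarrow> bool.
                  measure_pmf.prob (P n) {A. \<not> \<psi> A} + measure_pmf.prob (Q n) {A. \<psi> A})
                = 1 - total_variation (measure_pmf (P n)) (measure_pmf (Q n)))
    \<and> (\<lambda>n. 1 - total_variation (measure_pmf (P n)) (measure_pmf (Q n)))
        \<longlonglongrightarrow> 2 * std_normal_cdf (- (c\<^sup>2 / (2 * sqrt 2 * \<theta>)))"
proof -
  interpret planted_model \<zeta> \<theta> c lam p q using assms(1-7) by unfold_locales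
  have PQ: "P n = PP n" "Q n = QQ n" if "n \<ge> 1" for n
    using assms(8,9)[OF that] by (simp_all add: erdos_renyi_def bernoulli_product_def)
  have ev: "eventually (\<lambda>n. P n = PP n \<and> Q n = QQ n) sequentially"
    by (rule eventually_sequentiallyI[of 1]) (simp add: PQ)
  have v2: "c ^ 4 / (4 * \<theta>\<^sup>2) = v / 2" "c ^ 4 / (2 * \<theta>\<^sup>2) = v" by (simp_all add: v_def)
  \<comment> \<open>\<open>P\<close> and \<open>Q\<close> are specified only for
    \<open>n >= 1\<close>, so the limits are transferred along eventual equality.\<close>
  have weak_cong: "weak_conv_m F G" if "weak_conv_m F' G" "eventually (\<lambda>n. F' n = F n) sequentially" for F F' :: "nat \<Rightarrow> real measure" and G
    unfolding weak_conv_m_def weak_conv_def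
  proof (intro allI impI)
    fix x assume "isCont (cdf G) x"
    then have "(\<lambda>n. cdf (F' n) x) \<longlonglongrightarrow> cdf G x" using that(1) by (simp add: weak_conv_m_def weak_conv_def)
    moreover have "eventually (\<lambda>n. cdf (F' n) x = cdf (F n) x) sequentially" using that(2) by eventually_elim simp
    ultimately show "(\<lambda>n. cdf (F n) x) \<longlonglongrightarrow> cdf G x" by (rule Lim_transform_eventually)
  qed
  have 1: "weak_conv_m (\<lambda>n. distr (measure_pmf (P n)) borel (log_likelihood_ratio (measure_pmf (P n)) (measure_pmf (Q n)))) (gaussian (v / 2) v)"
    by (rule weak_cong[OF weak_conv_llr(1)]) (use ev in eventually_elim, simp)
  have 2: "weak_conv_m (\<lambda>n. distr (measure_pmf (Q n)) borel (log_likelihood_ratio (measure_pmf (P n)) (measure_pmf (Q n)))) (gaussian (- (v / 2)) v)"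
    by (rule weak_cong[OF weak_conv_llr(2)]) (use ev in eventually_elim, simp)
  have "sqrt v / 2 = c\<^sup>2 / (2 * sqrt 2 * \<theta>)"
  proof -
    have "sqrt v = c\<^sup>2 / (sqrt 2 * \<theta>)"
      using \<open>\<theta> > 0\<close> by (intro real_sqrt_unique) (auto simp: v_def power_divide power_mult_distrib)
    thus ?thesis by simp
  qed
  moreover have "(\<lambda>n. 1 - total_variation (measure_pmf (P n)) (measure_pmf (Q n))) \<longlonglongrightarrow> 2 * std_normal_cdf (- (sqrt v / 2))"
    by (rule Lim_transform_eventually[OF total_variation_lim]) (use ev in eventually_elim, simp)
  ultimately have 3: "(\<lambda>n. 1 - total_variation (measure_pmf (P n)) (measure_pmf (Q n))) \<longlonglongrightarrow> 2 * std_normal_cdf (- (c\<^sup>2 / (2 * sqrt 2 * \<theta>)))"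
    by (simp only:)
  show ?thesis
    unfolding v2 using c_bounds 1 2 3 total_variation_pmf(2) by auto
qed

end
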